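(* Let $T>0$, $Q(T)\coloneqq(0,T)\times(0,1)$, $H\coloneqq L^2(0,1)$, $X\coloneqq H^1(0,1)$. Assume $h,b$ satisfy (A1) $h\in C^2(\mathbb{R})$, $C_{h,1}\le h'\le C_{h,2}$, $|h''|\le C_{h,2}$ and (A2) $b\in C^2(\mathbb{R})$, $C_{b,1}\le b\le C_{b,2}$, $|b'|,|b''|\le C_{b,2}$ on $\mathbb{R}$, for positive constants $C_{h,1},C_{h,2},C_{b,1},C_{b,2}$; let $p\in W^{1,2}(0,T;H)\cap L^\infty(0,T;L^\infty(0,1))\cap L^2(0,T;X)$ and $v_0\in X$. Let $v\in W^{1,2}(0,T;H)\cap L^\infty(0,T;X)\cap L^2(0,T;H^2(0,1))$ be the unique strong solution of $\partial_t h(v)=\partial_x(\partial_x v+b(v)p)$ in $Q(T)$, $\partial_x v+b(v)p=0$ at $x=0,1$, $v(0,\cdot)=v_0$ on $(0,1)$. For $n\in\mathbb{N}$, $n\ge3$, let $v^{(n)}$ and $\widetilde v^{(n)}$ be the finite volume approximate solution and its discrete derivative defined in the context. Then there exists $C=C(h,b,p,v_0,T)>0$, independent of $n$, such that for all $n\ge 3$ and all $t\in[0,T]$, \[ |v-v^{(n)}|^2_{L^\infty(0,T;H)}+\int_0^t|\partial_x v(\tau,\cdot)-\widetilde v^{(n)}(\tau,\cdot)|^2_{L^2(\Delta x^{(n)},1)}\,d\tau\le C(\Delta x^{(n)})^{1/2}. \]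
   Context: Finite volume scheme: for $n\ge3$ set $\Delta x^{(n)}=1/n$, $x_i^{(n)}=i\Delta x^{(n)}$, $V_i^{(n)}=[x_{i-1}^{(n)},x_i^{(n)})$ for $i=1,\dots,n-1$ and $V_n^{(n)}=[x_{n-1}^{(n)},1]$, and let $\chi_i^{(n)}$ be the characteristic function of $V_i^{(n)}$. Set $p_i^{(n)}(t)=\frac{1}{\Delta x^{(n)}}\int_{V_i^{(n)}}p(t,x)\,dx$ and $v_{0,i}^{(n)}=\frac1{\Delta x^{(n)}}\int_{V_i^{(n)}}v_0\,dx$. Writing $\Delta x=\Delta x^{(n)}$ and $F_i=\frac{v_{i+1}-v_i}{\Delta x}+b\big(\frac{v_i+v_{i+1}}{2}\big)p_i^{(n)}$ for $i=1,\dots,n-1$, $(v_1^{(n)},\dots,v_n^{(n)})\in(C([0,T]))^n$ is the (unique) solution on $[0,T]$ of the ODE system $h'(v_1)\frac{d}{dt}v_1=\frac{1}{\Delta x}F_1$, $h'(v_i)\frac{d}{dt}v_i=\frac1{\Delta x}(F_i-F_{i-1})$ for $i=2,\dots,n-1$, $h'(v_n)\frac{d}{dt}v_n=-\frac1{\Delta x}F_{n-1}$, with $v_i(0)=v_{0,i}^{(n)}$. The approximate solution is $v^{(n)}(t,x)=\sum_{i=1}^n\chi_i^{(n)}(x)v_i^{(n)}(t)$. Define $\delta_x v^{(n)}(t,x)=\frac{v^{(n)}(t,x)-v^{(n)}(t,x-\Delta x)}{\Delta x}$ and $\widetilde v^{(n)}(t,x)=0$ for $0\le x<\Delta x$, $\widetilde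 v^{(n)}(t,x)=\delta_x v^{(n)}(t,x)$ for $\Delta x\le x\le1$. *)

theory Defs
  imports "HOL-Analysis.Analysis" "HOL-Probability.Essential_Supremum"
begin

definition C2 :: "(real \<Rightarrow> real) \<Rightarrow> bool" where
  "C2 f \<longleftrightarrow> (\<forall>x. f differentiable (at x)) \<and> (\<forall>x. deriv f differentiable (at x))
           \<and> continuous_on UNIV (deriv (deriv f))"

definition sq_int :: "'a::euclidean_space set \<Rightarrow> ('a \<Rightarrow> real) \<Rightarrow> bool" where
  "sq_int S f \<longleftrightarrow> set_borel_measurable lborel S f \<and> set_integrable lborel S (\<lambda>z. (f z)\<^sup>2)"

definition loc_int :: "'a::euclidean_space set \<Rightarrow> ('a \<Rightarrow> real) \<Rightarrow> bool" where
  "loc_int S f \<longleftrightarrow> (\<forall>K. compact K \<and> K \<subseteq> S \<longrightarrow> set_integrable lborel K f)"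

definition test1 :: "real set \<Rightarrow> (real \<Rightarrow> real) \<Rightarrow> bool" where
  "test1 S \<phi> \<longleftrightarrow> (\<forall>k x. ((deriv ^^ k) \<phi>) differentiable (at x))
     \<and> compact (closure {x. \<phi> x \<noteq> 0}) \<and> closure {x. \<phi> x \<noteq> 0} \<subseteq> S"

definition weak_deriv1 :: "real set \<Rightarrow> (real \<Rightarrow> real) \<Rightarrow> (real \<Rightarrow> real) \<Rightarrow> bool" where
  "weak_deriv1 S f g \<longleftrightarrow> loc_int S f \<and> loc_int S g \<and>
     (\<forall>\<phi>. test1 S \<phi> \<longrightarrow>
        (LINT x:S|lborel. f x * deriv \<phi> x) = - (LINT x:S|lborel. g x * \<phi> x))"

definition pd_t :: "(real \<times> real \<Rightarrow> real) \<Rightarrow> real \<times> real \<Rightarrow> real" where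
  "pd_t \<phi> = (\<lambda>(t,x). deriv (\<lambda>s. \<phi> (s,x)) t)"
definition pd_x :: "(real \<times> real \<Rightarrow> real) \<Rightarrow> real \<times> real \<Rightarrow> real" where
  "pd_x \<phi> = (\<lambda>(t,x). deriv (\<lambda>y. \<phi> (t,y)) x)"

definition iter_pd :: "bool list \<Rightarrow> (real \<times> real \<Rightarrow> real) \<Rightarrow> real \<times> real \<Rightarrow> real" where
  "iter_pd ws \<phi> = fold (\<lambda>w f. if w then pd_t f else pd_x f) ws \<phi>"

definition test2 :: "(real \<times> real) set \<Rightarrow> (real \<times> real \<Rightarrow> real) \<Rightarrow> bool" where
  "test2 S \<phi> \<longleftrightarrow> (\<forall>ws. continuous_on UNIV (iter_pd ws \<phi>)
        \<and> (\<forall>t x. (\<lambda>s. iter_pd ws \<phi> (s,x)) differentiable (at t))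
        \<and> (\<forall>t x. (\<lambda>y. iter_pd ws \<phi> (t,y)) differentiable (at x)))
     \<and> compact (closure {z. \<phi> z \<noteq> 0}) \<and> closure {z. \<phi> z \<noteq> 0} \<subseteq> S"

definition weak_dt :: "(real \<times> real) set \<Rightarrow> (real \<Rightarrow> real \<Rightarrow> real) \<Rightarrow> (real \<Rightarrow> real \<Rightarrow> real) \<Rightarrow> bool" where
  "weak_dt S f g \<longleftrightarrow> loc_int S (\<lambda>(t,x). f t x) \<and> loc_int S (\<lambda>(t,x). g t x) \<and>
     (\<forall>\<phi>. test2 S \<phi> \<longrightarrow>
        (LINT z:S|lborel. (case z of (t,x) \<Rightarrow> f t x) * pd_t \<phi> z)
          = - (LINT z:S|lborel. (case z of (t,x) \<Rightarrow> g t x) * \<phi> z))"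

definition weak_dx :: "(real \<times> real) set \<Rightarrow> (real \<Rightarrow> real \<Rightarrow> real) \<Rightarrow> (real \<Rightarrow> real \<Rightarrow> real) \<Rightarrow> bool" where
  "weak_dx S f g \<longleftrightarrow> loc_int S (\<lambda>(t,x). f t x) \<and> loc_int S (\<lambda>(t,x). g t x) \<and>
     (\<forall>\<phi>. test2 S \<phi> \<longrightarrow>
        (LINT z:S|lborel. (case z of (t,x) \<Rightarrow> f t x) * pd_x \<phi> z)
          = - (LINT z:S|lborel. (case z of (t,x) \<Rightarrow> g t x) * \<phi> z))"

definition QT :: "real \<Rightarrow> (real \<times> real) set" where
  "QT T = {0<..<T} \<times> {0<..<1}"

definition L2Q :: "real \<Rightarrow> (real \<Rightarrow> real \<Rightarrow> real) \<Rightarrow> bool" where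
  "L2Q T f \<longleftrightarrow> sq_int (QT T) (\<lambda>(t,x). f t x)"

definition cont_L2 :: "real \<Rightarrow> (real \<Rightarrow> real \<Rightarrow> real) \<Rightarrow> bool" where
  "cont_L2 T f \<longleftrightarrow> (\<forall>t\<in>{0..T}. sq_int {0<..<1} (f t)) \<and>
     (\<forall>s\<in>{0..T}. ((\<lambda>t. LINT x:{0<..<1}|lborel. (f t x - f s x)\<^sup>2) \<longlongrightarrow> 0) (at s within {0..T}))"

definition dx :: "nat \<Rightarrow> real" where "dx n = 1 / real n"

definition cell :: "nat \<Rightarrow> nat \<Rightarrow> real set" where
  "cell n i = (if i < n then {real (i - 1) * dx n ..< real i * dx n}
               else {real (n - 1) * dx n .. 1})"

definition cavg :: "nat \<Rightarrow> nat \<Rightarrow> (real \<Rightarrow> real) \<Rightarrow> real" where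
  "cavg n i f = (1 / dx n) * (LINT x:cell n i|lborel. f x)"

text \<open>Flux F_i(t), for i = 1..n-1 (0 otherwise, so that F_0 = F_n = 0 in the scheme).\<close>
definition flux :: "(real \<Rightarrow> real) \<Rightarrow> (real \<Rightarrow> real \<Rightarrow> real) \<Rightarrow> nat \<Rightarrow> (nat \<Rightarrow> real \<Rightarrow> real)
                    \<Rightarrow> nat \<Rightarrow> real \<Rightarrow> real" where
  "flux b p n vs i t = (if 1 \<le> i \<and> i \<le> n - 1 then
      (vs (i+1) t - vs i t) / dx n + b ((vs i t + vs (i+1) t) / 2) * cavg n i (p t)
    else 0)"

definition fv_solution :: "(real \<Rightarrow> real) \<Rightarrow> (real \<Rightarrow> real) \<Rightarrow> (real \<Rightarrow> real \<Rightarrow> real) \<Rightarrow> (real \<Rightarrow> real)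
                           \<Rightarrow> real \<Rightarrow> nat \<Rightarrow> (nat \<Rightarrow> real \<Rightarrow> real) \<Rightarrow> bool" where
  "fv_solution h b p v0 T n vs \<longleftrightarrow>
     (\<forall>i\<in>{1..n}. continuous_on {0..T} (vs i) \<and> vs i 0 = cavg n i v0 \<and>
        (\<forall>t\<in>{0..T}. \<exists>d. (vs i has_real_derivative d) (at t within {0..T}) \<and>
           deriv h (vs i t) * d = (flux b p n vs i t - flux b p n vs (i - 1) t) / dx n))"

definition vapprox :: "nat \<Rightarrow> (nat \<Rightarrow> real \<Rightarrow> real) \<Rightarrow> real \<Rightarrow> real \<Rightarrow> real" where
  "vapprox n vs t x = (\<Sum>i=1..n. indicator (cell n i) x * vs i t)"

definition vtilde :: "nat \<Rightarrow> (nat \<Rightarrow> real \<Rightarrow> real) \<Rightarrow> real \<Rightarrow> real \<Rightarrow> real" where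
  "vtilde n vs t x = (if 0 \<le> x \<and> x < dx n then 0
       else (vapprox n vs t x - vapprox n vs t (x - dx n)) / dx n)"

end

theory Submission
  imports Defs
begin

text \<open>Write \<open>y\<^sub>i\<close> for the mean of \<open>v(t)\<close> over the \<open>i\<close>-th cell, \<open>z\<^sub>i\<close> for the numerical solution and
  \<open>w = v\<^sub>x + b(v) p\<close> for the flux. The error is measured by \<open>e\<^sub>i = mean(h(v)) - h(z\<^sub>i)\<close>, because its time
  derivative is exactly a difference of fluxes divided by \<open>\<Delta>x\<close>. Multiplying by \<open>e\<^sub>i\<close> and summing by
  parts gives dissipation of the differences \<open>D\<^sub>i\<close> of \<open>y - z\<close>; the difference of \<open>h(y) - h(z)\<close> is
  split so that only the exact solution is differentiated, so no a priori bound on \<open>z\<close> is needed.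
  With \<open>\<Gamma>(t) = \<parallel>v\<^sub>x\<parallel>\<^sup>2 + \<parallel>v\<^sub>x\<^sub>x\<parallel>\<^sup>2 + \<parallel>p\<^sub>x\<parallel>\<^sup>2\<close>, which is integrable in time, all consistency errors
  are \<open>O(\<Delta>x (1 + \<Gamma>))\<close> in the square and the Gronwall coefficient is \<open>O(1 + \<Gamma>)\<close>; this even
  yields the rate \<open>\<Delta>x\<close>.

  The regularity of \<open>v\<close> and \<open>p\<close> is only weak. Testing with tensor products of bump functions shows that
  almost every time slice of \<open>v\<close>, \<open>v\<^sub>x\<close>, \<open>p\<close> is absolutely continuous. The weak time derivative of
  \<open>h(v)\<close> is eliminated from the equation, which avoids a chain rule, and the initial error is controlled
  through the continuity of \<open>v\<close> in \<open>L\<^sup>2\<close>.\<close>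

section \<open>Smooth functions on the line\<close>

text \<open>What shapes the estimates is that \<open>\<Gamma>\<close> is merely integrable in time:
  it may enter squared errors only to the first power, since \<open>\<Gamma>^2\<close> need be
  neither integrable nor usable as a Gronwall coefficient. The first power comes from
  one-dimensional embeddings: \<open>sup |v_x|^2 <= 4 * \<Gamma>\<close>, and functions with square
  integrable derivative are Hoelder of exponent 1/2, so oscillations over a cell have size
  \<open>sqrt (dx n * \<Gamma>)\<close>. The delicate term is the gap
  \<open>r_i = mean(h(v)) - h(y_i)\<close>, present because \<open>h(v)\<close> evolves while the
  flux contains \<open>v\<close>. The gap itself is controlled by the bound on \<open>v_x\<close>
  that is uniform in time. Its difference quotient is harder: the gap is quadratic in
  \<open>v - y_i\<close>, and one factor is bounded uniformly in time, the other by
  \<open>dx n * sup |v_x|\<close>, so the squared quotient is again linear in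
  \<open>\<Gamma>\<close>. No boundary terms arise in the summation by parts, as exact and numerical
  flux both vanish at the two ends.\<close>

primrec diff_upto :: "nat \<Rightarrow> (real \<Rightarrow> real) \<Rightarrow> bool" where
  "diff_upto 0 f = True"
| "diff_upto (Suc k) f = ((\<forall>x. f differentiable (at x)) \<and> diff_upto k (deriv f))"

definition smooth :: "(real \<Rightarrow> real) \<Rightarrow> bool" where
  "smooth f \<longleftrightarrow> (\<forall>k. diff_upto k f)"

lemma smooth_differentiable: "smooth f \<Longrightarrow> f differentiable (at x)"
  unfolding smooth_def by (metis diff_upto.simps(2))

lemma smooth_DERIV: "smooth f \<Longrightarrow> (f has_real_derivative deriv f x) (at x)"
  using smooth_differentiable DERIV_deriv_iff_real_differentiable by blast

lemma smooth_deriv: "smooth f \<Longrightarrow> smooth (deriv f)"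
  unfolding smooth_def by (metis diff_upto.simps(2))

lemma smooth_continuous: "smooth f \<Longrightarrow> continuous_on S f"
  by (intro continuous_at_imp_continuous_on ballI DERIV_isCont[OF smooth_DERIV])

text \<open>Smoothness passes from a derivative to its primitive; functions obtained by integration,
  such as the smooth step and the test function in the du Bois-Reymond argument, are handled this
  way.\<close>

lemma smoothI_deriv:
  assumes "\<And>x. (f has_real_derivative g x) (at x)" and "smooth g"
  shows "smooth f"
proof -
  have "deriv f = g"
    using assms(1) by (auto intro!: ext DERIV_imp_deriv)
  then have "diff_upto (Suc k) f" for k
    using assms by (auto simp: smooth_def real_differentiable_def)
  then show ?thesis
    unfolding smooth_def by (metis diff_upto.simps(1) not0_implies_Suc)
qed

lemma diff_upto_SucD: "diff_upto (Suc k) f \<Longrightarrow> diff_upto k f"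
  by (induction k arbitrary: f) auto

lemma diff_upto_add:
  "diff_upto k f \<Longrightarrow> diff_upto k g \<Longrightarrow> diff_upto k (\<lambda>x. f x + g x)"
proof (induction k arbitrary: f g)
  case (Suc k)
  have "deriv (\<lambda>x. f x + g x) = (\<lambda>x. deriv f x + deriv g x)"
    using Suc.prems by (auto intro!: ext DERIV_imp_deriv DERIV_add simp: DERIV_deriv_iff_real_differentiable)
  then show ?case
    using Suc by auto
qed auto

lemma diff_upto_const: "diff_upto k (\<lambda>x. c)"
  by (induction k arbitrary: c) auto

text \<open>The product rule brings back \<open>f\<close> and \<open>g\<close> themselves next to
  their derivatives, so the induction also needs that \<open>diff_upto\<close> is monotone in the
  order.\<close>

lemma diff_upto_mult:
  "diff_upto k f \<Longrightarrow> diff_upto k g \<Longrightarrow> diff_upto k (\<lambda>x. f x * g x)"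
proof (induction k arbitrary: f g)
  case (Suc k)
  have "deriv (\<lambda>x. f x * g x) = (\<lambda>x. f x * deriv g x + deriv f x * g x)"
    using Suc.prems by (auto intro!: ext DERIV_imp_deriv DERIV_mult' simp: DERIV_deriv_iff_real_differentiable)
  moreover have "diff_upto k f" "diff_upto k g"
    using Suc.prems by (blast intro: diff_upto_SucD)+
  ultimately show ?case
    using Suc by (auto intro!: diff_upto_add)
qed auto

lemma diff_upto_affine:
  "diff_upto k f \<Longrightarrow> diff_upto k (\<lambda>x. f (c * x + d))"
proof (induction k arbitrary: f)
  case (Suc k)
  have D: "((\<lambda>x. f (c * x + d)) has_real_derivative c * deriv f (c * x + d)) (at x)" for x
  proof -
    have "(f has_real_derivative deriv f (c * x + d)) (at (c * x + d))"
      using Suc.prems by (auto simp: DERIV_deriv_iff_real_differentiable)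
    moreover have "((\<lambda>x. c * x + d) has_real_derivative c) (at x)"
      by (auto intro!: derivative_eq_intros)
    ultimately show ?thesis
      using DERIV_chain2 by (fastforce simp: mult.commute)
  qed
  then have "deriv (\<lambda>x. f (c * x + d)) = (\<lambda>x. c * deriv f (c * x + d))"
    by (auto intro!: ext DERIV_imp_deriv)
  moreover have "diff_upto k (\<lambda>x. c * deriv f (c * x + d))"
    using Suc by (auto intro!: diff_upto_mult diff_upto_const)
  ultimately show ?case
    using D by (auto simp: real_differentiable_def)
qed auto

lemma smooth_add: "smooth f \<Longrightarrow> smooth g \<Longrightarrow> smooth (\<lambda>x. f x + g x)"
  and smooth_const: "smooth (\<lambda>x. c)"
  and smooth_mult: "smooth f \<Longrightarrow> smooth g \<Longrightarrow> smooth (\<lambda>x. f x * g x)"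
  and smooth_affine: "smooth f \<Longrightarrow> smooth (\<lambda>x. f (a * x + d))"
  unfolding smooth_def by (simp_all add: diff_upto_add diff_upto_const diff_upto_mult diff_upto_affine)

lemma smooth_diff: "smooth f \<Longrightarrow> smooth g \<Longrightarrow> smooth (\<lambda>x. f x - g x)"
  using smooth_add[of f "\<lambda>x. (-1) * g x"] smooth_mult[OF smooth_const, of g "-1"] by simp

lemma deriv_affine:
  assumes "smooth f" shows "deriv (\<lambda>x. f (a * x + d)) = (\<lambda>x. a * deriv f (a * x + d))"
proof -
  have "((\<lambda>x. f (a * x + d)) has_real_derivative deriv f (a * x + d) * a) (at x)" for x
    by (rule DERIV_chain2[OF smooth_DERIV[OF assms]]) (auto intro!: derivative_eq_intros)
  then show ?thesis
    by (auto intro!: ext DERIV_imp_deriv simp: mult.commute)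
qed

section \<open>The flat functions \<open>x^(-m) * exp (-1/x)\<close> and a smooth step built from
  them\<close>

definition flat :: "nat \<Rightarrow> real \<Rightarrow> real" where
  "flat m x = (if x > 0 then inverse x ^ m * exp (- inverse x) else 0)"

lemma flat_tendsto_0: "(flat m \<longlongrightarrow> 0) (at 0)"
proof -
  have "((\<lambda>x::real. x ^ m / exp x) \<longlongrightarrow> 0) at_top"
    by (rule tendsto_power_div_exp_0)
  then have "((\<lambda>x::real. inverse x ^ m / exp (inverse x)) \<longlongrightarrow> 0) (at_right 0)"
    by (rule filterlim_compose[OF _ filterlim_inverse_at_top_right])
  then have "(flat m \<longlongrightarrow> 0) (at_right 0)"
    by (rule Lim_transform_eventually)
      (auto simp: flat_def eventually_at_right_field exp_minus divide_inverse intro!: exI[of _ 1])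
  moreover have "(flat m \<longlongrightarrow> 0) (at_left 0)"
    by (rule tendsto_eventually) (auto simp: flat_def eventually_at_left_field intro!: exI[of _ "-1"])
  ultimately show ?thesis
    by (simp add: filterlim_split_at)
qed

text \<open>The family is closed under differentiation up to linear combinations, so smoothness of
  all members follows by one induction over the order, without a formula for higher
  derivatives.\<close>

lemma DERIV_flat:
  "(flat m has_real_derivative flat (m + 2) x - real m * flat (m + 1) x) (at x)"
proof (cases x "0::real" rule: linorder_cases)
  case less
  have "((\<lambda>x. 0) has_real_derivative 0) (at x)" by simp
  then have "(flat m has_real_derivative 0) (at x)"
    by (rule has_field_derivative_transform_within_open[of _ _ _ "{..<0}"]) (use less in \<open>auto simp: flat_def\<close>)
  with less show ?thesis by (simp add: flat_def)
next
  case equal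
  \<comment> \<open>At the origin the difference quotient of \<open>flat m\<close> is
    \<open>flat (m + 1)\<close>, which tends to 0.\<close>
  have "((\<lambda>h. (flat m (0 + h) - flat m 0) / h) \<longlongrightarrow> 0) (at 0)"
    by (rule Lim_transform_eventually[OF flat_tendsto_0[of "m+1"]])
       (auto simp: flat_def eventually_at divide_inverse intro!: exI[of _ 1])
  then show ?thesis
    using equal unfolding DERIV_def by (simp add: flat_def)
next
  case greater
  have "((\<lambda>x. inverse x ^ m) has_real_derivative - real m * inverse x ^ (m + 1)) (at x)"
  proof (cases m)
    case (Suc k)
    have "((\<lambda>x. inverse x ^ Suc k) has_real_derivative
        (1 + real k) * ((- (inverse x ^ Suc (Suc 0))) * inverse x ^ k)) (at x)"
      by (rule DERIV_power_Suc[OF DERIV_inverse]) (use greater in auto)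
    then show ?thesis
      unfolding Suc by (rule DERIV_cong) (simp add: algebra_simps)
  qed auto
  moreover have "((\<lambda>x. exp (- inverse x)) has_real_derivative exp (- inverse x) * inverse x ^ 2) (at x)"
    using greater by (auto intro!: derivative_eq_intros simp: power2_eq_square)
  ultimately have "((\<lambda>x. inverse x ^ m * exp (- inverse x)) has_real_derivative
      inverse x ^ m * (exp (- inverse x) * inverse x ^ 2)
      + (- real m * inverse x ^ (m + 1)) * exp (- inverse x)) (at x)"
    by (rule DERIV_mult')
  then have "((\<lambda>x. inverse x ^ m * exp (- inverse x)) has_real_derivative
      flat (m + 2) x - real m * flat (m + 1) x) (at x)"
    by (rule DERIV_cong) (use greater in \<open>simp add: flat_def power_add algebra_simps power2_eq_square\<close>)
  then show ?thesis
    by (rule has_field_derivative_transform_within_open[of _ _ _ "{0<..}"]) (use greater in \<open>auto simp: flat_def\<close>)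
qed

lemma smooth_flat: "smooth (flat m)"
proof -
  have "diff_upto k (flat m)" for k
  proof (induction k arbitrary: m)
    case (Suc k)
    have "deriv (flat m) = (\<lambda>x. flat (m + 2) x + (- real m) * flat (m + 1) x)"
      using DERIV_flat[of m] by (auto intro!: ext DERIV_imp_deriv)
    moreover have "diff_upto k (\<lambda>x. flat (m + 2) x + (- real m) * flat (m + 1) x)"
      by (intro diff_upto_add diff_upto_mult diff_upto_const Suc)
    ultimately show ?case
      using DERIV_flat[of m] by (auto simp: real_differentiable_def)
  qed auto
  then show ?thesis by (simp add: smooth_def)
qed

lemma continuous_primitive:
  fixes f :: "real \<Rightarrow> real"
  assumes "continuous_on UNIV f"
  obtains F where "\<And>x. (F has_real_derivative f x) (at x)" "F 0 = 0"
proof -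
  define F where "F = (\<lambda>u::real. LBINT y=0..u. f y)"
  have "(F has_real_derivative f x) (at x)" for x
  proof -
    \<comment> \<open>The compact interval has 0 and \<open>x\<close> in its interior, so the
      derivative within it is a full derivative at \<open>x\<close>.\<close>
    define a b where "a = - \<bar>x\<bar> - 1" and "b = \<bar>x\<bar> + 1"
    have "(F has_vector_derivative f x) (at x within {a..b})"
      unfolding F_def zero_ereal_def
      by (rule interval_integral_FTC2) (use assms continuous_on_subset in \<open>auto simp: a_def b_def\<close>)
    then show ?thesis
      by (simp add: at_within_Icc_at a_def b_def has_real_derivative_iff_has_vector_derivative)
  qed
  moreover have "F 0 = 0"
    by (simp add: F_def flip: zero_ereal_def)
  ultimately show ?thesis by (rule that)
qed

text \<open>Take the primitive of a nonnegative bump on \<open>[0, 1]\<close> and divide by its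
  total mass; the mass is positive by the mean value theorem, as the bump is positive
  inside.\<close>

lemma smooth_step_exists:
  "\<exists>\<psi>. smooth \<psi> \<and> (\<forall>x\<le>0. \<psi> x = 0) \<and> (\<forall>x\<ge>1. \<psi> x = 1) \<and> (\<forall>x. 0 \<le> deriv \<psi> x)"
proof -
  define B where "B = (\<lambda>x. flat 0 x * flat 0 ((-1) * x + 1))"
  have sm: "smooth B"
    unfolding B_def by (intro smooth_mult smooth_affine smooth_flat)
  have B0: "0 \<le> B x" and Bpos: "0 < x \<Longrightarrow> x < 1 \<Longrightarrow> 0 < B x"
    and Bz: "x \<le> 0 \<or> 1 \<le> x \<Longrightarrow> B x = 0" for x
    by (auto simp: B_def flat_def)
  obtain F where F: "\<And>x. (F has_real_derivative B x) (at x)" and F0: "F 0 = 0"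
    using continuous_primitive[OF smooth_continuous[OF sm]] by blast
  have F1: "F 0 < F 1"
  proof -
    obtain z where "0 < z" "z < 1" "F 1 - F 0 = (1 - 0) * B z"
      using MVT2[of 0 1 F B] F by auto
    then show ?thesis using Bpos[of z] by simp
  qed
  have Fl: "F x = 0" if "x \<le> 0" for x
  proof (cases "x < 0")
    case True
    obtain z where "z < 0" "F 0 - F x = (0 - x) * B z"
      using MVT2[OF True, of F B] F by blast
    then show ?thesis using Bz[of z] F0 by simp
  qed (use that F0 in auto)
  have Fr: "F x = F 1" if "x \<ge> 1" for x
  proof (cases "1 < x")
    case True
    obtain z where "1 < z" "F x - F 1 = (x - 1) * B z"
      using MVT2[OF True, of F B] F by blast
    then show ?thesis using Bz[of z] by simp
  qed (use that in auto)
  define \<psi> where "\<psi> = (\<lambda>x. (1 / F 1) * F x)"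
  have D: "(\<psi> has_real_derivative (1 / F 1) * B x) (at x)" for x
    unfolding \<psi>_def by (rule DERIV_cmult[OF F])
  have "smooth \<psi>"
    by (rule smoothI_deriv[OF D]) (intro smooth_mult smooth_const sm)
  moreover have "0 \<le> deriv \<psi> x" for x
    using DERIV_imp_deriv[OF D] B0 F1 F0 by simp
  moreover have "\<forall>x\<le>0. \<psi> x = 0"
    using Fl by (simp add: \<psi>_def)
  moreover have "\<psi> x = 1" if "x \<ge> 1" for x
    using Fr[OF that] F0 F1 by (simp add: \<psi>_def)
  ultimately show ?thesis by blast
qed

definition step :: "real \<Rightarrow> real" where
  "step = (SOME \<psi>. smooth \<psi> \<and> (\<forall>x\<le>0. \<psi> x = 0) \<and> (\<forall>x\<ge>1. \<psi> x = 1) \<and> (\<forall>x. 0 \<le> deriv \<psi> x))"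

lemma smooth_step: "smooth step"
  and step_le_0: "x \<le> 0 \<Longrightarrow> step x = 0"
  and step_ge_1: "x \<ge> 1 \<Longrightarrow> step x = 1"
  and deriv_step_nonneg: "0 \<le> deriv step x"
  using someI_ex[OF smooth_step_exists] unfolding step_def[symmetric] by blast+

lemma step_mono: "x \<le> y \<Longrightarrow> step x \<le> step y"
  by (rule DERIV_nonneg_imp_nondecreasing) (use smooth_DERIV[OF smooth_step] deriv_step_nonneg in blast)+

lemma step_bounds: "0 \<le> step x" "step x \<le> 1"
  using step_mono[of "min x 0" x] step_mono[of x "max x 1"] step_le_0[of "min x 0"] step_ge_1[of "max x 1"]
  by auto

lemma deriv_step_zero: "x < 0 \<or> 1 < x \<Longrightarrow> deriv step x = 0"
proof (elim disjE)
  assume "x < 0"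
  have "((\<lambda>x. 0) has_real_derivative 0) (at x)" by simp
  then have "(step has_real_derivative 0) (at x)"
    by (rule has_field_derivative_transform_within_open[of _ _ _ "{..<0}"]) (use \<open>x < 0\<close> in \<open>auto simp: step_le_0\<close>)
  then show ?thesis by (rule DERIV_imp_deriv)
next
  assume "1 < x"
  have "((\<lambda>x. 1) has_real_derivative 0) (at x)" by simp
  then have "(step has_real_derivative 0) (at x)"
    by (rule has_field_derivative_transform_within_open[of _ _ _ "{1<..}"]) (use \<open>1 < x\<close> in \<open>auto simp: step_ge_1\<close>)
  then show ?thesis by (rule DERIV_imp_deriv)
qed

section \<open>Bump functions and tensor tests\<close>

text \<open>The support is confined by an explicit interval, which derivatives inherit. The interval
  may be empty, so the zero function counts as a bump.\<close>

definition bump :: "real set \<Rightarrow> (real \<Rightarrow> real) \<Rightarrow> bool" where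
  "bump S f \<longleftrightarrow> smooth f \<and> (\<exists>c d. {c..d} \<subseteq> S \<and> (\<forall>x. x \<notin> {c..d} \<longrightarrow> f x = 0))"

lemma bump_smooth: "bump S f \<Longrightarrow> smooth f"
  by (simp add: bump_def)

lemma bump_outside: "bump S f \<Longrightarrow> x \<notin> S \<Longrightarrow> f x = 0"
  unfolding bump_def by blast

lemma continuous_compact_support_bounded:
  fixes f :: "real \<Rightarrow> real"
  assumes "continuous_on UNIV f" and "\<And>x. x \<notin> {c..d} \<Longrightarrow> f x = 0"
  obtains C where "0 < C" "\<And>x. \<bar>f x\<bar> \<le> C"
proof -
  have "compact (f ` {c..d})"
    using assms(1) by (intro compact_continuous_image) (auto intro: continuous_on_subset)
  then obtain C where C: "\<And>x. x \<in> {c..d} \<Longrightarrow> \<bar>f x\<bar> \<le> C"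
    using compact_imp_bounded bounded_iff by (metis imageI real_norm_def)
  have "\<bar>f x\<bar> \<le> max C 1" for x
    using C[of x] assms(2)[of x] by (cases "x \<in> {c..d}") auto
  then show ?thesis using that[of "max C 1"] by auto
qed

lemma deriv_zero_outside:
  assumes "\<And>x. x \<notin> {c..d} \<Longrightarrow> f x = (0::real)" "x \<notin> {c..d::real}"
  shows "deriv f x = 0"
proof -
  have "((\<lambda>x. 0) has_real_derivative 0) (at x)" by simp
  then have "(f has_real_derivative 0) (at x)"
    by (rule has_field_derivative_transform_within_open[of _ _ _ "- {c..d}"])
       (use assms in \<open>auto simp: open_Compl\<close>)
  then show ?thesis by (rule DERIV_imp_deriv)
qed

lemma bump_deriv: "bump S f \<Longrightarrow> bump S (deriv f)"
  unfolding bump_def using deriv_zero_outside smooth_deriv by metis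

lemma bump_bounded:
  assumes "bump S f" obtains C where "0 < C" "\<And>x. \<bar>f x\<bar> \<le> C"
  using assms smooth_continuous continuous_compact_support_bounded unfolding bump_def by metis

lemma bump_measurable [measurable_dest]: "bump S f \<Longrightarrow> f \<in> borel_measurable borel"
  by (intro borel_measurable_continuous_onI smooth_continuous bump_smooth)

lemma pd_tensor:
  assumes "smooth \<alpha>" "smooth \<beta>"
  shows "pd_t (\<lambda>(t,x). \<alpha> t * \<beta> x) = (\<lambda>(t,x). deriv \<alpha> t * \<beta> x)"
    and "pd_x (\<lambda>(t,x). \<alpha> t * \<beta> x) = (\<lambda>(t,x). \<alpha> t * deriv \<beta> x)"
  using assms by (auto simp: pd_t_def pd_x_def intro!: ext DERIV_imp_deriv DERIV_cmult DERIV_cmult_right smooth_DERIV)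

lemma iter_pd_tensor:
  "smooth \<alpha> \<Longrightarrow> smooth \<beta> \<Longrightarrow>
   \<exists>\<alpha>' \<beta>'. smooth \<alpha>' \<and> smooth \<beta>' \<and> iter_pd ws (\<lambda>(t,x). \<alpha> t * \<beta> x) = (\<lambda>(t,x). \<alpha>' t * \<beta>' x)"
proof (induction ws arbitrary: \<alpha> \<beta>)
  case (Cons w ws)
  then show ?case
    by (cases w) (simp_all add: iter_pd_def pd_tensor smooth_deriv)
qed (auto simp: iter_pd_def)

text \<open>All iterated partial derivatives of a tensor are again tensors of smooth functions,
  which reduces the smoothness conditions in the plane to one variable.\<close>

lemma test2_tensor:
  assumes "bump {0<..<T} \<alpha>" "bump {0<..<1} \<beta>"
  shows "test2 (QT T) (\<lambda>(t,x). \<alpha> t * \<beta> x)"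
proof -
  obtain c d c' d' where cd: "{c..d} \<subseteq> {0<..<T}" "\<And>x. x \<notin> {c..d} \<Longrightarrow> \<alpha> x = 0"
      "{c'..d'} \<subseteq> {0<..<1}" "\<And>x. x \<notin> {c'..d'} \<Longrightarrow> \<beta> x = 0"
    using assms unfolding bump_def by metis
  define K where "K = {c..d} \<times> {c'..d'}"
  have K: "compact K" "K \<subseteq> QT T"
    using cd by (auto simp: K_def QT_def compact_Times)
  have sub: "closure {z. (case z of (t,x) \<Rightarrow> \<alpha> t * \<beta> x) \<noteq> 0} \<subseteq> K"
  proof (rule closure_minimal)
    show "{z. (case z of (t,x) \<Rightarrow> \<alpha> t * \<beta> x) \<noteq> 0} \<subseteq> K"
    proof clarify
      fix t x assume "\<alpha> t * \<beta> x \<noteq> 0"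
      then show "(t,x) \<in> K"
        using cd(2)[of t] cd(4)[of x] by (auto simp: K_def)
    qed
  qed (use K compact_imp_closed in blast)
  have comp: "compact (closure {z. (case z of (t,x) \<Rightarrow> \<alpha> t * \<beta> x) \<noteq> 0})"
    using K(1) sub by (metis closed_closure compact_Int_closed inf.absorb_iff2)
  have "continuous_on UNIV (iter_pd ws (\<lambda>(t,x). \<alpha> t * \<beta> x)) \<and>
     (\<forall>t x. (\<lambda>s. iter_pd ws (\<lambda>(t,x). \<alpha> t * \<beta> x) (s,x)) differentiable (at t)) \<and>
     (\<forall>t x. (\<lambda>y. iter_pd ws (\<lambda>(t,x). \<alpha> t * \<beta> x) (t,y)) differentiable (at x))" for ws
  proof -
    obtain \<alpha>' \<beta>' where ab: "smooth \<alpha>'" "smooth \<beta>'"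
        "iter_pd ws (\<lambda>(t,x). \<alpha> t * \<beta> x) = (\<lambda>(t,x). \<alpha>' t * \<beta>' x)"
      using iter_pd_tensor assms bump_smooth by metis
    have "continuous_on UNIV (\<lambda>z::real \<times> real. \<alpha>' (fst z) * \<beta>' (snd z))"
      by (intro continuous_on_mult continuous_on_compose2[OF smooth_continuous[OF ab(1), of UNIV]]
          continuous_on_compose2[OF smooth_continuous[OF ab(2), of UNIV]]
          continuous_on_fst continuous_on_snd continuous_on_id) auto
    then show ?thesis
      unfolding ab(3) using ab(1,2)
      by (auto simp: case_prod_unfold intro!: differentiable_mult smooth_differentiable)
  qed
  with sub comp K(2) show ?thesis
    unfolding test2_def by blast
qed

lemma weak_tensor_aux:
  fixes f :: "real \<Rightarrow> real \<Rightarrow> real"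
  shows "(LINT z:QT T|lborel. (case z of (t,x) \<Rightarrow> f t x) * (case z of (t,x) \<Rightarrow> \<alpha> t * \<beta> x)) =
    (LBINT z. indicator (QT T) z * f (fst z) (snd z) * (\<alpha> (fst z) * \<beta> (snd z)))"
  by (simp add: set_lebesgue_integral_def case_prod_unfold mult.assoc)

lemma weak_dx_tensor:
  assumes "weak_dx (QT T) f g" "bump {0<..<T} \<alpha>" "bump {0<..<1} \<beta>"
  shows "(LBINT z. indicator (QT T) z * f (fst z) (snd z) * (\<alpha> (fst z) * deriv \<beta> (snd z))) =
    - (LBINT z. indicator (QT T) z * g (fst z) (snd z) * (\<alpha> (fst z) * \<beta> (snd z)))"
  using assms(1) test2_tensor[OF assms(2,3)] pd_tensor[OF assms(2,3)[THEN bump_smooth]]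
  unfolding weak_dx_def weak_tensor_aux[symmetric] by metis

lemma weak_dt_tensor:
  assumes "weak_dt (QT T) f g" "bump {0<..<T} \<alpha>" "bump {0<..<1} \<beta>"
  shows "(LBINT z. indicator (QT T) z * f (fst z) (snd z) * (deriv \<alpha> (fst z) * \<beta> (snd z))) =
    - (LBINT z. indicator (QT T) z * g (fst z) (snd z) * (\<alpha> (fst z) * \<beta> (snd z)))"
  using assms(1) test2_tensor[OF assms(2,3)] pd_tensor[OF assms(2,3)[THEN bump_smooth]]
  unfolding weak_dt_def weak_tensor_aux[symmetric] by metis

section \<open>Smooth plateaus approximating the indicator of an open interval\<close>

definition ramp :: "real \<Rightarrow> nat \<Rightarrow> real \<Rightarrow> real" where
  "ramp a k x = step (real (Suc k) * (x - a) - 1)"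

text \<open>The plateau rises between \<open>a + 1/(k+1)\<close> and \<open>a + 2/(k+1)\<close> and
  falls symmetrically before \<open>b\<close>. The offset keeps the support compact in the open
  interval, even when \<open>a\<close> and \<open>b\<close> are end points of the domain.\<close>

definition plat :: "real \<Rightarrow> real \<Rightarrow> nat \<Rightarrow> real \<Rightarrow> real" where
  "plat a b k x = ramp a k x * ramp (- b) k (- x)"

lemma smooth_ramp: "smooth (ramp a k)"
proof -
  have "ramp a k = (\<lambda>x. step (real (Suc k) * x + (- real (Suc k) * a - 1)))"
    by (auto simp: ramp_def algebra_simps)
  then show ?thesis using smooth_affine[OF smooth_step] by simp
qed

lemma smooth_ramp': "smooth (\<lambda>x. ramp b k (- x))"
  using smooth_affine[OF smooth_ramp[of b k], of "-1" 0] by simp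

lemma smooth_plat: "smooth (plat a b k)"
  unfolding plat_def[abs_def] by (intro smooth_mult smooth_ramp smooth_ramp')

lemma ramp_bounds: "0 \<le> ramp a k x" "ramp a k x \<le> 1"
  by (simp_all add: ramp_def step_bounds)

lemma ramp_zero: "x \<le> a + 1 / real (Suc k) \<Longrightarrow> ramp a k x = 0"
  unfolding ramp_def by (rule step_le_0) (simp add: field_simps)

lemma ramp_one: "a + 2 / real (Suc k) \<le> x \<Longrightarrow> ramp a k x = 1"
  unfolding ramp_def by (rule step_ge_1) (simp add: field_simps)

lemma deriv_ramp: "deriv (ramp a k) x = real (Suc k) * deriv step (real (Suc k) * (x - a) - 1)"
proof -
  have *: "ramp a k = (\<lambda>x. step (real (Suc k) * x + (- real (Suc k) * a - 1)))"
    by (auto simp: ramp_def algebra_simps)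
  show ?thesis
    unfolding * deriv_affine[OF smooth_step] by (simp add: algebra_simps)
qed

lemma deriv_ramp_nonneg: "0 \<le> deriv (ramp a k) x"
  unfolding deriv_ramp using deriv_step_nonneg by simp

lemma deriv_ramp_zero:
  assumes "x < a + 1 / real (Suc k) \<or> a + 2 / real (Suc k) < x"
  shows "deriv (ramp a k) x = 0"
  unfolding deriv_ramp using assms by (subst deriv_step_zero) (auto simp: field_simps)

lemma plat_bounds: "0 \<le> plat a b k x" "plat a b k x \<le> 1"
  by (simp_all add: plat_def ramp_bounds mult_le_one)

lemma plat_outside:
  assumes "x \<notin> {a + 1 / real (Suc k) .. b - 1 / real (Suc k)}" shows "plat a b k x = 0"
proof -
  have "x \<le> a + 1 / real (Suc k) \<or> - x \<le> - b + 1 / real (Suc k)"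
    using assms by auto
  then show ?thesis
    unfolding plat_def using ramp_zero by auto
qed

lemma bump_plat:
  assumes "A \<le> a" "b \<le> B" shows "bump {A<..<B} (plat a b k)"
proof -
  have "{a + 1 / real (Suc k) .. b - 1 / real (Suc k)} \<subseteq> {A<..<B}"
  proof -
    have "0 < 1 / real (Suc k)" by simp
    with assms show ?thesis by (smt (verit) atLeastAtMost_iff greaterThanLessThan_iff subsetI)
  qed
  then show ?thesis
    unfolding bump_def using smooth_plat plat_outside by blast
qed

lemma eventually_ramp_one:
  assumes "a < x" shows "eventually (\<lambda>k. ramp a k x = 1) sequentially"
proof -
  have "(\<lambda>k. a + 2 / real (Suc k)) \<longlonglongrightarrow> a + 0"
    by (intro tendsto_add tendsto_const LIMSEQ_Suc[OF lim_const_over_n])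
  then have "eventually (\<lambda>k. a + 2 / real (Suc k) < x) sequentially"
    using assms by (intro order_tendstoD) auto
  then show ?thesis
    by eventually_elim (simp add: ramp_one)
qed

text \<open>The limit holds at every point: inside, both edges are eventually passed, and at or
  beyond the end points every plateau vanishes.\<close>

lemma plat_tendsto: "(\<lambda>k. plat a b k x) \<longlonglongrightarrow> indicator {a<..<b} x"
proof (cases "a < x \<and> x < b")
  case True
  then have "eventually (\<lambda>k. ramp a k x = 1) sequentially" "eventually (\<lambda>k. ramp (-b) k (-x) = 1) sequentially"
    by (auto intro: eventually_ramp_one)
  then have "eventually (\<lambda>k. plat a b k x = indicator {a<..<b} x) sequentially"
    by eventually_elim (use True in \<open>auto simp: plat_def\<close>)
  then show ?thesis by (rule tendsto_eventually)
next
  case False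
  have "plat a b k x = 0" for k
  proof (cases "x \<le> a")
    case True
    then have "x \<le> a + 1 / real (Suc k)" by (simp add: add_increasing2)
    then show ?thesis by (simp add: plat_def ramp_zero)
  next
    case F: False
    moreover have "0 < 1 / real (Suc k)" by simp
    ultimately have "- x \<le> - b + 1 / real (Suc k)" using False by linarith
    then show ?thesis unfolding plat_def by (simp add: ramp_zero)
  qed
  with False show ?thesis by auto
qed

lemma deriv_plat:
  "deriv (plat a b k) x = deriv (ramp a k) x * ramp (-b) k (-x) - ramp a k x * deriv (ramp (-b) k) (-x)"
proof -
  have "((\<lambda>x. ramp (-b) k (-x)) has_real_derivative deriv (ramp (-b) k) (-x) * (-1)) (at x)"
    by (rule DERIV_chain2[OF smooth_DERIV[OF smooth_ramp]]) (auto intro!: derivative_eq_intros)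
  from DERIV_mult'[OF smooth_DERIV[OF smooth_ramp] this, of a k] show ?thesis
    unfolding plat_def[abs_def] by (intro DERIV_imp_deriv) (simp add: algebra_simps)
qed

lemma measurable_plat [measurable]: "plat a b k \<in> borel_measurable borel"
  by (intro borel_measurable_continuous_onI smooth_continuous smooth_plat)

section \<open>Functions orthogonal to all tensor tests\<close>

lemma integrable_mult_bounded:
  fixes U \<phi> :: "'a \<Rightarrow> real"
  assumes "integrable M U" "\<phi> \<in> borel_measurable M" "\<And>z. \<bar>\<phi> z\<bar> \<le> C"
  shows "integrable M (\<lambda>z. U z * \<phi> z)"
proof (rule Bochner_Integration.integrable_bound[where f = "\<lambda>z. C * U z"])
  show "AE z in M. norm (U z * \<phi> z) \<le> norm (C * U z)"
  proof (intro AE_I2)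
    fix z
    have "\<bar>U z\<bar> * \<bar>\<phi> z\<bar> \<le> \<bar>U z\<bar> * \<bar>C\<bar>"
      using assms(3)[of z] by (intro mult_left_mono) auto
    then show "norm (U z * \<phi> z) \<le> norm (C * U z)"
      by (simp add: abs_mult mult.commute)
  qed
qed (use assms in auto)

lemma tendsto_integral_mult_bounded:
  fixes U :: "'a \<Rightarrow> real"
  assumes "integrable M U" "\<And>k. \<phi> k \<in> borel_measurable M" "\<phi>' \<in> borel_measurable M"
    and "\<And>k z. \<bar>\<phi> k z\<bar> \<le> C" "\<And>z. (\<lambda>k. \<phi> k z) \<longlonglongrightarrow> \<phi>' z"
  shows "(\<lambda>k. \<integral>z. U z * \<phi> k z \<partial>M) \<longlonglongrightarrow> (\<integral>z. U z * \<phi>' z \<partial>M)"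
proof (rule integral_dominated_convergence[where w = "\<lambda>z. C * \<bar>U z\<bar>"])
  show "AE z in M. norm (U z * \<phi> k z) \<le> C * \<bar>U z\<bar>" for k
  proof (intro AE_I2)
    fix z
    have "\<bar>U z\<bar> * \<bar>\<phi> k z\<bar> \<le> \<bar>U z\<bar> * C"
      using assms(4)[of k z] by (intro mult_left_mono) auto
    then show "norm (U z * \<phi> k z) \<le> C * \<bar>U z\<bar>"
      by (simp add: abs_mult mult.commute)
  qed
qed (use assms in \<open>auto intro!: tendsto_mult_left tendsto_intros\<close>)

text \<open>Tensors of plateaus converge boundedly to indicators of open rectangles, so
  \<open>U\<close> integrates to 0 over each box. Boxes are an intersection-stable generator of the
  Borel sets, and a Dynkin argument carries this over to all of them.\<close>

lemma AE_zero_of_tensor_tests: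
  fixes U :: "real \<times> real \<Rightarrow> real"
  assumes int: "integrable lborel U" and supp: "\<And>z. z \<notin> QT T \<Longrightarrow> U z = 0"
    and tests: "\<And>\<alpha> \<beta>. bump {0<..<T} \<alpha> \<Longrightarrow> bump {0<..<1} \<beta> \<Longrightarrow>
       (LBINT z. U z * (\<alpha> (fst z) * \<beta> (snd z))) = 0"
  shows "AE z in lborel. U z = 0"
proof (rule sigma_finite_measure.density_zero[OF sigma_finite_lborel int])
  have U[measurable]: "U \<in> borel_measurable borel"
    using int by auto
  have rect: "(LBINT z. U z * (indicator {s<..<t} (fst z) * indicator {a<..<b} (snd z))) = 0"
    if "0 \<le> s" "t \<le> T" "0 \<le> a" "b \<le> 1" for s t a b
  proof -
    have "(\<lambda>k. LBINT z. U z * (plat s t k (fst z) * plat a b k (snd z)))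
      \<longlonglongrightarrow> (LBINT z. U z * (indicator {s<..<t} (fst z) * indicator {a<..<b} (snd z)))"
    proof (rule tendsto_integral_mult_bounded[where C = 1, OF int])
      show "\<bar>plat s t k (fst z) * plat a b k (snd z)\<bar> \<le> 1" for k and z :: "real \<times> real"
        using plat_bounds by (simp add: abs_mult mult_le_one)
    qed (auto intro!: tendsto_mult plat_tendsto simp: borel_prod[symmetric])
    moreover have "(LBINT z. U z * (plat s t k (fst z) * plat a b k (snd z))) = 0" for k
      by (intro tests bump_plat that)
    ultimately show ?thesis
      by (simp add: LIMSEQ_const_iff)
  qed
  \<comment> \<open>Since \<open>U\<close> vanishes off \<open>QT T\<close>, a box may be clipped to
    it, where the tests live.\<close>
  have box: "set_lebesgue_integral lborel (box l u) U = 0" for l u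
  proof -
    have "set_lebesgue_integral lborel (box l u) U =
      (LBINT z. U z * (indicator {max 0 (fst l)<..<min T (fst u)} (fst z)
                * indicator {max 0 (snd l)<..<min 1 (snd u)} (snd z)))"
      unfolding set_lebesgue_integral_def
    proof (intro Bochner_Integration.integral_cong refl)
      fix z
      show "indicator (box l u) z *\<^sub>R U z = U z * (indicator {max 0 (fst l)<..<min T (fst u)} (fst z)
                * indicator {max 0 (snd l)<..<min 1 (snd u)} (snd z))"
        using supp[of z] by (cases "U z = 0"; cases z) (auto simp: box_prod QT_def indicator_def)
    qed
    also have "\<dots> = 0" by (rule rect) auto
    finally show ?thesis .
  qed
  have setint: "set_integrable lborel A U" if "A \<in> sets borel" for A
    unfolding set_integrable_def using int that by (intro integrable_mult_indicator) auto
  \<comment> \<open>The integral over the whole plane is what the complement step of the Dynkin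
    argument uses.\<close>
  have all: "(LBINT z. U z) = 0"
  proof -
    have "(LBINT z. U z) = set_lebesgue_integral lborel (box (0,0) (T,1)) U"
      unfolding set_lebesgue_integral_def
    proof (intro Bochner_Integration.integral_cong refl)
      show "U z = indicator (box (0,0) (T,1)) z *\<^sub>R U z" for z
        using supp[of z] by (cases "U z = 0"; cases z) (auto simp: box_prod QT_def indicator_def)
    qed
    then show ?thesis using box by simp
  qed
  fix A :: "(real \<times> real) set" assume "A \<in> sets lborel"
  then have A: "A \<in> sigma_sets UNIV (range (\<lambda>(a, b). box a b))"
    by (simp add: borel_eq_box)
  have ss: "sigma_sets UNIV (range (\<lambda>(a, b). box a b)) = sets (borel :: (real \<times> real) measure)"
    by (simp add: borel_eq_box)
  have "Int_stable (range (\<lambda>(a, b). box a b :: (real \<times> real) set))"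
    by (auto simp: Int_stable_def box_Int_box)
  moreover have "range (\<lambda>(a, b). box a b :: (real \<times> real) set) \<subseteq> Pow UNIV"
    by auto
  ultimately show "set_lebesgue_integral lborel A U = 0"
    using A
  proof (induction rule: sigma_sets_induct_disjoint)
    case (basic A)
    then show ?case using box by auto
  next
    case empty
    then show ?case by (simp add: set_lebesgue_integral_def)
  next
    case (compl A)
    have "set_lebesgue_integral lborel (UNIV - A) U = (LBINT z. U z - indicator A z *\<^sub>R U z)"
      unfolding set_lebesgue_integral_def by (intro Bochner_Integration.integral_cong) (auto simp: indicator_def)
    also have "\<dots> = 0"
      using compl all setint[of A] int ss
      by (subst Bochner_Integration.integral_diff) (auto simp: set_integrable_def set_lebesgue_integral_def)
    finally show ?case .
  next
    case (union A)
    have "set_lebesgue_integral lborel (\<Union>i. A i) U = (\<Sum>i. set_lebesgue_integral lborel (A i) U)"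
      using union ss setint
      by (intro lebesgue_integral_countable_add) (auto simp: disjoint_family_on_def)
    then show ?case using union by simp
  qed
qed

section \<open>Time slices of weakly differentiable functions\<close>

lemma plane_AE:
  assumes "AE z in lborel. Q z" shows "AE t in lborel. AE x in lborel. Q (t::real, x::real)"
  by (rule lborel_pair.AE_pair[of Q, unfolded lborel_prod, OF assms])

lemma slice_measurable:
  "f \<in> borel_measurable borel \<Longrightarrow> (\<lambda>x. f (t::real, x::real)) \<in> borel_measurable borel"
  by (rule measurable_compose[of "\<lambda>x. (t, x)"]) (simp_all add: borel_prod[symmetric])

lemma plane_fst:
  fixes f :: "real \<times> real \<Rightarrow> real"
  assumes "integrable lborel f"
  shows "AE t in lborel. integrable lborel (\<lambda>x. f (t, x))"
    and "integrable lborel (\<lambda>t. LBINT x. f (t, x))"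
    and "(LBINT z. f z) = (LBINT t. (LBINT x. f (t, x)))"
  using lborel_pair.AE_integrable_fst'[of f] lborel_pair.integrable_fst'[of f] lborel_pair.integral_fst'[of f] assms
  by (simp_all add: lborel_prod)

lemma plane_swap:
  fixes f :: "real \<Rightarrow> real \<Rightarrow> real"
  assumes "integrable lborel (\<lambda>z. f (fst z) (snd z))"
  shows "(LBINT y. (LBINT x. f x y)) = (LBINT x. (LBINT y. f x y))"
  using lborel_pair.Fubini_integral[of f] assms by (simp add: lborel_prod case_prod_unfold)

lemma plane_integrable_tensor:
  fixes k l :: "real \<Rightarrow> real"
  assumes [measurable]: "integrable lborel k" "integrable lborel l"
  shows "integrable lborel (\<lambda>z. k (fst z) * l (snd z))"
proof -
  have "integrable (lborel \<Otimes>\<^sub>M lborel) (\<lambda>z. k (fst z) * l (snd z))"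
  proof (rule lborel_pair.Fubini_integrable)
    have "integrable lborel (\<lambda>x. \<bar>k x\<bar> * (LBINT y. \<bar>l y\<bar>))"
      using assms by auto
    then show "integrable lborel (\<lambda>x. LBINT y. norm (k (fst (x, y)) * l (snd (x, y))))"
      by (simp add: abs_mult)
  qed (use assms in auto)
  then show ?thesis by (simp add: lborel_prod)
qed

lemma integrable_indicator_Ioo [simp]: "integrable lborel (indicator {a<..<b} :: real \<Rightarrow> real)"
  by (cases "a \<le> b") (auto intro!: integrable_real_indicator)

lemma QT_sets [measurable]: "QT T \<in> sets borel"
  unfolding QT_def by (intro borel_open open_Times) auto

lemma QT_finite: "emeasure lborel (QT T) < \<infinity>"
proof -
  have "bounded (QT T)" unfolding QT_def by (intro bounded_Times) auto
  then show ?thesis by (rule emeasure_bounded_finite)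
qed

lemma sq_intD:
  fixes f :: "'a::euclidean_space \<Rightarrow> real"
  assumes "sq_int S f" "S \<in> sets borel" "emeasure lborel S < \<infinity>"
  shows "(\<lambda>x. indicator S x * f x) \<in> borel_measurable borel"
    and "integrable lborel (\<lambda>x. indicator S x * (f x)\<^sup>2)"
    and "integrable lborel (\<lambda>x. indicator S x * f x)"
proof -
  show m: "(\<lambda>x. indicator S x * f x) \<in> borel_measurable borel"
    and i: "integrable lborel (\<lambda>x. indicator S x * (f x)\<^sup>2)"
    using assms by (auto simp: sq_int_def set_borel_measurable_def set_integrable_def)
  have "integrable lborel (\<lambda>x. indicator S x * (f x)\<^sup>2 + indicator S x)"
    using assms i by (auto intro!: Bochner_Integration.integrable_add integrable_real_indicator)
  then show "integrable lborel (\<lambda>x. indicator S x * f x)"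
  proof (rule Bochner_Integration.integrable_bound)
    show "AE x in lborel. norm (indicator S x * f x) \<le> norm (indicator S x * (f x)\<^sup>2 + indicator S x)"
    proof (intro AE_I2)
      fix x
      have "\<bar>f x\<bar> \<le> (f x)\<^sup>2 + 1"
      proof -
        have "2 * \<bar>f x\<bar> \<le> (f x)\<^sup>2 + 1" using sum_squares_bound[of "\<bar>f x\<bar>" 1] by simp
        then show ?thesis by linarith
      qed
      then show "norm (indicator S x * f x) \<le> norm (indicator S x * (f x)\<^sup>2 + indicator S x)"
        by (auto simp: indicator_def)
    qed
  qed (use m in simp)
qed

lemma L2Q_D:
  assumes "L2Q T f"
  shows "(\<lambda>z. indicator (QT T) z * f (fst z) (snd z)) \<in> borel_measurable borel"
    and "integrable lborel (\<lambda>z. indicator (QT T) z * (f (fst z) (snd z))\<^sup>2)"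
    and "integrable lborel (\<lambda>z. indicator (QT T) z * f (fst z) (snd z))"
  using sq_intD[of "QT T" "\<lambda>(t,x). f t x"] assms QT_finite QT_sets
  unfolding L2Q_def by (auto simp: case_prod_unfold)

lemma indicator_QT: "indicator (QT T) (t, x) = (indicator {0<..<T} t * indicator {0<..<1} x :: real)"
  by (auto simp: QT_def indicator_def)

lemma sq_int_slice:
  assumes "L2Q T f"
  shows "AE t in lborel. t \<in> {0<..<T} \<longrightarrow> sq_int {0<..<1} (f t)"
proof -
  have "AE t in lborel. integrable lborel (\<lambda>x. indicator (QT T) (t, x) * (f t x)\<^sup>2)"
    using plane_fst(1)[OF L2Q_D(2)[OF assms]] by simp
  then show ?thesis
  proof eventually_elim
    case (elim t)
    show ?case
    proof
      assume t: "t \<in> {0<..<T}"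
      have "(\<lambda>x. indicator (QT T) (t, x) * f t x) \<in> borel_measurable borel"
        using slice_measurable[OF L2Q_D(1)[OF assms], of t] by simp
      then show "sq_int {0<..<1} (f t)"
        using elim t by (simp add: sq_int_def set_borel_measurable_def set_integrable_def indicator_QT)
    qed
  qed
qed

text \<open>Absolute continuity is expressed by increments. The continuous \<open>F\<close> gives
  meaning to point values, those at 0 and 1 included, for an \<open>f\<close> known only almost
  everywhere.\<close>

definition ac_rep :: "(real \<Rightarrow> real) \<Rightarrow> (real \<Rightarrow> real) \<Rightarrow> (real \<Rightarrow> real) \<Rightarrow> bool" where
  "ac_rep f g F \<longleftrightarrow> continuous_on {0..1} F \<and>
     (\<forall>x y. 0 \<le> x \<and> x \<le> y \<and> y \<le> 1 \<longrightarrow> F y - F x = (LINT s:{x<..<y}|lborel. g s)) \<and>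
     (AE x in lborel. x \<in> {0<..<1} \<longrightarrow> f x = F x)"

text \<open>Dominated convergence: as the upper limit tends to \<open>x\<close>, the integrands
  converge at every \<open>y\<close> except \<open>y = x\<close>.\<close>

lemma continuous_on_primitive:
  fixes g :: "real \<Rightarrow> real"
  assumes "integrable lborel g"
  shows "continuous_on S (\<lambda>x. LBINT y. indicator {..<x} y * g y)"
proof (rule continuous_on_subset[OF _ subset_UNIV], unfold continuous_on_sequentially comp_def, intro ballI allI impI, elim conjE)
  fix X :: "nat \<Rightarrow> real" and x assume X: "X \<longlonglongrightarrow> x"
  show "(\<lambda>n. LBINT y. indicator {..<X n} y * g y) \<longlonglongrightarrow> (LBINT y. indicator {..<x} y * g y)"
  proof (rule integral_dominated_convergence[where w = "\<lambda>y. \<bar>g y\<bar>"])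
    show "AE y in lborel. (\<lambda>n. indicator {..<X n} y * g y) \<longlonglongrightarrow> indicator {..<x} y * g y"
      using AE_lborel_singleton[of x]
    proof eventually_elim
      fix y assume "y \<noteq> x"
      then consider "y < x" | "x < y" by linarith
      then have "eventually (\<lambda>n. indicator {..<X n} y * g y = indicator {..<x} y * g y) sequentially"
      proof cases
        case 1
        from order_tendstoD(1)[OF X 1] show ?thesis by eventually_elim (use 1 in auto)
      next
        case 2
        from order_tendstoD(2)[OF X 2] show ?thesis by eventually_elim (use 2 in auto)
      qed
      then show "(\<lambda>n. indicator {..<X n} y * g y) \<longlonglongrightarrow> indicator {..<x} y * g y"
        by (rule tendsto_eventually)
    qed
  qed (use assms in \<open>auto simp: indicator_def\<close>)
qed

lemma integrable_Ioo_continuous: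
  fixes f :: "real \<Rightarrow> real"
  assumes "continuous_on {a..b} f" shows "integrable lborel (\<lambda>x. indicator {a<..<b} x * f x)"
proof -
  have "set_integrable lborel {a<..<b} f"
    by (rule set_integrable_subset[OF borel_integrable_atLeastAtMost'[OF assms]]) auto
  then show ?thesis by (simp add: set_integrable_def)
qed

lemma LBINT_FTC_within:
  fixes F f :: "real \<Rightarrow> real"
  assumes "a \<le> b" "\<And>x. x \<in> {a..b} \<Longrightarrow> (F has_real_derivative f x) (at x within {a..b})" "continuous_on {a..b} f"
  shows "(LBINT x. indicator {a<..<b} x * f x) = F b - F a"
proof -
  have *: "(LBINT x. indicator {a..b} x *\<^sub>R f x) = F b - F a"
    using assms by (intro integral_FTC_atLeastAtMost) (auto simp: has_real_derivative_iff_has_vector_derivative)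
  have i: "integrable lborel (\<lambda>x. indicator {a..b} x *\<^sub>R f x)"
    using borel_integrable_atLeastAtMost'[OF assms(3)] by (simp add: set_integrable_def)
  have "(LBINT x. indicator {a<..<b} x * f x) = (LBINT x. indicator {a..b} x *\<^sub>R f x)"
  proof (rule integral_cong_AE)
    show "(\<lambda>x. indicator {a<..<b} x * f x) \<in> borel_measurable lborel"
      using integrable_Ioo_continuous[OF assms(3)] by (rule borel_measurable_integrable)
    show "AE x in lborel. indicator {a<..<b} x * f x = indicator {a..b} x *\<^sub>R f x"
      using AE_lborel_singleton[of a] AE_lborel_singleton[of b]
      by eventually_elim (auto simp: indicator_def)
  qed (use i in simp)
  then show ?thesis using * by simp
qed

lemma LBINT_FTC:
  fixes F f :: "real \<Rightarrow> real"
  assumes "a \<le> b" "\<And>x. (F has_real_derivative f x) (at x)" "continuous_on {a..b} f"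
  shows "(LBINT x. indicator {a<..<b} x * f x) = F b - F a"
  by (rule LBINT_FTC_within[OF assms(1) has_field_derivative_at_within[OF assms(2)] assms(3)])

text \<open>If the interval from \<open>bump\<close> is empty, the function is zero and the midpoint
  of \<open>(A, B)\<close> serves as a one-point interval.\<close>

lemma bump_normal_form:
  assumes "bump {A<..<B} f" "A < B"
  obtains c d where "A < c" "c \<le> d" "d < B" "\<And>x. x \<notin> {c..d} \<Longrightarrow> f x = 0"
proof -
  obtain c d where cd: "{c..d} \<subseteq> {A<..<B}" "\<And>x. x \<notin> {c..d} \<Longrightarrow> f x = 0"
    using assms unfolding bump_def by blast
  show ?thesis
  proof (cases "c \<le> d")
    case True
    then have "A < c" "d < B" using cd(1) by auto
    then show ?thesis using True cd(2) by (intro that)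
  next
    case False
    then have "f x = 0" for x using cd(2)[of x] by auto
    then show ?thesis using assms(2) by (intro that[of "(A+B)/2" "(A+B)/2"]) auto
  qed
qed

text \<open>Integration by parts through Fubini: after exchanging the order,
  \<open>deriv \<beta>\<close> is integrated over \<open>(y, 1)\<close> and gives
  \<open>- \<beta> y\<close>, because \<open>\<beta>\<close> vanishes at 1.\<close>

lemma parts_primitive:
  fixes g :: "real \<Rightarrow> real"
  assumes g: "integrable lborel g" and \<beta>: "bump {0<..<1} \<beta>" and g0: "\<And>y. y \<notin> {0<..<1} \<Longrightarrow> g y = 0"
  shows "(LBINT x. indicator {0<..<1} x * (LBINT y. indicator {..<x} y * g y) * deriv \<beta> x)
       = - (LBINT y. g y * \<beta> y)"
proof -
  note [measurable] = bump_measurable[OF bump_deriv[OF \<beta>]]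
  have [measurable]: "g \<in> borel_measurable borel" using g by auto
  obtain C where C: "0 < C" "\<And>x. \<bar>deriv \<beta> x\<bar> \<le> C"
    using bump_bounded[OF bump_deriv[OF \<beta>]] by blast
  have "integrable lborel (\<lambda>z. (indicator {0<..<1} (fst z) * g (snd z)) * (indicator {z. snd z < fst z} z * deriv \<beta> (fst z)))"
  proof (rule integrable_mult_bounded)
    show "\<bar>indicator {z. snd z < fst z} z * deriv \<beta> (fst z)\<bar> \<le> C" for z :: "real \<times> real"
      using C by (auto simp: indicator_def less_imp_le)
    show "(\<lambda>z::real\<times>real. indicator {z. snd z < fst z} z * deriv \<beta> (fst z)) \<in> borel_measurable lborel"
      by (simp add: borel_prod[symmetric])
  qed (use plane_integrable_tensor[of "indicator {0<..<1}" g] g in simp)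
  then have I: "integrable lborel (\<lambda>z. indicator {0<..<1} (fst z) * g (snd z) * (indicator {..<fst z} (snd z) * deriv \<beta> (fst z)))"
    by (rule Bochner_Integration.integrable_cong[OF refl, THEN iffD1, rotated]) (auto simp: indicator_def)
  have "(LBINT x. indicator {0<..<1} x * (LBINT y. indicator {..<x} y * g y) * deriv \<beta> x) =
    (LBINT x. (LBINT y. indicator {0<..<1} x * g y * (indicator {..<x} y * deriv \<beta> x)))"
  proof (intro Bochner_Integration.integral_cong refl)
    fix x
    have "(LBINT y. indicator {0<..<1} x * g y * (indicator {..<x} y * deriv \<beta> x)) =
      (LBINT y. (indicator {0<..<1} x * deriv \<beta> x) * (indicator {..<x} y * g y))"
      by (intro Bochner_Integration.integral_cong refl) (simp add: algebra_simps)
    then show "indicator {0<..<1} x * (LBINT y. indicator {..<x} y * g y) * deriv \<beta> x =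
      (LBINT y. indicator {0<..<1} x * g y * (indicator {..<x} y * deriv \<beta> x))"
      by simp
  qed
  also have "\<dots> = (LBINT y. (LBINT x. indicator {0<..<1} x * g y * (indicator {..<x} y * deriv \<beta> x)))"
    by (rule plane_swap[symmetric, OF I])
  also have "\<dots> = (LBINT y. - (g y * \<beta> y))"
  proof (intro Bochner_Integration.integral_cong refl)
    fix y
    show "(LBINT x. indicator {0<..<1} x * g y * (indicator {..<x} y * deriv \<beta> x)) = - (g y * \<beta> y)"
    proof (cases "y \<in> {0<..<1}")
      case True
      have "(LBINT x. indicator {0<..<1} x * g y * (indicator {..<x} y * deriv \<beta> x)) =
        (LBINT x. g y * (indicator {y<..<1} x * deriv \<beta> x))"
        using True by (intro Bochner_Integration.integral_cong refl) (auto simp: indicator_def)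
      also have "\<dots> = g y * (\<beta> 1 - \<beta> y)"
        using True LBINT_FTC[of y 1 \<beta> "deriv \<beta>"] smooth_DERIV[OF bump_smooth[OF \<beta>]]
          smooth_continuous[OF bump_smooth[OF bump_deriv[OF \<beta>]]] by simp
      finally show ?thesis using bump_outside[OF \<beta>, of 1] by simp
    qed (simp add: g0)
  qed
  finally show ?thesis by simp
qed

text \<open>The argument of du Bois-Reymond: \<open>P\<close> is the primitive of \<open>g\<close> in \<open>x\<close> and \<open>c\<close> the \<open>\<rho>\<close>-mean of \<open>f - P\<close>;
  since \<open>\<eta> - (\<integral> \<eta>) \<rho>\<close> is the derivative of a bump function, \<open>f - P - c\<close> is orthogonal to all tensor tests.\<close>

lemma weak_dx_slice:
  assumes w: "weak_dx (QT T) f g" and f: "L2Q T f" and g: "L2Q T g"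
  shows "AE t in lborel. t \<in> {0<..<T} \<longrightarrow> (\<exists>F. ac_rep (f t) (g t) F)"
proof -
  define f0 where "f0 = (\<lambda>z. indicator (QT T) z * f (fst z) (snd z))"
  define g0 where "g0 = (\<lambda>z. indicator (QT T) z * g (fst z) (snd z))"
  define P where "P = (\<lambda>z. indicator (QT T) z * (LBINT y. indicator {..<snd z} y * g0 (fst z, y)))"
  \<comment> \<open>As derivative of a step from 0 to 1 whose transition lies in
    \<open>[1/3, 2/3]\<close>, \<open>\<rho>\<close> is a bump of integral 1.\<close>
  define \<rho> where "\<rho> = deriv (\<lambda>x. step (3 * x + (- 1)))"
  define c where "c = (\<lambda>t. LBINT x. (f0 (t,x) - P (t,x)) * \<rho> x)"
  define U where "U = (\<lambda>z. f0 z - P z - indicator (QT T) z * c (fst z))"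
  have f0i: "integrable lborel f0" and g0i: "integrable lborel g0"
    using L2Q_D(3) f g by (auto simp: f0_def g0_def)
  have [measurable]: "f0 \<in> borel_measurable borel" "g0 \<in> borel_measurable borel"
    using f0i g0i by auto
  note slice[measurable] = slice_measurable[OF \<open>g0 \<in> borel_measurable borel\<close>]
  have sm\<rho>: "smooth (\<lambda>x. step (3 * x + (- 1)))" by (rule smooth_affine[OF smooth_step])
  have step_out: "step (3 * x + (- 1)) = 0" if "x \<le> 1/3" for x
    using that by (intro step_le_0) simp
  have step_out': "step (3 * x + (- 1)) = 1" if "x \<ge> 2/3" for x
    using that by (intro step_ge_1) simp
  have \<rho>: "bump {0<..<1} \<rho>"
  proof -
    have "\<rho> x = 0" if "x \<notin> {1/3..2/3}" for x
    proof -
      have "\<rho> x = 3 * deriv step (3 * x + (- 1))"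
        unfolding \<rho>_def deriv_affine[OF smooth_step] by simp
      moreover have "3 * x + (- 1) < 0 \<or> 1 < 3 * x + (- 1)" using that by auto
      ultimately show ?thesis using deriv_step_zero[of "3 * x + (- 1)"] by simp
    qed
    moreover have "{1/3..2/3} \<subseteq> {0<..<1::real}" by auto
    moreover have "smooth \<rho>" unfolding \<rho>_def by (rule smooth_deriv[OF sm\<rho>])
    ultimately show ?thesis unfolding bump_def by blast
  qed
  note [measurable] = bump_measurable[OF \<rho>]
  have Pm[measurable]: "P \<in> borel_measurable borel"
  proof -
    have "(\<lambda>z. LBINT y. indicator {w. snd w < snd (fst w)} (z,y) * g0 (fst z, y)) \<in> borel_measurable (borel \<Otimes>\<^sub>M borel)"
      by (simp add: borel_prod[symmetric])
    then show ?thesis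
      unfolding P_def by (simp add: borel_prod indicator_def cong: if_cong)
  qed
  have Pi: "integrable lborel P"
  proof -
    define k where "k = (\<lambda>t. LBINT x. \<bar>g0 (t, x)\<bar>)"
    have k: "integrable lborel k"
      using plane_fst(2)[of "\<lambda>z. \<bar>g0 z\<bar>"] g0i by (simp add: k_def)
    \<comment> \<open>A primitive is bounded by the L1 norm of the slice of \<open>g0\<close>; that
      norm is integrable in time, which makes \<open>P\<close> integrable on the plane.\<close>
    have bnd: "\<bar>P (t, x)\<bar> \<le> k t * indicator {0<..<1} x" if "integrable lborel (\<lambda>x. g0 (t, x))" for t x
    proof -
      have i: "integrable lborel (\<lambda>y. indicator {..<x} y * g0 (t, y))"
        using integrable_mult_indicator[of "{..<x}" lborel "\<lambda>x. g0 (t, x)"] that by simp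
      have "\<bar>LBINT y. indicator {..<x} y * g0 (t, y)\<bar> \<le> (LBINT y. \<bar>indicator {..<x} y * g0 (t, y)\<bar>)"
        by (rule integral_abs_bound)
      also have "\<dots> \<le> k t"
        unfolding k_def using i that by (intro integral_mono) (auto simp: indicator_def)
      finally show ?thesis
        by (cases "(t,x) \<in> QT T") (auto simp: P_def QT_def k_def)
    qed
    have Ps: "(\<lambda>x. P (t, x)) \<in> borel_measurable borel" for t
      by (rule slice_measurable[OF Pm])
    have 1: "integrable lborel (\<lambda>x::real. k t * indicator {0<..<1} x)" for t
      by simp
    have 2: "integrable lborel (\<lambda>x. P (t, x))" if "integrable lborel (\<lambda>x. g0 (t, x))" for t
      using bnd[OF that] Ps by (intro Bochner_Integration.integrable_bound[OF 1[of t]]) (auto intro: order_trans[OF _ abs_ge_self])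
    have ae: "AE t in lborel. integrable lborel (\<lambda>x. g0 (t, x))"
      by (rule plane_fst(1)[OF g0i])
    have "integrable (lborel \<Otimes>\<^sub>M lborel) P"
    proof (rule lborel_pair.Fubini_integrable)
      show "P \<in> borel_measurable (lborel \<Otimes>\<^sub>M lborel)" by (simp add: lborel_prod Pm)
      show "AE t in lborel. integrable lborel (\<lambda>x. P (t, x))"
        using ae by eventually_elim (rule 2)
      show "integrable lborel (\<lambda>t. LBINT x. norm (P (t, x)))"
      proof (rule Bochner_Integration.integrable_bound[OF k])
        have "P \<in> borel_measurable (borel \<Otimes>\<^sub>M borel)" by (simp add: borel_prod Pm)
        then show "(\<lambda>t. LBINT x. norm (P (t, x))) \<in> borel_measurable lborel"
          by measurable
        show "AE t in lborel. norm (LBINT x. norm (P (t, x))) \<le> norm (k t)"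
          using ae
        proof eventually_elim
          case (elim t)
          have "(LBINT x. norm (P (t, x))) \<le> (LBINT x. k t * indicator {0<..<1::real} x)"
            using bnd[OF elim] 2[OF elim] by (intro integral_mono) auto
          then show ?case by simp
        qed
      qed
    qed
    then show ?thesis by (simp add: lborel_prod)
  qed
  have Vi: "integrable lborel (\<lambda>z. f0 z - P z)"
    using f0i Pi by simp
  \<comment> \<open>\<open>f0\<close> and \<open>P\<close> have the same weak derivative in
    \<open>x\<close>, so their difference is invisible to tests whose second factor is a derivative.
    Only a function of \<open>t\<close> alone remains undetermined.\<close>
  have key: "(LBINT z. (f0 z - P z) * (\<alpha> (fst z) * deriv \<beta> (snd z))) = 0"
    if \<alpha>: "bump {0<..<T} \<alpha>" and \<beta>: "bump {0<..<1} \<beta>" for \<alpha> \<beta>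
  proof -
    obtain A where A: "0 < A" "\<And>x. \<bar>\<alpha> x\<bar> \<le> A" using bump_bounded[OF \<alpha>] by blast
    obtain B where B: "0 < B" "\<And>x. \<bar>\<beta> x\<bar> \<le> B" using bump_bounded[OF \<beta>] by blast
    obtain B' where B': "0 < B'" "\<And>x. \<bar>deriv \<beta> x\<bar> \<le> B'" using bump_bounded[OF bump_deriv[OF \<beta>]] by blast
    note [measurable] = bump_measurable[OF \<alpha>] bump_measurable[OF \<beta>] bump_measurable[OF bump_deriv[OF \<beta>]]
    have i: "integrable lborel (\<lambda>z. f z * (\<alpha> (fst z) * deriv \<beta> (snd z)))" if "integrable lborel f" for f
      using A B' that by (intro integrable_mult_bounded[where C = "A * B'"])
        (auto simp: abs_mult borel_prod[symmetric] intro!: mult_mono)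
    have j: "integrable lborel (\<lambda>z. g0 z * (\<alpha> (fst z) * \<beta> (snd z)))"
      using A B g0i by (intro integrable_mult_bounded[where C = "A * B"])
        (auto simp: abs_mult borel_prod[symmetric] intro!: mult_mono)
    have "(LBINT z. P z * (\<alpha> (fst z) * deriv \<beta> (snd z))) =
      (LBINT t. (LBINT x. P (t,x) * (\<alpha> t * deriv \<beta> x)))"
      using plane_fst(3)[OF i[OF Pi]] by simp
    also have "\<dots> = (LBINT t. - (LBINT x. g0 (t,x) * (\<alpha> t * \<beta> x)))"
    proof (rule integral_cong_AE)
      show "(\<lambda>t. LBINT x. P (t,x) * (\<alpha> t * deriv \<beta> x)) \<in> borel_measurable lborel"
        using plane_fst(2)[OF i[OF Pi]] by auto
      show "(\<lambda>t. - (LBINT x. g0 (t,x) * (\<alpha> t * \<beta> x))) \<in> borel_measurable lborel"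
        using plane_fst(2)[OF j] by auto
      show "AE t in lborel. (LBINT x. P (t,x) * (\<alpha> t * deriv \<beta> x)) = - (LBINT x. g0 (t,x) * (\<alpha> t * \<beta> x))"
        using plane_fst(1)[OF g0i]
      proof eventually_elim
        case (elim t)
        have "(LBINT x. P (t,x) * (\<alpha> t * deriv \<beta> x)) =
          (LBINT x. \<alpha> t * (indicator {0<..<1} x * (LBINT y. indicator {..<x} y * g0 (t,y)) * deriv \<beta> x))"
        proof (intro Bochner_Integration.integral_cong refl)
          fix x
          show "P (t,x) * (\<alpha> t * deriv \<beta> x) =
            \<alpha> t * (indicator {0<..<1} x * (LBINT y. indicator {..<x} y * g0 (t,y)) * deriv \<beta> x)"
            using bump_outside[OF \<alpha>, of t] by (cases "t \<in> {0<..<T}") (auto simp: P_def indicator_QT)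
        qed
        also have "\<dots> = \<alpha> t * (LBINT x. (indicator {0<..<1} x * (LBINT y. indicator {..<x} y * g0 (t,y)) * deriv \<beta> x))"
          by simp
        also have "\<dots> = \<alpha> t * (- (LBINT x. g0 (t,x) * \<beta> x))"
          using parts_primitive[OF elim \<beta>] by (simp add: g0_def indicator_QT)
        also have "\<dots> = - (LBINT x. g0 (t,x) * (\<alpha> t * \<beta> x))"
        proof -
          have "(LBINT x. g0 (t,x) * (\<alpha> t * \<beta> x)) = (LBINT x. \<alpha> t * (g0 (t,x) * \<beta> x))"
            by (simp add: algebra_simps)
          then show ?thesis by simp
        qed
        finally show ?case .
      qed
    qed
    also have "\<dots> = - (LBINT z. g0 z * (\<alpha> (fst z) * \<beta> (snd z)))"
      using plane_fst(3)[OF j] by simp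
    also have "\<dots> = (LBINT z. f0 z * (\<alpha> (fst z) * deriv \<beta> (snd z)))"
      unfolding f0_def g0_def using weak_dx_tensor[OF w \<alpha> \<beta>] by simp
    finally show ?thesis
      using i[OF f0i] i[OF Pi] by (simp add: left_diff_distrib)
  qed
  obtain R where R: "0 < R" "\<And>x. \<bar>\<rho> x\<bar> \<le> R" using bump_bounded[OF \<rho>] by blast
  have V\<rho>i: "integrable lborel (\<lambda>z. (f0 z - P z) * \<rho> (snd z))"
    using R by (intro integrable_mult_bounded[OF Vi, where C = R]) (auto simp: borel_prod[symmetric])
  have ci: "integrable lborel c"
    using plane_fst(2)[OF V\<rho>i] by (simp add: c_def)
  then have [measurable]: "c \<in> borel_measurable borel" by auto
  have cQ: "(\<lambda>z. indicator (QT T) z * c (fst z)) = (\<lambda>z. (indicator {0<..<T} (fst z) * c (fst z)) * indicator {0<..<1} (snd z))"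
    by (auto simp: QT_def indicator_def)
  have cQi: "integrable lborel (\<lambda>z. indicator (QT T) z * c (fst z))"
    unfolding cQ using integrable_mult_indicator[of "{0<..<T}" lborel c] ci
    by (intro plane_integrable_tensor) auto
  have Ui: "integrable lborel U"
    unfolding U_def using Vi cQi by simp
  have "AE z in lborel. U z = 0"
  proof (rule AE_zero_of_tensor_tests[OF Ui])
    show "U z = 0" if "z \<notin> QT T" for z
      using that by (simp add: U_def f0_def P_def)
    fix \<alpha> \<eta> assume \<alpha>: "bump {0<..<T} \<alpha>" and \<eta>: "bump {0<..<1} \<eta>"
    obtain A where A: "0 < A" "\<And>x. \<bar>\<alpha> x\<bar> \<le> A" using bump_bounded[OF \<alpha>] by blast
    obtain B where B: "0 < B" "\<And>x. \<bar>\<eta> x\<bar> \<le> B" using bump_bounded[OF \<eta>] by blast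
    note [measurable] = bump_measurable[OF \<alpha>] bump_measurable[OF \<eta>]
    obtain N where N: "\<And>x. (N has_real_derivative \<eta> x) (at x)" "N 0 = 0"
      using continuous_primitive[OF smooth_continuous[OF bump_smooth[OF \<eta>]]] by blast
    obtain a b where ab: "0 < a" "a \<le> b" "b < 1" "\<And>x. x \<notin> {a..b} \<Longrightarrow> \<eta> x = 0"
      using bump_normal_form[OF \<eta>] by auto
    define m where "m = N 1"
    have m: "(LBINT x. indicator {0<..<1} x * \<eta> x) = m"
      using LBINT_FTC[of 0 1 N \<eta>] N smooth_continuous[OF bump_smooth[OF \<eta>]] by (simp add: m_def)
    have const: "N x = N y" if xy: "x < y" and dis: "{x<..<y} \<inter> {a..b} = {}" for x y
    proof -
      obtain z where "x < z" "z < y" "N y - N x = (y - x) * \<eta> z"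
        using MVT2[OF xy, of N \<eta>] N by blast
      moreover from this have "z \<notin> {a..b}" using dis by auto
      ultimately show ?thesis using ab(4) by simp
    qed
    have Nl: "N x = 0" if "x < a" for x
    proof (cases x "0::real" rule: linorder_cases)
      case less
      then show ?thesis using const[of x 0] N(2) ab by force
    next
      case greater
      then show ?thesis using const[of 0 x] N(2) ab that by force
    qed (simp add: N)
    have Nr: "N x = m" if "b < x" for x
    proof (cases x "1::real" rule: linorder_cases)
      case less
      then show ?thesis using const[of x 1] ab that by (force simp: m_def)
    next
      case greater
      then show ?thesis using const[of 1 x] ab that by (force simp: m_def)
    qed (simp add: m_def)
    \<comment> \<open>To the right of both supports \<open>N\<close> has reached its total
      \<open>m\<close> and the step equals 1, so the difference vanishes there and
      \<open>\<beta>\<close> has compact support.\<close>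
    define \<beta> where "\<beta> = (\<lambda>x. N x - m * step (3 * x + (- 1)))"
    have D: "(\<beta> has_real_derivative \<eta> x - m * \<rho> x) (at x)" for x
      unfolding \<beta>_def \<rho>_def by (intro DERIV_diff N DERIV_cmult smooth_DERIV[OF sm\<rho>])
    then have \<beta>': "deriv \<beta> = (\<lambda>x. \<eta> x - m * \<rho> x)"
      by (auto intro!: ext DERIV_imp_deriv)
    have \<beta>: "bump {0<..<1} \<beta>"
    proof -
      have "smooth \<beta>"
        by (rule smoothI_deriv[OF D]) (intro smooth_diff smooth_mult smooth_const bump_smooth[OF \<eta>] bump_smooth[OF \<rho>])
      moreover have "{min a (1/3)..max b (2/3)} \<subseteq> {0<..<1}" using ab by auto
      moreover have "\<beta> x = 0" if "x \<notin> {min a (1/3)..max b (2/3)}" for x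
      proof -
        consider "x < a" "x \<le> 1/3" | "b < x" "2/3 \<le> x" using \<open>x \<notin> _\<close> by fastforce
        then show ?thesis
          by cases (auto simp: \<beta>_def Nl Nr step_out step_out' simp del: add_uminus_conv_diff)
      qed
      ultimately show ?thesis unfolding bump_def by blast
    qed
    have i: "integrable lborel (\<lambda>z. f z * (\<alpha> (fst z) * \<eta> (snd z)))" if "integrable lborel f" for f
      using A B that by (intro integrable_mult_bounded[where C = "A * B"])
        (auto simp: abs_mult borel_prod[symmetric] intro!: mult_mono)
    have j: "integrable lborel (\<lambda>z. (f0 z - P z) * (\<alpha> (fst z) * \<rho> (snd z)))"
      using A R Vi by (intro integrable_mult_bounded[where C = "A * R"])
        (auto simp: abs_mult borel_prod[symmetric] intro!: mult_mono)
    have "(LBINT z. (f0 z - P z) * (\<alpha> (fst z) * \<eta> (snd z)) - m * ((f0 z - P z) * (\<alpha> (fst z) * \<rho> (snd z)))) = 0"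
      using key[OF \<alpha> \<beta>] unfolding \<beta>' by (simp add: algebra_simps)
    then have 1: "(LBINT z. (f0 z - P z) * (\<alpha> (fst z) * \<eta> (snd z)))
        = m * (LBINT z. (f0 z - P z) * (\<alpha> (fst z) * \<rho> (snd z)))"
      using i[OF Vi] j by (subst (asm) Bochner_Integration.integral_diff) auto
    have "(LBINT z. (indicator (QT T) z * c (fst z)) * (\<alpha> (fst z) * \<eta> (snd z)))
        = (LBINT t. (LBINT x. (indicator (QT T) (t,x) * c t) * (\<alpha> t * \<eta> x)))"
      using plane_fst(3)[OF i[OF cQi]] by simp
    also have "\<dots> = (LBINT t. m * (\<alpha> t * c t))"
    proof (intro Bochner_Integration.integral_cong refl)
      fix t
      have "(LBINT x. (indicator (QT T) (t,x) * c t) * (\<alpha> t * \<eta> x))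
          = (LBINT x. (c t * \<alpha> t) * (indicator {0<..<1} x * \<eta> x))"
        using bump_outside[OF \<alpha>, of t]
        by (intro Bochner_Integration.integral_cong refl) (cases "t \<in> {0<..<T}"; auto simp: indicator_QT)
      then show "(LBINT x. (indicator (QT T) (t,x) * c t) * (\<alpha> t * \<eta> x)) = m * (\<alpha> t * c t)"
        by (simp add: m)
    qed
    also have "\<dots> = m * (LBINT t. (LBINT x. (f0 (t,x) - P (t,x)) * (\<alpha> t * \<rho> x)))"
    proof -
      have "\<alpha> t * c t = (LBINT x. (f0 (t,x) - P (t,x)) * (\<alpha> t * \<rho> x))" for t
      proof -
        have "\<alpha> t * c t = (LBINT x. \<alpha> t * ((f0 (t,x) - P (t,x)) * \<rho> x))"
          by (simp add: c_def)
        then show ?thesis by (simp add: algebra_simps)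
      qed
      then show ?thesis by simp
    qed
    also have "\<dots> = m * (LBINT z. (f0 z - P z) * (\<alpha> (fst z) * \<rho> (snd z)))"
      using plane_fst(3)[OF j] by simp
    finally show "(LBINT z. U z * (\<alpha> (fst z) * \<eta> (snd z))) = 0"
      unfolding U_def using 1 i[OF Vi] i[OF cQi]
      by (subst left_diff_distrib, subst Bochner_Integration.integral_diff) auto
  qed
  from plane_AE[OF this] plane_fst(1)[OF g0i]
  show ?thesis
  proof eventually_elim
    case (elim t)
    show ?case
    proof (intro impI exI)
      assume t: "t \<in> {0<..<T}"
      define G where "G = (\<lambda>x. LBINT y. indicator {..<x} y * g0 (t, y))"
      show "ac_rep (f t) (g t) (\<lambda>x. c t + G x)"
        unfolding ac_rep_def
      proof (intro conjI allI impI)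
        show "continuous_on {0..1} (\<lambda>x. c t + G x)"
          unfolding G_def by (intro continuous_intros continuous_on_primitive elim)
        show "AE x in lborel. x \<in> {0<..<1} \<longrightarrow> f t x = c t + G x"
          using elim(1) by eventually_elim (use t in \<open>auto simp: U_def f0_def P_def G_def indicator_QT\<close>)
        fix x y :: real assume xy: "0 \<le> x \<and> x \<le> y \<and> y \<le> 1"
        have gi: "integrable lborel (\<lambda>s. indicator S s * g0 (t, s))" if "S \<in> sets borel" for S
          using integrable_mult_indicator[of S lborel "\<lambda>s. g0 (t, s)"] that elim(2) by simp
        have "G y - G x = (LBINT s. indicator {..<y} s * g0 (t, s) - indicator {..<x} s * g0 (t, s))"
          unfolding G_def by (rule Bochner_Integration.integral_diff[symmetric]) (auto intro: gi)
        also have "\<dots> = (LBINT s. indicator {x<..<y} s * g0 (t, s))"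
        proof (rule integral_cong_AE)
          show "AE s in lborel. indicator {..<y} s * g0 (t, s) - indicator {..<x} s * g0 (t, s)
              = indicator {x<..<y} s * g0 (t, s)"
            using AE_lborel_singleton[of x] by eventually_elim (use xy in \<open>auto simp: indicator_def\<close>)
        qed simp_all
        also have "\<dots> = (LINT s:{x<..<y}|lborel. g t s)"
          unfolding set_lebesgue_integral_def
          using xy t by (intro Bochner_Integration.integral_cong refl) (auto simp: g0_def QT_def indicator_def)
        finally show "c t + G y - (c t + G x) = (LINT s:{x<..<y}|lborel. g t s)" by simp
      qed
    qed
  qed
qed

section \<open>Gronwall estimate for absolutely continuous functions\<close>

lemma integrable_indicator_mult:
  fixes f :: "'a \<Rightarrow> real"
  shows "integrable M f \<Longrightarrow> A \<in> sets M \<Longrightarrow> integrable M (\<lambda>x. indicator A x * f x)"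
  using integrable_mult_indicator[of A M f] by simp

text \<open>The integral of \<open>r u * r s\<close> over the square of side \<open>t\<close> is cut
  along the diagonal. The two triangles agree by symmetry, so each is half of the squared increment;
  \<open>E\<close> is never differentiated pointwise.\<close>

lemma ac_square:
  fixes r :: "real \<Rightarrow> real"
  assumes r: "integrable lborel r" and E: "\<And>u. u \<in> {0..t} \<Longrightarrow> E u = e0 + (LBINT s. indicator {0<..<u} s * r s)"
    and t: "0 \<le> t"
  shows "(E t)\<^sup>2 = e0\<^sup>2 + 2 * (LBINT u. indicator {0<..<t} u * (E u * r u))"
proof -
  define q where "q = (\<lambda>u. indicator {0<..<t} u * r u)"
  define I where "I = (LBINT u. q u)"
  have q: "integrable lborel q"
    unfolding q_def by (rule integrable_indicator_mult[OF r]) simp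
  then have [measurable]: "q \<in> borel_measurable borel" by auto
  have two: "integrable lborel (\<lambda>z. q (fst z) * q (snd z))"
    by (rule plane_integrable_tensor[OF q q])
  have i1: "integrable lborel (\<lambda>z. indicator {..<fst z} (snd z) * (q (fst z) * q (snd z)))"
    using integrable_indicator_mult[OF two, of "{z. snd z < fst z}"] borel_open[OF open_Collect_less[OF continuous_on_snd[OF continuous_on_id] continuous_on_fst[OF continuous_on_id]]]
    by (simp add: indicator_def cong: if_cong)
  have i2: "integrable lborel (\<lambda>z. indicator {fst z<..} (snd z) * (q (fst z) * q (snd z)))"
    using integrable_indicator_mult[OF two, of "{z. fst z < snd z}"] borel_open[OF open_Collect_less[OF continuous_on_fst[OF continuous_on_id] continuous_on_snd[OF continuous_on_id]]]
    by (simp add: indicator_def cong: if_cong)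
  define A where "A = (LBINT u. (LBINT s. indicator {..<u} s * (q u * q s)))"
  define A' where "A' = (LBINT u. (LBINT s. indicator {u<..} s * (q u * q s)))"
  have "A = (LBINT s. (LBINT u. indicator {..<u} s * (q u * q s)))"
    unfolding A_def by (rule plane_swap[symmetric]) (use i1 in simp)
  also have "\<dots> = A'"
    unfolding A'_def by (intro Bochner_Integration.integral_cong refl) (auto simp: indicator_def)
  finally have AA': "A = A'" .
  have "A + A' = (LBINT u. (LBINT s. indicator {..<u} s * (q u * q s))
      + (LBINT s. indicator {u<..} s * (q u * q s)))"
    unfolding A_def A'_def using plane_fst(2)[OF i1] plane_fst(2)[OF i2]
    by (intro Bochner_Integration.integral_add[symmetric]) auto
  also have "\<dots> = (LBINT u. q u * I)"
  proof (intro Bochner_Integration.integral_cong refl)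
    fix u
    have "(LBINT s. indicator {..<u} s * (q u * q s)) + (LBINT s. indicator {u<..} s * (q u * q s))
      = (LBINT s. indicator {..<u} s * (q u * q s) + indicator {u<..} s * (q u * q s))"
      by (intro Bochner_Integration.integral_add[symmetric] integrable_indicator_mult) (use q in auto)
    also have "\<dots> = (LBINT s. q u * q s)"
    proof (rule integral_cong_AE)
      show "AE s in lborel. indicator {..<u} s * (q u * q s) + indicator {u<..} s * (q u * q s) = q u * q s"
        using AE_lborel_singleton[of u] by eventually_elim (auto simp: indicator_def)
    qed simp_all
    finally show "(LBINT s. indicator {..<u} s * (q u * q s)) + (LBINT s. indicator {u<..} s * (q u * q s))
      = q u * I" by (simp add: I_def)
  qed
  finally have "2 * A = I\<^sup>2"
    using AA' by (simp add: I_def power2_eq_square)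
  moreover have "(LBINT u. indicator {0<..<t} u * (E u * r u)) = e0 * I + A"
  proof -
    have "(LBINT u. indicator {0<..<t} u * (E u * r u))
      = (LBINT u. e0 * q u + (LBINT s. indicator {..<u} s * (q u * q s)))"
    proof (intro Bochner_Integration.integral_cong refl)
      fix u
      show "indicator {0<..<t} u * (E u * r u) = e0 * q u + (LBINT s. indicator {..<u} s * (q u * q s))"
      proof (cases "u \<in> {0<..<t}")
        case True
        have "(LBINT s. indicator {..<u} s * (q u * q s)) = (LBINT s. q u * (indicator {0<..<u} s * r s))"
          using True by (intro Bochner_Integration.integral_cong refl) (auto simp: q_def indicator_def)
        also have "\<dots> = q u * (LBINT s. indicator {0<..<u} s * r s)"
          by (rule integral_mult_right_zero)
        finally show ?thesis
          using True E[of u] by (simp add: q_def distrib_right mult.commute[of "r u"])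
      qed (simp add: q_def)
    qed
    also have "\<dots> = (LBINT u. e0 * q u) + A"
      unfolding A_def using plane_fst(2)[OF i1] q by (intro Bochner_Integration.integral_add) auto
    finally show ?thesis by (simp add: I_def)
  qed
  moreover have "E t = e0 + I"
    using E[of t] t by (simp add: I_def q_def)
  ultimately show ?thesis
    by (simp add: power2_eq_square algebra_simps)
qed

text \<open>Dominated convergence for the truncations at integer heights: each value of
  \<open>k\<close> is eventually below the height.\<close>

lemma truncation_small:
  fixes k :: "real \<Rightarrow> real"
  assumes k: "integrable lborel k" "\<And>x. 0 \<le> k x" and \<epsilon>: "0 < \<epsilon>"
  obtains m where "0 < m" "(LBINT x. k x - min (k x) m) \<le> \<epsilon>"
proof -
  have [measurable]: "k \<in> borel_measurable borel" using k by auto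
  have "(\<lambda>n. LBINT x. k x - min (k x) (real (Suc n))) \<longlonglongrightarrow> integral\<^sup>L lborel (\<lambda>x::real. 0::real)"
  proof (rule integral_dominated_convergence[where w = k])
    show "AE x in lborel. (\<lambda>n. k x - min (k x) (real (Suc n))) \<longlonglongrightarrow> 0"
    proof (intro AE_I2 tendsto_eventually)
      fix x
      have "eventually (\<lambda>n. k x \<le> real (Suc n)) sequentially"
        using filterlim_real_sequentially[unfolded filterlim_at_top, rule_format, of "k x"]
        by eventually_elim simp
      then show "eventually (\<lambda>n. k x - min (k x) (real (Suc n)) = 0) sequentially"
        by eventually_elim simp
    qed
  qed (use k in auto)
  then have "eventually (\<lambda>n. (LBINT x. k x - min (k x) (real (Suc n))) < \<epsilon>) sequentially"
    using \<epsilon> by (intro order_tendstoD(2)) auto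
  then obtain n where "(LBINT x. k x - min (k x) (real (Suc n))) < \<epsilon>"
    by (auto simp: eventually_sequentially)
  then show ?thesis by (intro that[of "real (Suc n)"]) auto
qed

text \<open>Splitting \<open>k = min k m + (k - min k m)\<close> with \<open>\<integral> (k - min k m) \<le> 1/2\<close>, the exponential
  weight with rate \<open>4 m\<close> absorbs the bounded part and \<open>1/2\<close> the remainder.\<close>

lemma gronwall_integrable:
  fixes k :: "real \<Rightarrow> real"
  assumes k: "integrable lborel k" "\<And>x. 0 \<le> k x" and T: "0 \<le> T"
  obtains C where "0 < C"
    "\<And>f A t. continuous_on {0..T} f \<Longrightarrow> (\<And>t. t \<in> {0..T} \<Longrightarrow> 0 \<le> f t) \<Longrightarrow> 0 \<le> A \<Longrightarrow>
       (\<And>t. t \<in> {0..T} \<Longrightarrow> f t \<le> A + (LBINT s. indicator {0<..<t} s * (k s * f s))) \<Longrightarrow>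
       t \<in> {0..T} \<Longrightarrow> f t \<le> C * A"
proof -
  obtain m where m: "0 < m" "(LBINT x. k x - min (k x) m) \<le> 1/2"
    using truncation_small[OF k, of "1/2"] by auto
  have [measurable]: "k \<in> borel_measurable borel" using k by auto
  define l where "l = 4 * m"
  have l: "0 < l" using m by (simp add: l_def)
  have k2: "integrable lborel (\<lambda>s. k s - min (k s) m)"
    using m k by (intro Bochner_Integration.integrable_bound[OF k(1)]) auto
  show ?thesis
  \<comment> \<open>The constant depends on \<open>k\<close> and \<open>T\<close> only and is fixed
    before \<open>f\<close> and \<open>A\<close>, so that one value serves every mesh.\<close>
  proof (rule that[of "4 * exp (l * T)"])
    fix f :: "real \<Rightarrow> real" and A t
    assume f: "continuous_on {0..T} f" "\<And>t. t \<in> {0..T} \<Longrightarrow> 0 \<le> f t" and A: "0 \<le> A"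
      and ineq: "\<And>t. t \<in> {0..T} \<Longrightarrow> f t \<le> A + (LBINT s. indicator {0<..<t} s * (k s * f s))"
      and t: "t \<in> {0..T}"
    \<comment> \<open>The hypothesis is applied only at the maximum point \<open>u\<close> of the
      weighted function, where all other values are controlled by \<open>f u\<close>.\<close>
    have "continuous_on {0..T} (\<lambda>t. f t * exp (- l * t))"
      by (intro continuous_intros f)
    then have "\<exists>u\<in>{0..T}. \<forall>s\<in>{0..T}. f s * exp (- l * s) \<le> f u * exp (- l * u)"
      by (intro continuous_attains_sup) (use T in auto)
    then obtain u where u: "u \<in> {0..T}" "\<And>s. s \<in> {0..T} \<Longrightarrow> f s * exp (- l * s) \<le> f u * exp (- l * u)"
      by blast
    define M where "M = f u * exp (- l * u)"
    have M0: "0 \<le> M" using f(2) u by (simp add: M_def)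
    have fM: "f s \<le> M * exp (l * s)" if "s \<in> {0..T}" for s
    proof -
      have "f s * exp (- l * s) * exp (l * s) \<le> M * exp (l * s)"
        unfolding M_def using u(2)[OF that] by (intro mult_right_mono) auto
      then show ?thesis by (simp add: mult.assoc flip: exp_add)
    qed
    have fu: "f u = M * exp (l * u)" by (simp add: M_def mult.assoc flip: exp_add)
    have i1: "integrable lborel (\<lambda>s. indicator {0<..<u} s * exp (l * s))"
    proof -
      have "set_integrable lborel {0..u} (\<lambda>s. exp (l * s))"
        by (intro borel_integrable_atLeastAtMost' continuous_intros)
      then have "set_integrable lborel {0<..<u} (\<lambda>s. exp (l * s))"
        by (rule set_integrable_subset) auto
      then show ?thesis by (simp add: set_integrable_def)
    qed
    have "(LBINT s. indicator {0<..<u} s * (k s * f s)) \<le>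
      (LBINT s. m * M * (indicator {0<..<u} s * exp (l * s)) + M * exp (l * u) * (k s - min (k s) m))"
    proof (rule integral_mono')
      show "integrable lborel (\<lambda>s. m * M * (indicator {0<..<u} s * exp (l * s)) + M * exp (l * u) * (k s - min (k s) m))"
        using i1 k2 by (intro Bochner_Integration.integrable_add integrable_mult_right) auto
      fix s
      show "indicator {0<..<u} s * (k s * f s) \<le>
        m * M * (indicator {0<..<u} s * exp (l * s)) + M * exp (l * u) * (k s - min (k s) m)"
      proof (cases "s \<in> {0<..<u}")
        case True
        then have s: "s \<in> {0..T}" using u by auto
        have "k s * f s \<le> k s * (M * exp (l * s))"
          using fM[OF s] k(2) by (intro mult_left_mono) auto
        also have "\<dots> = min (k s) m * (M * exp (l * s)) + (k s - min (k s) m) * (M * exp (l * s))"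
          by (simp add: algebra_simps)
        also have "\<dots> \<le> m * (M * exp (l * s)) + (k s - min (k s) m) * (M * exp (l * u))"
          using True l M0 by (intro add_mono mult_right_mono mult_left_mono) auto
        finally show ?thesis using True by (simp add: algebra_simps)
      qed (use M0 in simp)
      show "0 \<le> m * M * (indicator {0<..<u} s * exp (l * s)) + M * exp (l * u) * (k s - min (k s) m)"
        using M0 m by (intro add_nonneg_nonneg mult_nonneg_nonneg) auto
    qed
    also have "\<dots> = m * M * (LBINT s. indicator {0<..<u} s * exp (l * s)) + M * exp (l * u) * (LBINT s. k s - min (k s) m)"
      using i1 k2 by (subst Bochner_Integration.integral_add) auto
    also have "(LBINT s. indicator {0<..<u} s * exp (l * s)) = exp (l * u) / l - exp (l * 0) / l"
      using u l by (intro LBINT_FTC) (auto intro!: derivative_eq_intros continuous_intros)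
    also have "m * M * (exp (l * u) / l - exp (l * 0) / l) \<le> m * M * (exp (l * u) / l)"
      using m M0 l by (intro mult_left_mono) auto
    also have "M * exp (l * u) * (LBINT s. k s - min (k s) m) \<le> M * exp (l * u) * (1/2)"
      using m M0 by (intro mult_left_mono) auto
    finally have "(LBINT s. indicator {0<..<u} s * (k s * f s))
      \<le> m * M * (exp (l * u) / l) + M * exp (l * u) * (1/2)"
      by linarith
    then have "f u \<le> A + (m * M * (exp (l * u) / l) + M * exp (l * u) * (1/2))"
      using ineq[OF u(1)] by linarith
    \<comment> \<open>\<open>m / l = 1/4\<close> by the choice of \<open>l\<close>; with the
      remainder \<open>1/2\<close> the total stays below 1, and absorbing it leaves the factor
      4.\<close>
    also have "\<dots> = A + (3/4) * (M * exp (l * u))"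
      using m by (simp add: l_def field_simps)
    finally have "M * exp (l * u) \<le> 4 * A"
      unfolding fu by simp
    moreover have "M * 1 \<le> M * exp (l * u)"
      using M0 u l by (intro mult_left_mono) auto
    ultimately have "M \<le> 4 * A" by simp
    have "f t \<le> M * exp (l * t)" by (rule fM[OF t])
    also have "\<dots> \<le> (4 * A) * exp (l * T)"
      using \<open>M \<le> 4 * A\<close> t l M0 A by (intro mult_mono) auto
    finally show "f t \<le> 4 * exp (l * T) * A" by (simp add: algebra_simps)
  qed simp
qed

section \<open>Point evaluation by derivatives of plateaus\<close>

text \<open>\<open>deriv s\<close> is a nonnegative weight of mass \<open>s d - s c\<close>; only
  the values of \<open>\<eta>\<close> where this weight is nonzero matter.\<close>

lemma weighted_mean_error:
  fixes s \<eta> :: "real \<Rightarrow> real"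
  assumes "c \<le> d" and s: "smooth s" and s': "\<And>x. 0 \<le> deriv s x" and \<eta>: "continuous_on {c..d} \<eta>"
    and near: "\<And>x. x \<in> {c<..<d} \<Longrightarrow> deriv s x \<noteq> 0 \<Longrightarrow> \<bar>\<eta> x - y\<bar> \<le> \<delta>"
  shows "\<bar>(LBINT x. indicator {c<..<d} x * (\<eta> x * deriv s x)) - y * (s d - s c)\<bar> \<le> \<delta> * (s d - s c)"
proof -
  note cont = smooth_continuous[OF smooth_deriv[OF s], of "{c..d}"]
  have F: "(LBINT x. indicator {c<..<d} x * deriv s x) = s d - s c"
    by (intro LBINT_FTC assms smooth_DERIV[OF s] cont)
  have i1: "integrable lborel (\<lambda>x. indicator {c<..<d} x * (\<eta> x * deriv s x))"
    by (intro integrable_Ioo_continuous continuous_intros cont \<eta>)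
  have i2: "integrable lborel (\<lambda>x. indicator {c<..<d} x * deriv s x)"
    by (intro integrable_Ioo_continuous cont)
  have eq: "(LBINT x. indicator {c<..<d} x * (\<eta> x * deriv s x)) - y * (s d - s c)
    = (LBINT x. indicator {c<..<d} x * (\<eta> x * deriv s x) - y * (indicator {c<..<d} x * deriv s x))"
    using i1 i2 F by (subst Bochner_Integration.integral_diff) auto
  have "\<bar>(LBINT x. indicator {c<..<d} x * (\<eta> x * deriv s x)) - y * (s d - s c)\<bar>
    \<le> (LBINT x. \<bar>indicator {c<..<d} x * (\<eta> x * deriv s x) - y * (indicator {c<..<d} x * deriv s x)\<bar>)"
    unfolding eq by (rule integral_abs_bound)
  also have "\<dots> \<le> (LBINT x. \<delta> * (indicator {c<..<d} x * deriv s x))"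
  proof (intro integral_mono)
    fix x
    show "\<bar>indicator {c<..<d} x * (\<eta> x * deriv s x) - y * (indicator {c<..<d} x * deriv s x)\<bar>
      \<le> \<delta> * (indicator {c<..<d} x * deriv s x)"
    proof (cases "x \<in> {c<..<d} \<and> deriv s x \<noteq> 0")
      case True
      have "\<bar>\<eta> x * deriv s x - y * deriv s x\<bar> = \<bar>\<eta> x - y\<bar> * deriv s x"
        by (simp only: left_diff_distrib[symmetric] abs_mult abs_of_nonneg[OF s'[of x]])
      also have "\<dots> \<le> \<delta> * deriv s x"
        by (rule mult_right_mono[OF near s']) (use True in simp_all)
      finally show ?thesis using True by simp
    next
      case False
      then have "indicator {c<..<d} x * deriv s x = 0" "indicator {c<..<d} x * (\<eta> x * deriv s x) = 0"
        by (cases "x \<in> {c<..<d}"; simp)+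
      then show ?thesis by auto
    qed
    show "integrable lborel (\<lambda>x. \<bar>indicator {c<..<d} x * (\<eta> x * deriv s x) - y * (indicator {c<..<d} x * deriv s x)\<bar>)"
      by (intro integrable_abs Bochner_Integration.integrable_diff integrable_mult_right i1 i2)
    show "integrable lborel (\<lambda>x. \<delta> * (indicator {c<..<d} x * deriv s x))"
      by (intro integrable_mult_right i2)
  qed
  also have "\<dots> = \<delta> * (s d - s c)"
    by (simp add: F)
  finally show ?thesis .
qed

text \<open>This is the falling edge of a plateau with the sign reversed, hence increasing; both
  edges can then be treated as nonnegative weights.\<close>

lemma smooth_reflected_ramp: "smooth (\<lambda>x. - ramp b k (- x))"
  and deriv_reflected_ramp: "deriv (\<lambda>x. - ramp b k (- x)) x = deriv (ramp b k) (- x)"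
proof -
  show "smooth (\<lambda>x. - ramp b k (- x))"
    using smooth_mult[OF smooth_const[of "-1"] smooth_ramp'[of b k]] by simp
  have "((\<lambda>x. ramp b k (-x)) has_real_derivative deriv (ramp b k) (-x) * (-1)) (at x)"
    by (rule DERIV_chain2[OF smooth_DERIV[OF smooth_ramp]]) (auto intro!: derivative_eq_intros)
  from DERIV_minus[OF this] show "deriv (\<lambda>x. - ramp b k (- x)) x = deriv (ramp b k) (- x)"
    by (intro DERIV_imp_deriv) simp
qed

text \<open>Each edge contributes a weight of mass at most 1, whence the factor 2. The bound does
  not depend on \<open>k\<close> and later yields the majorant for a limit under the time
  integral.\<close>

lemma plat_deriv_bound:
  fixes \<eta> :: "real \<Rightarrow> real"
  assumes "a \<le> b" "continuous_on {a..b} \<eta>" "\<And>x. x \<in> {a..b} \<Longrightarrow> \<bar>\<eta> x\<bar> \<le> S"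
  shows "\<bar>LBINT x. indicator {a<..<b} x * (\<eta> x * deriv (plat a b k) x)\<bar> \<le> 2 * S"
proof -
  define R where "R = (\<lambda>x. - ramp (- b) k (- x))"
  have R: "smooth R" "\<And>x. deriv R x = deriv (ramp (-b) k) (- x)"
    unfolding R_def by (simp_all add: smooth_reflected_ramp deriv_reflected_ramp)
  have S: "0 \<le> S" using assms(1) assms(3)[of a] by force
  have i1: "integrable lborel (\<lambda>x. indicator {a<..<b} x * (\<eta> x * deriv (plat a b k) x))"
    by (intro integrable_Ioo_continuous continuous_intros assms smooth_continuous smooth_deriv smooth_plat)
  have i2: "integrable lborel (\<lambda>x. indicator {a<..<b} x * deriv s x)" if "smooth s" for s
    by (intro integrable_Ioo_continuous smooth_continuous smooth_deriv that)
  have F: "(LBINT x. indicator {a<..<b} x * deriv s x) = s b - s a" if "smooth s" for s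
    by (intro LBINT_FTC assms smooth_DERIV smooth_continuous smooth_deriv that)
  have "\<bar>LBINT x. indicator {a<..<b} x * (\<eta> x * deriv (plat a b k) x)\<bar>
    \<le> (LBINT x. \<bar>indicator {a<..<b} x * (\<eta> x * deriv (plat a b k) x)\<bar>)"
    by (rule integral_abs_bound)
  also have "\<dots> \<le> (LBINT x. S * (indicator {a<..<b} x * deriv (ramp a k) x) + S * (indicator {a<..<b} x * deriv R x))"
  proof (intro integral_mono)
    fix x
    have "0 \<le> deriv (ramp a k) x * ramp (-b) k (-x)" "0 \<le> ramp a k x * deriv R x"
      unfolding R(2) by (simp_all add: ramp_bounds deriv_ramp_nonneg)
    moreover have "deriv (ramp a k) x * ramp (-b) k (-x) \<le> deriv (ramp a k) x" "ramp a k x * deriv R x \<le> deriv R x"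
      unfolding R(2) by (simp_all add: mult_left_le mult_left_le_one_le ramp_bounds deriv_ramp_nonneg)
    ultimately have "\<bar>deriv (plat a b k) x\<bar> \<le> deriv (ramp a k) x + deriv R x"
      unfolding deriv_plat R(2) by linarith
    then have "\<bar>\<eta> x\<bar> * \<bar>deriv (plat a b k) x\<bar> \<le> S * (deriv (ramp a k) x + deriv R x)" if "x \<in> {a<..<b}"
      using that assms(3)[of x] S by (intro mult_mono) auto
    then show "\<bar>indicator {a<..<b} x * (\<eta> x * deriv (plat a b k) x)\<bar>
      \<le> S * (indicator {a<..<b} x * deriv (ramp a k) x) + S * (indicator {a<..<b} x * deriv R x)"
      by (cases "x \<in> {a<..<b}") (auto simp: abs_mult algebra_simps)
  qed (use i1 i2[OF smooth_ramp] i2[OF R(1)] in auto)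
  also have "\<dots> = S * (ramp a k b - ramp a k a) + S * (R b - R a)"
    using i2[OF smooth_ramp] i2[OF R(1)] F[OF smooth_ramp] F[OF R(1)] by (subst Bochner_Integration.integral_add) auto
  also have "\<dots> \<le> S * 1 + S * 1"
    using S ramp_bounds[of a k b] ramp_bounds[of a k a] ramp_bounds[of "-b" k "-b"] ramp_bounds[of "-b" k "-a"]
    by (intro add_mono mult_left_mono) (auto simp: R_def)
  finally show ?thesis by simp
qed

text \<open>The derivative of the plateau approximates a unit mass at \<open>a\<close> minus a unit
  mass at \<open>b\<close>, and continuity of \<open>\<eta>\<close> up to the end points turns these
  into point values.\<close>

lemma plat_deriv_limit:
  fixes \<eta> :: "real \<Rightarrow> real"
  assumes ab: "a < b" and \<eta>: "continuous_on {a..b} \<eta>"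
  shows "(\<lambda>k. LBINT x. indicator {a<..<b} x * (\<eta> x * deriv (plat a b k) x)) \<longlonglongrightarrow> \<eta> a - \<eta> b"
proof (rule LIMSEQ_I)
  fix \<epsilon> :: real assume "0 < \<epsilon>"
  define \<delta> where "\<delta> = \<epsilon> / 4"
  have \<delta>: "0 < \<delta>" using \<open>0 < \<epsilon>\<close> by (simp add: \<delta>_def)
  obtain r1 where r1: "0 < r1" "\<And>x. x \<in> {a..b} \<Longrightarrow> \<bar>x - a\<bar> < r1 \<Longrightarrow> \<bar>\<eta> x - \<eta> a\<bar> < \<delta>"
    using \<eta>[unfolded continuous_on_iff, rule_format, of a \<delta>] ab \<delta> by (auto simp: dist_real_def)
  obtain r2 where r2: "0 < r2" "\<And>x. x \<in> {a..b} \<Longrightarrow> \<bar>x - b\<bar> < r2 \<Longrightarrow> \<bar>\<eta> x - \<eta> b\<bar> < \<delta>"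
    using \<eta>[unfolded continuous_on_iff, rule_format, of b \<delta>] ab \<delta> by (auto simp: dist_real_def)
  \<comment> \<open>For large \<open>k\<close> the midpoint separates the two edges, so that each
    can be estimated alone.\<close>
  define c where "c = (a + b) / 2"
  have c: "a < c" "c < b" using ab by (auto simp: c_def)
  define r where "r = min (min r1 r2) (c - a)"
  have r: "0 < r" using r1 r2 c by (simp add: r_def)
  have "(\<lambda>k. 2 / real (Suc k)) \<longlonglongrightarrow> 0"
    by (intro LIMSEQ_Suc[OF lim_const_over_n])
  then obtain K where K: "\<And>k. k \<ge> K \<Longrightarrow> 2 / real (Suc k) < r"
    using order_tendstoD(2)[of "\<lambda>k. 2 / real (Suc k)" 0 sequentially r] r unfolding eventually_sequentially by blast
  show "\<exists>K. \<forall>k\<ge>K. norm ((LBINT x. indicator {a<..<b} x * (\<eta> x * deriv (plat a b k) x)) - (\<eta> a - \<eta> b)) < \<epsilon>"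
  proof (intro exI allI impI)
    fix k assume "k \<ge> K"
    define h where "h = 2 / real (Suc k)"
    have h: "0 < h" "h < r" using K[OF \<open>k \<ge> K\<close>] by (auto simp: h_def)
    have hc: "a + h < c" "c < b - h" using h by (auto simp: r_def c_def field_simps)
    define R where "R = (\<lambda>x. - ramp (- b) k (- x))"
    have R: "smooth R" "\<And>x. deriv R x = deriv (ramp (-b) k) (- x)"
      unfolding R_def by (simp_all add: smooth_reflected_ramp deriv_reflected_ramp)
    have left: "deriv (plat a b k) x = deriv (ramp a k) x" if "x < c" for x
    proof -
      have "ramp (-b) k (-x) = 1" using that hc by (intro ramp_one) (simp add: h_def)
      moreover have "deriv (ramp (-b) k) (-x) = 0" using that hc by (intro deriv_ramp_zero) (simp add: h_def)
      ultimately show ?thesis by (simp add: deriv_plat)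
    qed
    have right: "deriv (plat a b k) x = - deriv R x" if "c < x" for x
    proof -
      have "ramp a k x = 1" using that hc by (intro ramp_one) (simp add: h_def)
      moreover have "deriv (ramp a k) x = 0" using that hc by (intro deriv_ramp_zero) (simp add: h_def)
      ultimately show ?thesis by (simp add: deriv_plat R)
    qed
    have cl: "continuous_on {a..c} \<eta>" and cr: "continuous_on {c..b} \<eta>"
      using c by (auto intro!: continuous_on_subset[OF \<eta>])
    have il: "integrable lborel (\<lambda>x. indicator {a<..<c} x * (\<eta> x * deriv (ramp a k) x))"
      by (intro integrable_Ioo_continuous continuous_intros cl smooth_continuous smooth_deriv smooth_ramp)
    have ir: "integrable lborel (\<lambda>x. indicator {c<..<b} x * (\<eta> x * deriv R x))"
      by (intro integrable_Ioo_continuous continuous_intros cr smooth_continuous smooth_deriv R)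
    have i: "integrable lborel (\<lambda>x. indicator {a<..<b} x * (\<eta> x * deriv (plat a b k) x))"
      by (intro integrable_Ioo_continuous continuous_intros \<eta> smooth_continuous smooth_deriv smooth_plat)
    have eq: "(LBINT x. indicator {a<..<b} x * (\<eta> x * deriv (plat a b k) x)) =
      (LBINT x. indicator {a<..<c} x * (\<eta> x * deriv (ramp a k) x))
      - (LBINT x. indicator {c<..<b} x * (\<eta> x * deriv R x))"
    proof -
      have "(LBINT x. indicator {a<..<b} x * (\<eta> x * deriv (plat a b k) x)) =
        (LBINT x. indicator {a<..<c} x * (\<eta> x * deriv (ramp a k) x) - indicator {c<..<b} x * (\<eta> x * deriv R x))"
      proof (rule integral_cong_AE)
        show "AE x in lborel. indicator {a<..<b} x * (\<eta> x * deriv (plat a b k) x) =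
          indicator {a<..<c} x * (\<eta> x * deriv (ramp a k) x) - indicator {c<..<b} x * (\<eta> x * deriv R x)"
          using AE_lborel_singleton[of c]
        proof eventually_elim
          fix x assume "x \<noteq> c"
          then consider "x < c" | "c < x" by linarith
          then show "indicator {a<..<b} x * (\<eta> x * deriv (plat a b k) x) =
            indicator {a<..<c} x * (\<eta> x * deriv (ramp a k) x) - indicator {c<..<b} x * (\<eta> x * deriv R x)"
            by cases (use c in \<open>auto simp: left right indicator_def\<close>)
        qed
      qed (use i il ir in auto)
      then show ?thesis using il ir by simp
    qed
    have "\<bar>(LBINT x. indicator {a<..<c} x * (\<eta> x * deriv (ramp a k) x)) - \<eta> a * (ramp a k c - ramp a k a)\<bar>
      \<le> \<delta> * (ramp a k c - ramp a k a)"
    proof (rule weighted_mean_error[OF _ smooth_ramp deriv_ramp_nonneg cl])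
      fix x assume x: "x \<in> {a<..<c}" "deriv (ramp a k) x \<noteq> 0"
      then have "\<not> a + 2 / real (Suc k) < x" using deriv_ramp_zero by blast
      then have "x \<le> a + h" unfolding h_def by linarith
      then show "\<bar>\<eta> x - \<eta> a\<bar> \<le> \<delta>" using x h c by (intro less_imp_le r1) (auto simp: r_def)
    qed (use c in simp)
    moreover have "ramp a k c = 1" using hc by (intro ramp_one) (simp add: h_def)
    moreover have "ramp a k a = 0" by (intro ramp_zero) simp
    moreover have "\<bar>(LBINT x. indicator {c<..<b} x * (\<eta> x * deriv R x)) - \<eta> b * (R b - R c)\<bar>
      \<le> \<delta> * (R b - R c)"
    proof (rule weighted_mean_error[OF _ R(1) _ cr])
      show "0 \<le> deriv R x" for x by (simp add: R deriv_ramp_nonneg)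
      fix x assume x: "x \<in> {c<..<b}" "deriv R x \<noteq> 0"
      then have "\<not> - b + 2 / real (Suc k) < - x" using deriv_ramp_zero unfolding R by blast
      then have "- x \<le> - b + h" unfolding h_def by linarith
      then show "\<bar>\<eta> x - \<eta> b\<bar> \<le> \<delta>" using x h c by (intro less_imp_le r2) (auto simp: r_def)
    qed (use c in simp)
    moreover have "R c = -1" unfolding R_def using hc by (subst ramp_one) (auto simp: h_def)
    moreover have "R b = 0" unfolding R_def by (subst ramp_zero) auto
    ultimately have "\<bar>(LBINT x. indicator {a<..<b} x * (\<eta> x * deriv (plat a b k) x)) - (\<eta> a - \<eta> b)\<bar> \<le> 2 * \<delta>"
      unfolding eq by simp
    then show "norm ((LBINT x. indicator {a<..<b} x * (\<eta> x * deriv (plat a b k) x)) - (\<eta> a - \<eta> b)) < \<epsilon>"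
      using \<open>0 < \<epsilon>\<close> by (simp add: \<delta>_def)
  qed
qed

section \<open>The discrete energy inequality\<close>

text \<open>The term at the upper end is kept so that the induction on \<open>n\<close> goes
  through; in the application it vanishes together with \<open>R n\<close>.\<close>

lemma summation_by_parts_zero_ends:
  fixes e R :: "nat \<Rightarrow> real"
  assumes "R 0 = 0"
  shows "(\<Sum>i=1..n. e i * (R i - R (i - 1))) = e n * R n - (\<Sum>i\<in>{1..<n}. R i * (e (Suc i) - e i))"
proof (induction n)
  case (Suc n)
  show ?case
  proof (cases "n = 0")
    case False
    then have "{1..<Suc n} = insert n {1..<n}" by auto
    then show ?thesis using Suc by (simp add: algebra_simps)
  qed (use assms in simp)
qed (use assms in simp)

lemma lipschitz_of_deriv_bound:
  assumes "\<And>x. (f has_real_derivative f' x) (at x)" "\<And>x. \<bar>f' x\<bar> \<le> (K::real)"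
  shows "\<bar>f x - f y\<bar> \<le> K * \<bar>x - y\<bar>"
  using field_differentiable_bound[of UNIV f f' K x y] assms by simp

section \<open>Difference estimates for the nonlinearities\<close>

locale nonlinearities =
  fixes h b :: "real \<Rightarrow> real" and c1 c2 cb :: real
  assumes C2_h: "C2 h" and C2_b: "C2 b" and c1: "0 < c1" and c2: "0 < c2" and cb: "0 < cb"
    and h': "\<And>r. c1 \<le> deriv h r \<and> deriv h r \<le> c2" and h'': "\<And>r. \<bar>deriv (deriv h) r\<bar> \<le> c2"
    and b0: "\<And>r. \<bar>b r\<bar> \<le> cb" and b': "\<And>r. \<bar>deriv b r\<bar> \<le> cb"
begin

lemma DERIV_h: "(h has_real_derivative deriv h x) (at x)"
  and DERIV_h': "(deriv h has_real_derivative deriv (deriv h) x) (at x)"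
  and DERIV_b: "(b has_real_derivative deriv b x) (at x)"
  using C2_h C2_b by (auto simp: C2_def DERIV_deriv_iff_real_differentiable)

lemma h_lip: "\<bar>h x - h y\<bar> \<le> c2 * \<bar>x - y\<bar>"
proof (rule lipschitz_of_deriv_bound[OF DERIV_h])
  show "\<bar>deriv h r\<bar> \<le> c2" for r using h'[of r] c1 by linarith
qed

lemma h'_lip: "\<bar>deriv h x - deriv h y\<bar> \<le> c2 * \<bar>x - y\<bar>"
  by (rule lipschitz_of_deriv_bound[OF DERIV_h' h''])

lemma b_lip: "\<bar>b x - b y\<bar> \<le> cb * \<bar>x - y\<bar>"
  by (rule lipschitz_of_deriv_bound[OF DERIV_b b'])

lemma continuous_h [continuous_intros]: "continuous_on S f \<Longrightarrow> continuous_on S (\<lambda>x. h (f x))"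
  by (rule continuous_on_compose2[of UNIV h]) (auto intro!: continuous_at_imp_continuous_on DERIV_isCont[OF DERIV_h])

lemma continuous_b [continuous_intros]: "continuous_on S f \<Longrightarrow> continuous_on S (\<lambda>x. b (f x))"
  by (rule continuous_on_compose2[of UNIV b]) (auto intro!: continuous_at_imp_continuous_on DERIV_isCont[OF DERIV_b])

lemma h_measurable [measurable]: "h \<in> borel_measurable borel"
  using continuous_h[OF continuous_on_id, of UNIV] by (simp add: borel_measurable_continuous_onI)

lemma b_measurable [measurable]: "b \<in> borel_measurable borel"
  using continuous_b[OF continuous_on_id, of UNIV] by (simp add: borel_measurable_continuous_onI)

lemma MVT_h: "\<exists>\<xi>. \<bar>\<xi> - y\<bar> \<le> \<bar>x - y\<bar> \<and> h x - h y = deriv h \<xi> * (x - y)"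
proof (cases x y rule: linorder_cases)
  case less
  then obtain z where "x < z" "z < y" "h y - h x = (y - x) * deriv h z"
    using MVT2[OF less, of h "deriv h"] DERIV_h by blast
  then show ?thesis by (intro exI[of _ z]) (auto simp: algebra_simps)
next
  case greater
  then obtain z where "y < z" "z < x" "h x - h y = (x - y) * deriv h z"
    using MVT2[OF greater, of h "deriv h"] DERIV_h by blast
  then show ?thesis by (intro exI[of _ z]) (auto simp: algebra_simps)
qed auto

lemma h_coercive: "c1 * \<bar>x - y\<bar> \<le> \<bar>h x - h y\<bar>"
proof -
  obtain \<xi> where "h x - h y = deriv h \<xi> * (x - y)" using MVT_h by blast
  moreover have "c1 * \<bar>x - y\<bar> \<le> \<bar>deriv h \<xi>\<bar> * \<bar>x - y\<bar>"
    using h'[of \<xi>] c1 by (intro mult_right_mono) auto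
  ultimately show ?thesis by (simp add: abs_mult)
qed

lemma h_taylor: "\<bar>h x - h y - deriv h y * (x - y)\<bar> \<le> c2 * (x - y)\<^sup>2"
proof -
  obtain \<xi> where \<xi>: "\<bar>\<xi> - y\<bar> \<le> \<bar>x - y\<bar>" "h x - h y = deriv h \<xi> * (x - y)" using MVT_h by blast
  have "\<bar>h x - h y - deriv h y * (x - y)\<bar> = \<bar>deriv h \<xi> - deriv h y\<bar> * \<bar>x - y\<bar>"
    unfolding \<xi>(2) by (simp only: abs_mult left_diff_distrib[symmetric])
  also have "\<dots> \<le> (c2 * \<bar>x - y\<bar>) * \<bar>x - y\<bar>"
    using h'_lip[of \<xi> y] \<xi>(1) c2 by (intro mult_right_mono order_trans[OF h'_lip] mult_left_mono) auto
  finally show ?thesis by (simp add: power2_eq_square)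
qed

text \<open>One mean value theorem along both segments, with a common parameter, gives
  \<open>h'(Y) (y'-y) - h'(Z) (z'-z)\<close>. With \<open>A = h'(Z)\<close> the rest is
  \<open>(h'(Y) - h'(Z)) (y'-y)\<close>, which contains the increment of the first pair
  only.\<close>

lemma h_double_difference:
  "\<exists>A. c1 \<le> A \<and> A \<le> c2 \<and>
     \<bar>(h y' - h y) - (h z' - h z) - A * ((y' - y) - (z' - z))\<bar> \<le> c2 * \<bar>y' - y\<bar> * (\<bar>y - z\<bar> + \<bar>y' - z'\<bar>)"
proof -
  define g where "g = (\<lambda>s. h (y + s * (y' - y)) - h (z + s * (z' - z)))"
  define g' where "g' = (\<lambda>s. deriv h (y + s * (y' - y)) * (y' - y) - deriv h (z + s * (z' - z)) * (z' - z))"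
  have "(g has_real_derivative g' s) (at s)" for s
    unfolding g_def g'_def
    by (intro DERIV_diff DERIV_chain2[OF DERIV_h]) (auto intro!: derivative_eq_intros)
  then obtain s where s: "0 < s" "s < 1" "g 1 - g 0 = (1 - 0) * g' s"
    using MVT2[of 0 1 g g'] by auto
  define Y Z where "Y = y + s * (y' - y)" and "Z = z + s * (z' - z)"
  have "(h y' - h y) - (h z' - h z) - deriv h Z * ((y' - y) - (z' - z)) = (deriv h Y - deriv h Z) * (y' - y)"
    using s(3) by (simp add: g_def g'_def Y_def Z_def algebra_simps)
  moreover have "\<bar>(deriv h Y - deriv h Z) * (y' - y)\<bar> \<le> c2 * \<bar>y' - y\<bar> * (\<bar>y - z\<bar> + \<bar>y' - z'\<bar>)"
  proof -
    have "\<bar>Y - Z\<bar> \<le> \<bar>y - z\<bar> + \<bar>y' - z'\<bar>"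
    proof -
      have "Y - Z = (1 - s) * (y - z) + s * (y' - z')" by (simp add: Y_def Z_def algebra_simps)
      then have "\<bar>Y - Z\<bar> \<le> (1 - s) * \<bar>y - z\<bar> + s * \<bar>y' - z'\<bar>"
        using s abs_triangle_ineq[of "(1 - s) * (y - z)" "s * (y' - z')"] by (simp add: abs_mult)
      also have "\<dots> \<le> \<bar>y - z\<bar> + \<bar>y' - z'\<bar>"
        using s by (intro add_mono mult_left_le_one_le) auto
      finally show ?thesis .
    qed
    then have "\<bar>deriv h Y - deriv h Z\<bar> \<le> c2 * (\<bar>y - z\<bar> + \<bar>y' - z'\<bar>)"
      using h'_lip[of Y Z] c2 by (meson mult_left_mono less_imp_le order_trans)
    then have "\<bar>deriv h Y - deriv h Z\<bar> * \<bar>y' - y\<bar> \<le> c2 * (\<bar>y - z\<bar> + \<bar>y' - z'\<bar>) * \<bar>y' - y\<bar>"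
      by (rule mult_right_mono) simp
    then show ?thesis by (simp only: abs_mult ac_simps)
  qed
  ultimately show ?thesis
    using h'[of Z] by (intro exI[of _ "deriv h Z"]) simp
qed

end

text \<open>The product contains \<open>- A * D^2\<close>, at most \<open>- c1 * D^2\<close>.
  Young's inequality spends half of this on the cross terms in \<open>D\<close>; the price
  \<open>w^2 / (2 * c1)\<close> is the origin of the constant.\<close>

lemma quadratic_absorb:
  fixes A D a q c1 c2 :: real
  assumes "0 < c1" "c1 \<le> A" "A \<le> c2"
  shows "- (D + a) * (A * D + q) \<le> - (c1 / 2) * D\<^sup>2 + ((1 + c2\<^sup>2) / c1 + 1) * (a\<^sup>2 + q\<^sup>2)"
proof -
  define w where "w = \<bar>q\<bar> + c2 * \<bar>a\<bar>"
  have c2: "0 < c2" using assms by linarith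
  have "- (D + a) * (A * D + q) = - A * D\<^sup>2 - D * (q + A * a) - a * q"
    by (simp add: algebra_simps power2_eq_square)
  also have "\<dots> \<le> - c1 * D\<^sup>2 + \<bar>D\<bar> * w + \<bar>a\<bar> * \<bar>q\<bar>"
  proof -
    have "c1 * D\<^sup>2 \<le> A * D\<^sup>2" using assms by (intro mult_right_mono) auto
    moreover have "\<bar>D * (q + A * a)\<bar> \<le> \<bar>D\<bar> * w"
    proof -
      have "\<bar>A * a\<bar> \<le> c2 * \<bar>a\<bar>" using assms by (simp add: abs_mult mult_right_mono)
      then have "\<bar>q + A * a\<bar> \<le> w" by (simp add: w_def)
      then show ?thesis by (simp add: abs_mult mult_left_mono)
    qed
    moreover have "\<bar>a * q\<bar> \<le> \<bar>a\<bar> * \<bar>q\<bar>" by (simp add: abs_mult)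
    ultimately show ?thesis by linarith
  qed
  also have "\<bar>D\<bar> * w \<le> (c1 / 2) * D\<^sup>2 + w\<^sup>2 / (2 * c1)"
  proof -
    have "0 \<le> (c1 * \<bar>D\<bar> - w)\<^sup>2 / (2 * c1)" using assms by simp
    also have "\<dots> = (c1 / 2) * \<bar>D\<bar>\<^sup>2 + w\<^sup>2 / (2 * c1) - \<bar>D\<bar> * w"
      using assms by (simp add: field_simps power2_eq_square)
    finally show ?thesis by simp
  qed
  also have "w\<^sup>2 / (2 * c1) \<le> (1 + c2\<^sup>2) / c1 * (a\<^sup>2 + q\<^sup>2)"
  proof -
    have "w\<^sup>2 \<le> 2 * q\<^sup>2 + 2 * (c2\<^sup>2 * a\<^sup>2)"
      using sum_squares_bound[of "\<bar>q\<bar>" "c2 * \<bar>a\<bar>"] by (simp add: w_def power2_sum power_mult_distrib mult.commute)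
    also have "\<dots> \<le> 2 * (1 + c2\<^sup>2) * (a\<^sup>2 + q\<^sup>2)"
      by (simp add: algebra_simps)
    finally have "w\<^sup>2 / (2 * c1) \<le> 2 * (1 + c2\<^sup>2) * (a\<^sup>2 + q\<^sup>2) / (2 * c1)"
      using assms by (intro divide_right_mono) auto
    also have "\<dots> = (1 + c2\<^sup>2) / c1 * (a\<^sup>2 + q\<^sup>2)"
      using assms by (simp add: field_simps)
    finally show ?thesis .
  qed
  also have "\<bar>a\<bar> * \<bar>q\<bar> \<le> a\<^sup>2 + q\<^sup>2"
  proof -
    have "2 * (\<bar>a\<bar> * \<bar>q\<bar>) \<le> a\<^sup>2 + q\<^sup>2"
      using sum_squares_bound[of "\<bar>a\<bar>" "\<bar>q\<bar>"] by (simp add: mult.assoc)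
    moreover have "0 \<le> \<bar>a\<bar> * \<bar>q\<bar>" by simp
    ultimately show ?thesis by linarith
  qed
  finally show ?thesis by (simp add: algebra_simps)
qed

lemma square_add_le: "((a::real) + b)\<^sup>2 \<le> 2 * (a\<^sup>2 + b\<^sup>2)"
  using sum_squares_bound[of a b] by (simp add: power2_sum)

lemma square_mono_abs: "\<bar>a::real\<bar> \<le> b \<Longrightarrow> a\<^sup>2 \<le> b\<^sup>2"
  by (metis abs_ge_zero power2_abs power_mono)

context nonlinearities
begin

definition Kloc :: real where "Kloc = (1 + c2\<^sup>2) / c1 + 1"
text \<open>The sum over all edges produces \<open>4 * Kloc\<close> from the two consistency errors
  and four times the factor of the last term in \<open>local_energy\<close>.\<close>

definition Ken :: "real \<Rightarrow> real" where "Ken M = 4 * Kloc + 32 * Kloc * (c2\<^sup>2 + (cb * M)\<^sup>2) / c1\<^sup>2"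

lemma Kloc_pos: "1 \<le> Kloc" unfolding Kloc_def using c1 by simp

lemma Ken_pos: "0 < Ken M"
  unfolding Ken_def using Kloc_pos c1 by (intro add_pos_nonneg) auto

text \<open>The contribution of one edge. \<open>\<tau>\<close> and \<open>\<rho>\<close> are
  consistency errors; \<open>E\<close> and \<open>B\<close> are the remainders from \<open>h\<close>
  and \<open>b\<close>, proportional to the distances \<open>\<epsilon>\<close>,
  \<open>\<epsilon>'\<close> of exact and numerical values in the two cells, which coercivity of
  \<open>h\<close> trades for \<open>e\<close> and \<open>r\<close>.\<close>

lemma local_energy:
  assumes A: "c1 \<le> A" "A \<le> c2" and S: "0 \<le> S"
    and E: "\<bar>E\<bar> \<le> c2 * S * (\<epsilon> + \<epsilon>')" and B: "\<bar>B\<bar> \<le> cb * M * (\<epsilon> + \<epsilon>')"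
    and eps: "0 \<le> \<epsilon>" "0 \<le> \<epsilon>'" "c1 * \<epsilon> \<le> \<bar>e\<bar> + \<bar>r\<bar>" "c1 * \<epsilon>' \<le> \<bar>e'\<bar> + \<bar>r'\<bar>"
  shows "- (\<tau> + D + B) * (A * D + E + \<rho>) \<le> - (c1 / 2) * D\<^sup>2 + 2 * Kloc * (\<tau>\<^sup>2 + \<rho>\<^sup>2)
    + 8 * Kloc * (c2\<^sup>2 + (cb * M)\<^sup>2) / c1\<^sup>2 * ((1 + S\<^sup>2) * (e\<^sup>2 + r\<^sup>2 + e'\<^sup>2 + r'\<^sup>2))"
proof -
  define q where "q = e\<^sup>2 + r\<^sup>2 + e'\<^sup>2 + r'\<^sup>2"
  have q0: "0 \<le> q" by (simp add: q_def)
  have sq: "(\<epsilon> + \<epsilon>')\<^sup>2 \<le> 4 * q / c1\<^sup>2"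
  proof -
    have "(c1 * \<epsilon>)\<^sup>2 \<le> (\<bar>e\<bar> + \<bar>r\<bar>)\<^sup>2" "(c1 * \<epsilon>')\<^sup>2 \<le> (\<bar>e'\<bar> + \<bar>r'\<bar>)\<^sup>2"
      using eps c1 by (auto intro!: power_mono)
    then have "(c1 * \<epsilon>)\<^sup>2 + (c1 * \<epsilon>')\<^sup>2 \<le> 2 * q"
      using square_add_le[of "\<bar>e\<bar>" "\<bar>r\<bar>"] square_add_le[of "\<bar>e'\<bar>" "\<bar>r'\<bar>"] by (simp add: q_def)
    moreover have "(c1 * (\<epsilon> + \<epsilon>'))\<^sup>2 \<le> 2 * ((c1 * \<epsilon>)\<^sup>2 + (c1 * \<epsilon>')\<^sup>2)"
      using square_add_le[of "c1 * \<epsilon>" "c1 * \<epsilon>'"] by (simp add: distrib_left)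
    ultimately have "c1\<^sup>2 * (\<epsilon> + \<epsilon>')\<^sup>2 \<le> 4 * q" by (simp add: power_mult_distrib)
    then show ?thesis using c1 by (simp add: pos_le_divide_eq mult.commute)
  qed
  have E2: "E\<^sup>2 \<le> c2\<^sup>2 * S\<^sup>2 * (\<epsilon> + \<epsilon>')\<^sup>2" and B2: "B\<^sup>2 \<le> (cb * M)\<^sup>2 * (\<epsilon> + \<epsilon>')\<^sup>2"
    using square_mono_abs[OF E] square_mono_abs[OF B] by (simp_all add: power_mult_distrib)
  have EB: "E\<^sup>2 + B\<^sup>2 \<le> (c2\<^sup>2 + (cb * M)\<^sup>2) * (1 + S\<^sup>2) * (4 * q / c1\<^sup>2)"
  proof -
    have "E\<^sup>2 + B\<^sup>2 \<le> (c2\<^sup>2 * S\<^sup>2 + (cb * M)\<^sup>2) * (\<epsilon> + \<epsilon>')\<^sup>2"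
      using E2 B2 by (simp add: algebra_simps)
    also have "\<dots> \<le> ((c2\<^sup>2 + (cb * M)\<^sup>2) * (1 + S\<^sup>2)) * (\<epsilon> + \<epsilon>')\<^sup>2"
      by (intro mult_right_mono) (auto simp: algebra_simps)
    also have "\<dots> \<le> ((c2\<^sup>2 + (cb * M)\<^sup>2) * (1 + S\<^sup>2)) * (4 * q / c1\<^sup>2)"
      by (intro mult_left_mono sq) auto
    finally show ?thesis .
  qed
  have "- (\<tau> + D + B) * (A * D + E + \<rho>) = - (D + (\<tau> + B)) * (A * D + (E + \<rho>))"
    by (simp add: algebra_simps)
  also have "\<dots> \<le> - (c1 / 2) * D\<^sup>2 + Kloc * ((\<tau> + B)\<^sup>2 + (E + \<rho>)\<^sup>2)"
    unfolding Kloc_def by (rule quadratic_absorb[OF c1 A])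
  also have "\<dots> \<le> - (c1 / 2) * D\<^sup>2 + Kloc * (2 * (\<tau>\<^sup>2 + B\<^sup>2) + 2 * (E\<^sup>2 + \<rho>\<^sup>2))"
    using Kloc_pos square_add_le[of \<tau> B] square_add_le[of E \<rho>] by (intro add_left_mono mult_left_mono) auto
  also have "\<dots> = - (c1 / 2) * D\<^sup>2 + 2 * Kloc * (\<tau>\<^sup>2 + \<rho>\<^sup>2) + 2 * Kloc * (E\<^sup>2 + B\<^sup>2)"
    by (simp add: algebra_simps)
  also have "\<dots> \<le> - (c1 / 2) * D\<^sup>2 + 2 * Kloc * (\<tau>\<^sup>2 + \<rho>\<^sup>2) + 2 * Kloc * ((c2\<^sup>2 + (cb * M)\<^sup>2) * (1 + S\<^sup>2) * (4 * q / c1\<^sup>2))"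
    using Kloc_pos EB by (intro add_left_mono mult_left_mono) auto
  also have "2 * Kloc * ((c2\<^sup>2 + (cb * M)\<^sup>2) * (1 + S\<^sup>2) * (4 * q / c1\<^sup>2))
      = 8 * Kloc * (c2\<^sup>2 + (cb * M)\<^sup>2) / c1\<^sup>2 * ((1 + S\<^sup>2) * q)"
    by simp
  finally show ?thesis unfolding q_def .
qed

text \<open>Summation by parts leaves \<open>- R i * (e (i+1) - e i)\<close> on each interior edge,
  with factors \<open>\<tau> + D + B\<close> and \<open>d * (A * D + E + \<rho>)\<close>.
  \<open>S\<close> stands for a bound on the difference quotients of the exact averages and
  \<open>a\<close> for the squared error size. Since \<open>(n - 1) * d <= 1\<close>, the sum over
  the edges loses no power of \<open>n\<close>.\<close>

lemma discrete_energy: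
  fixes y z r W P R :: "nat \<Rightarrow> real"
  assumes n: "n \<ge> 1" and d: "d = 1 / real n" and S: "0 \<le> S" and a: "0 \<le> a" and M: "0 \<le> M"
    and R0: "R 0 = 0" "R n = 0"
    and R: "\<And>i. 1 \<le> i \<Longrightarrow> i < n \<Longrightarrow> R i = W i - ((z (i+1) - z i) / d + b ((z i + z (i+1)) / 2) * P i)"
    and cons: "\<And>i. 1 \<le> i \<Longrightarrow> i < n \<Longrightarrow> (W i - ((y (i+1) - y i) / d + b ((y i + y (i+1)) / 2) * P i))\<^sup>2 \<le> a * (1 + S\<^sup>2)"
    and P: "\<And>i. 1 \<le> i \<Longrightarrow> i < n \<Longrightarrow> \<bar>P i\<bar> \<le> M"
    and dy: "\<And>i. 1 \<le> i \<Longrightarrow> i < n \<Longrightarrow> \<bar>y (i+1) - y i\<bar> \<le> d * S"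
    and r: "\<And>i. 1 \<le> i \<Longrightarrow> i \<le> n \<Longrightarrow> (r i)\<^sup>2 \<le> a"
    and dr: "\<And>i. 1 \<le> i \<Longrightarrow> i < n \<Longrightarrow> ((r (i+1) - r i) / d)\<^sup>2 \<le> a * (1 + S\<^sup>2)"
    and e: "\<And>i. 1 \<le> i \<Longrightarrow> i \<le> n \<Longrightarrow> e i = h (y i) + r i - h (z i)"
  shows "(\<Sum>i=1..n. e i * (R i - R (i - 1))) + (c1 / 2) * (\<Sum>i\<in>{1..<n}. d * (((y (i+1) - y i) - (z (i+1) - z i)) / d)\<^sup>2)
    \<le> Ken M * (1 + S\<^sup>2) * (a + (\<Sum>i=1..n. d * (e i)\<^sup>2))"
proof -
  define D where "D = (\<lambda>i. ((y (i+1) - y i) - (z (i+1) - z i)) / d)"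
  define L where "L = 8 * Kloc * (c2\<^sup>2 + (cb * M)\<^sup>2) / c1\<^sup>2"
  have d0: "0 < d" using n d by simp
  have L0: "0 \<le> L" unfolding L_def using Kloc_pos c1 by simp
  have step: "- R i * (e (Suc i) - e i) \<le> - (c1 / 2) * (d * (D i)\<^sup>2) + 4 * Kloc * (a * (1 + S\<^sup>2)) * d
      + L * (1 + S\<^sup>2) * (2 * a * d + d * (e i)\<^sup>2 + d * (e (Suc i))\<^sup>2)" if i: "1 \<le> i" "i < n" for i
  proof -
    obtain A where A: "c1 \<le> A" "A \<le> c2"
      "\<bar>(h (y (i+1)) - h (y i)) - (h (z (i+1)) - h (z i)) - A * ((y (i+1) - y i) - (z (i+1) - z i))\<bar>
        \<le> c2 * \<bar>y (i+1) - y i\<bar> * (\<bar>y i - z i\<bar> + \<bar>y (i+1) - z (i+1)\<bar>)"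
      using h_double_difference by blast
    define X where "X = (h (y (i+1)) - h (y i)) - (h (z (i+1)) - h (z i)) - A * ((y (i+1) - y i) - (z (i+1) - z i))"
    define E where "E = X / d"
    define \<rho> where "\<rho> = (r (i+1) - r i) / d"
    define \<tau> where "\<tau> = W i - ((y (i+1) - y i) / d + b ((y i + y (i+1)) / 2) * P i)"
    define B where "B = (b ((y i + y (i+1)) / 2) - b ((z i + z (i+1)) / 2)) * P i"
    have Ri: "R i = \<tau> + D i + B"
      unfolding R[OF i] \<tau>_def D_def B_def by (simp add: left_diff_distrib diff_divide_distrib)
    have ei: "e (Suc i) - e i = d * (A * D i + E + \<rho>)"
    proof -
      have "d * (A * D i + E + \<rho>) = A * (d * D i) + d * E + d * \<rho>" by (simp add: algebra_simps)
      also have "\<dots> = A * ((y (i+1) - y i) - (z (i+1) - z i)) + X + (r (i+1) - r i)"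
        using d0 by (simp add: D_def E_def \<rho>_def)
      also have "\<dots> = e (Suc i) - e i"
        using e[of i] e[of "Suc i"] i by (simp add: X_def)
      finally show ?thesis by simp
    qed
    have "- (\<tau> + D i + B) * (A * D i + E + \<rho>) \<le> - (c1 / 2) * (D i)\<^sup>2 + 2 * Kloc * (\<tau>\<^sup>2 + \<rho>\<^sup>2)
      + 8 * Kloc * (c2\<^sup>2 + (cb * M)\<^sup>2) / c1\<^sup>2 * ((1 + S\<^sup>2) * ((e i)\<^sup>2 + (r i)\<^sup>2 + (e (i+1))\<^sup>2 + (r (i+1))\<^sup>2))"
    proof (rule local_energy[OF A(1,2) S])
      have "\<bar>X\<bar> \<le> c2 * (d * S) * (\<bar>y i - z i\<bar> + \<bar>y (i+1) - z (i+1)\<bar>)"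
        using A(3) dy[OF i] c2 unfolding X_def[symmetric]
        by (elim order_trans) (intro mult_right_mono mult_left_mono; simp)
      then show "\<bar>E\<bar> \<le> c2 * S * (\<bar>y i - z i\<bar> + \<bar>y (i+1) - z (i+1)\<bar>)"
        using d0 by (simp add: E_def pos_divide_le_eq algebra_simps)
      have "\<bar>b ((y i + y (i+1)) / 2) - b ((z i + z (i+1)) / 2)\<bar> \<le> cb * (\<bar>y i - z i\<bar> + \<bar>y (i+1) - z (i+1)\<bar>)"
      proof (rule order_trans[OF b_lip mult_left_mono])
        have "(y i + y (i+1)) / 2 - (z i + z (i+1)) / 2 = ((y i - z i) + (y (i+1) - z (i+1))) / 2"
          by (simp add: field_simps)
        then have "\<bar>(y i + y (i+1)) / 2 - (z i + z (i+1)) / 2\<bar> = \<bar>(y i - z i) + (y (i+1) - z (i+1))\<bar> / 2"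
          by (simp only: abs_divide abs_numeral)
        then show "\<bar>(y i + y (i+1)) / 2 - (z i + z (i+1)) / 2\<bar> \<le> \<bar>y i - z i\<bar> + \<bar>y (i+1) - z (i+1)\<bar>"
          using abs_triangle_ineq[of "y i - z i" "y (i+1) - z (i+1)"] abs_ge_zero[of "y i - z i"]
            abs_ge_zero[of "y (i+1) - z (i+1)"] by linarith
      qed (use cb in simp)
      then have "\<bar>b ((y i + y (i+1)) / 2) - b ((z i + z (i+1)) / 2)\<bar> * \<bar>P i\<bar> \<le> cb * (\<bar>y i - z i\<bar> + \<bar>y (i+1) - z (i+1)\<bar>) * M"
        using P[OF i] cb by (intro mult_mono) auto
      then show "\<bar>B\<bar> \<le> cb * M * (\<bar>y i - z i\<bar> + \<bar>y (i+1) - z (i+1)\<bar>)"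
        unfolding B_def abs_mult by (simp only: ac_simps)
      show "c1 * \<bar>y i - z i\<bar> \<le> \<bar>e i\<bar> + \<bar>r i\<bar>"
        using h_coercive[of "y i" "z i"] e[of i] i by simp
      show "c1 * \<bar>y (i+1) - z (i+1)\<bar> \<le> \<bar>e (i+1)\<bar> + \<bar>r (i+1)\<bar>"
        using h_coercive[of "y (i+1)" "z (i+1)"] e[of "i+1"] i by simp
    qed auto
    also have "\<dots> \<le> - (c1 / 2) * (D i)\<^sup>2 + 2 * Kloc * (2 * (a * (1 + S\<^sup>2)))
      + L * ((1 + S\<^sup>2) * ((e i)\<^sup>2 + (e (i+1))\<^sup>2 + 2 * a))"
    proof -
      have "2 * Kloc * (\<tau>\<^sup>2 + \<rho>\<^sup>2) \<le> 2 * Kloc * (2 * (a * (1 + S\<^sup>2)))"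
        using cons[OF i] dr[OF i] Kloc_pos unfolding \<tau>_def[symmetric] \<rho>_def[symmetric]
        by (intro mult_left_mono) auto
      moreover have "L * ((1 + S\<^sup>2) * ((e i)\<^sup>2 + (r i)\<^sup>2 + (e (i+1))\<^sup>2 + (r (i+1))\<^sup>2))
        \<le> L * ((1 + S\<^sup>2) * ((e i)\<^sup>2 + (e (i+1))\<^sup>2 + 2 * a))"
        using r[of i] r[of "i+1"] i L0 by (intro mult_left_mono) auto
      ultimately show ?thesis unfolding L_def[symmetric] by linarith
    qed
    finally have "d * (- (\<tau> + D i + B) * (A * D i + E + \<rho>)) \<le> d * (- (c1 / 2) * (D i)\<^sup>2 + 2 * Kloc * (2 * (a * (1 + S\<^sup>2)))
      + L * ((1 + S\<^sup>2) * ((e i)\<^sup>2 + (e (i+1))\<^sup>2 + 2 * a)))"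
      using d0 by (intro mult_left_mono) auto
    then show ?thesis
      unfolding Ri ei by (simp add: algebra_simps)
  qed
  have nd: "real (n - 1) * d \<le> 1" using n d by simp
  have sub1: "(\<Sum>i\<in>{1..<n}. d * (e i)\<^sup>2) \<le> (\<Sum>i=1..n. d * (e i)\<^sup>2)"
    using d0 by (intro sum_mono2) auto
  have sub2: "(\<Sum>i\<in>{1..<n}. d * (e (Suc i))\<^sup>2) \<le> (\<Sum>i=1..n. d * (e i)\<^sup>2)"
  proof -
    have "(\<Sum>i\<in>{1..<n}. d * (e (Suc i))\<^sup>2) = (\<Sum>i\<in>{Suc 1..<Suc n}. d * (e i)\<^sup>2)"
      by (rule sum.shift_bounds_Suc_ivl[symmetric])
    also have "\<dots> \<le> (\<Sum>i=1..n. d * (e i)\<^sup>2)" using d0 by (intro sum_mono2) auto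
    finally show ?thesis .
  qed
  define Q where "Q = (\<Sum>i=1..n. d * (e i)\<^sup>2)"
  have Q0: "0 \<le> Q" unfolding Q_def using d0 by (intro sum_nonneg) auto
  have "(\<Sum>i=1..n. e i * (R i - R (i - 1))) = (\<Sum>i\<in>{1..<n}. - R i * (e (Suc i) - e i))"
    unfolding summation_by_parts_zero_ends[of R e n, OF R0(1)] using R0(2) by (simp add: sum_negf)
  also have "\<dots> \<le> (\<Sum>i\<in>{1..<n}. - (c1 / 2) * (d * (D i)\<^sup>2) + 4 * Kloc * (a * (1 + S\<^sup>2)) * d
      + L * (1 + S\<^sup>2) * (2 * a * d + d * (e i)\<^sup>2 + d * (e (Suc i))\<^sup>2))"
    by (intro sum_mono step) auto
  also have "\<dots> = - (c1 / 2) * (\<Sum>i\<in>{1..<n}. d * (D i)\<^sup>2) + 4 * Kloc * (a * (1 + S\<^sup>2)) * (real (n - 1) * d)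
      + L * (1 + S\<^sup>2) * (2 * a * (real (n - 1) * d) + (\<Sum>i\<in>{1..<n}. d * (e i)\<^sup>2) + (\<Sum>i\<in>{1..<n}. d * (e (Suc i))\<^sup>2))"
    by (simp only: sum.distrib sum_distrib_left[symmetric] sum_constant card_atLeastLessThan)
  also have "\<dots> \<le> - (c1 / 2) * (\<Sum>i\<in>{1..<n}. d * (D i)\<^sup>2) + 4 * Kloc * (a * (1 + S\<^sup>2)) * 1
      + L * (1 + S\<^sup>2) * (2 * a * 1 + Q + Q)"
  proof -
    have "4 * Kloc * (a * (1 + S\<^sup>2)) * (real (n - 1) * d) \<le> 4 * Kloc * (a * (1 + S\<^sup>2)) * 1"
      using nd Kloc_pos a by (intro mult_left_mono) auto
    moreover have "2 * a * (real (n - 1) * d) \<le> 2 * a * 1"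
      using nd a by (intro mult_left_mono) auto
    then have "L * (1 + S\<^sup>2) * (2 * a * (real (n - 1) * d) + (\<Sum>i\<in>{1..<n}. d * (e i)\<^sup>2) + (\<Sum>i\<in>{1..<n}. d * (e (Suc i))\<^sup>2))
      \<le> L * (1 + S\<^sup>2) * (2 * a * 1 + Q + Q)"
      using sub1 sub2 L0 unfolding Q_def[symmetric] by (intro mult_left_mono) (linarith, simp)
    ultimately show ?thesis by linarith
  qed
  also have "\<dots> \<le> - (c1 / 2) * (\<Sum>i\<in>{1..<n}. d * (D i)\<^sup>2) + Ken M * (1 + S\<^sup>2) * (a + Q)"
  proof -
    have K: "Ken M = 4 * Kloc + 4 * L" by (simp add: Ken_def L_def)
    have "4 * Kloc * (a * (1 + S\<^sup>2)) * 1 \<le> 4 * Kloc * (1 + S\<^sup>2) * (a + Q)"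
      using Q0 Kloc_pos by (simp add: algebra_simps)
    moreover have "L * (1 + S\<^sup>2) * (2 * a * 1 + Q + Q) \<le> L * (1 + S\<^sup>2) * (4 * (a + Q))"
      using Q0 L0 a by (intro mult_left_mono mult_nonneg_nonneg) auto
    ultimately show ?thesis unfolding K by (simp add: algebra_simps)
  qed
  finally show ?thesis by (simp add: Q_def D_def)
qed

end

section \<open>Averages over cells\<close>

abbreviation cell_Ioo :: "nat \<Rightarrow> nat \<Rightarrow> real set" where
  "cell_Ioo n i \<equiv> {real (i - 1) * dx n <..< real i * dx n}"

lemma dx_pos: "n \<ge> 1 \<Longrightarrow> 0 < dx n"
  by (simp add: dx_def)

lemma n_dx: "n \<ge> 1 \<Longrightarrow> real n * dx n = 1"
  by (simp add: dx_def)

lemma dx_le_1: "n \<ge> 1 \<Longrightarrow> dx n \<le> 1"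
  by (simp add: dx_def)

lemma node_le_1: "n \<ge> 1 \<Longrightarrow> i \<le> n \<Longrightarrow> real i * dx n \<le> 1"
  by (simp add: dx_def)

lemma node_nonneg: "0 \<le> real i * dx n"
  by (simp add: dx_def)

lemma node_pred: "1 \<le> i \<Longrightarrow> real (i - 1) * dx n = real i * dx n - dx n"
  by (simp add: of_nat_diff algebra_simps)

lemma cell_Ioo_subset: "n \<ge> 1 \<Longrightarrow> i \<le> n \<Longrightarrow> cell_Ioo n i \<subseteq> {0<..<1}"
  using node_le_1[of n i] node_nonneg[of "i - 1" n] by (auto simp: not_le)

lemma AE_cell:
  assumes "n \<ge> 1" "1 \<le> i" "i \<le> n"
  shows "AE x in lborel. x \<in> cell n i \<longleftrightarrow> x \<in> cell_Ioo n i"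
  using AE_lborel_singleton[of "real (i - 1) * dx n"] AE_lborel_singleton[of "real i * dx n"]
proof eventually_elim
  case (elim x)
  then show ?case
    using assms n_dx[of n] by (cases "i = n") (auto simp: cell_def)
qed

lemma cell_measurable [measurable]: "cell n i \<in> sets borel"
  by (simp add: cell_def)

lemma cell_subset: "n \<ge> 1 \<Longrightarrow> i \<le> n \<Longrightarrow> cell n i \<subseteq> {0..1}"
  using node_le_1[of n i] node_nonneg[of "i - 1" n] node_nonneg[of "n - 1" n] by (auto simp: cell_def)

text \<open>Measurability is known on \<open>(0, 1)\<close> only, while the first and the last cell
  contain 0 and 1; the two single points are added separately.\<close>

lemma cell_borel_measurable:
  fixes f :: "real \<Rightarrow> real"
  assumes "(\<lambda>x. indicator {0<..<1} x * f x) \<in> borel_measurable borel" "S \<subseteq> {0..1}" "S \<in> sets borel"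
  shows "(\<lambda>x. indicator S x * f x) \<in> borel_measurable borel"
proof -
  have "(\<lambda>x. indicator S x * f x) = (\<lambda>x. indicator S x * (indicator {0<..<1} x * f x)
      + f 0 * indicator (S \<inter> {0}) x + f 1 * indicator (S \<inter> {1}) x)"
    using assms(2) by (fastforce simp: indicator_def)
  then show ?thesis using assms(1,3) by simp
qed

lemma cavg_eq:
  assumes "n \<ge> 1" "1 \<le> i" "i \<le> n" and m: "(\<lambda>x. indicator {0<..<1} x * f x) \<in> borel_measurable borel"
  shows "cavg n i f = (1 / dx n) * (LBINT x. indicator (cell_Ioo n i) x * f x)"
proof -
  have "(LBINT x. indicator (cell n i) x *\<^sub>R f x) = (LBINT x. indicator (cell_Ioo n i) x * f x)"
  proof (rule integral_cong_AE)
    show "(\<lambda>x. indicator (cell n i) x *\<^sub>R f x) \<in> borel_measurable lborel"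
      using cell_borel_measurable[OF m cell_subset cell_measurable] assms by simp
    have "cell_Ioo n i \<subseteq> {0..1}"
      using cell_Ioo_subset[of n i] assms by fastforce
    then show "(\<lambda>x. indicator (cell_Ioo n i) x * f x) \<in> borel_measurable lborel"
      using cell_borel_measurable[OF m, of "cell_Ioo n i"] by simp
    show "AE x in lborel. indicator (cell n i) x *\<^sub>R f x = indicator (cell_Ioo n i) x * f x"
      using AE_cell[OF assms(1-3)] by eventually_elim (auto simp: indicator_def)
  qed
  then show ?thesis by (simp add: cavg_def set_lebesgue_integral_def)
qed

lemma integrable_sub_Ioo:
  fixes f :: "real \<Rightarrow> real"
  assumes "integrable lborel (\<lambda>x. indicator {0<..<1} x * f x)" "S \<subseteq> {0<..<1}" "S \<in> sets borel"
  shows "integrable lborel (\<lambda>x. indicator S x * f x)"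
proof -
  have "(\<lambda>x. indicator S x * f x) = (\<lambda>x. indicator S x * (indicator {0<..<1} x * f x))"
    using assms(2) by (fastforce simp: indicator_def)
  then show ?thesis using integrable_indicator_mult[OF assms(1), of S] assms(3) by simp
qed

lemma mean_affine:
  fixes a b c m x0 :: real
  assumes "a < b"
  shows "(LBINT x. indicator {a<..<b} x * (c + m * (x - x0))) = (b - a) * (c + m * ((a + b) / 2 - x0))"
proof -
  have "(LBINT x. indicator {a<..<b} x * (c + m * (x - x0)))
      = (c * b + m * (b - x0)\<^sup>2 / 2) - (c * a + m * (a - x0)\<^sup>2 / 2)"
    using assms by (intro LBINT_FTC) (auto intro!: derivative_eq_intros continuous_intros)
  also have "\<dots> = (b - a) * (c + m * ((a + b) / 2 - x0))"
    by (simp add: power2_eq_square field_simps)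
  finally show ?thesis .
qed

text \<open>The mean of an affine function is its value at the cell midpoint
  \<open>i * dx n - dx n / 2\<close>, so only the deviation from that function contributes.\<close>

lemma cavg_affine_error:
  assumes n: "n \<ge> 1" "1 \<le> i" "i \<le> n" and f: "integrable lborel (\<lambda>x. indicator {0<..<1} x * f x)"
    and err: "AE x in lborel. x \<in> cell_Ioo n i \<longrightarrow> \<bar>f x - (c + m * (x - x0))\<bar> \<le> K"
  shows "\<bar>cavg n i f - (c + m * (real i * dx n - dx n / 2 - x0))\<bar> \<le> K"
proof -
  let ?J = "cell_Ioo n i"
  have d: "0 < dx n" by (rule dx_pos[OF n(1)])
  have len: "real i * dx n - real (i - 1) * dx n = dx n" using node_pred[OF n(2), of n] by simp
  have fi: "integrable lborel (\<lambda>x. indicator ?J x * f x)"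
    using cell_Ioo_subset[OF n(1,3)] by (intro integrable_sub_Ioo[OF f]) auto
  have li: "integrable lborel (\<lambda>x. indicator ?J x * (c + m * (x - x0)))"
    by (intro integrable_Ioo_continuous continuous_intros)
  have l: "(LBINT x. indicator ?J x * (c + m * (x - x0))) = dx n * (c + m * (real i * dx n - dx n / 2 - x0))"
  proof -
    have "(real (i - 1) * dx n + real i * dx n) / 2 = real i * dx n - dx n / 2"
      using node_pred[OF n(2), of n] by (simp add: field_simps)
    then show ?thesis using mean_affine[of "real (i - 1) * dx n" "real i * dx n" c m x0] len d by simp
  qed
  have "\<bar>(LBINT x. indicator ?J x * f x) - dx n * (c + m * (real i * dx n - dx n / 2 - x0))\<bar>
    = \<bar>LBINT x. indicator ?J x * f x - indicator ?J x * (c + m * (x - x0))\<bar>"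
    unfolding Bochner_Integration.integral_diff[OF fi li] l ..
  also have "\<dots> \<le> (LBINT x. \<bar>indicator ?J x * f x - indicator ?J x * (c + m * (x - x0))\<bar>)"
    by (rule integral_abs_bound)
  also have "\<dots> \<le> (LBINT x. K * indicator ?J x)"
  proof (rule integral_mono_AE)
    show "AE x in lborel. \<bar>indicator ?J x * f x - indicator ?J x * (c + m * (x - x0))\<bar> \<le> K * indicator ?J x"
      using err by eventually_elim (auto simp: indicator_def)
  qed (use fi li in auto)
  also have "\<dots> = K * dx n" using len d by simp
  finally have *: "\<bar>(LBINT x. indicator ?J x * f x) - dx n * (c + m * (real i * dx n - dx n / 2 - x0))\<bar> \<le> K * dx n" .
  have "cavg n i f - (c + m * (real i * dx n - dx n / 2 - x0)) =
    ((LBINT x. indicator ?J x * f x) - dx n * (c + m * (real i * dx n - dx n / 2 - x0))) / dx n"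
    using cavg_eq[OF n] f d by (simp add: diff_divide_distrib)
  then show ?thesis
    using * d by (simp add: pos_divide_le_eq)
qed

lemma cavg_const_error:
  assumes "n \<ge> 1" "1 \<le> i" "i \<le> n" "integrable lborel (\<lambda>x. indicator {0<..<1} x * f x)"
    "AE x in lborel. x \<in> cell_Ioo n i \<longrightarrow> \<bar>f x - c\<bar> \<le> K"
  shows "\<bar>cavg n i f - c\<bar> \<le> K"
  using cavg_affine_error[of n i f c 0 0 K] assms by simp

text \<open>The set where the bound holds is closed and contains almost all of the interval, hence
  the interval and then its closure. Boundary values and the initial time are reached in this
  way.\<close>

lemma continuous_le_of_AE:
  fixes u :: "real \<Rightarrow> real"
  assumes "a < b" "continuous_on {a..b} u" "AE x in lborel. x \<in> {a<..<b} \<longrightarrow> u x \<le> c" "x \<in> {a..b}"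
  shows "u x \<le> c"
proof -
  define C where "C = {x \<in> {a..b}. u x \<le> c}"
  have C: "closed C"
  proof -
    have "C = {a..b} \<inter> u -` {..c}" by (auto simp: C_def)
    then show ?thesis using continuous_closed_preimage[OF assms(2), of "{..c}"] by simp
  qed
  have "{a<..<b} \<subseteq> C"
  proof
    fix x :: real assume "x \<in> {a<..<b}"
    have "AE x\<in>{a<..<b} in lebesgue. x \<in> C"
      using AE_completion[OF assms(3)] by eventually_elim (auto simp: C_def)
    then show "x \<in> C"
      using mem_closed_if_AE_lebesgue_open[OF open_greaterThanLessThan C] \<open>x \<in> {a<..<b}\<close> by blast
  qed
  then have "closure {a<..<b} \<subseteq> C" by (rule closure_minimal[OF _ C])
  then show ?thesis using assms(1,4) by (auto simp: C_def)
qed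

lemma continuous_eq_of_AE:
  fixes u v :: "real \<Rightarrow> real"
  assumes "a < b" "continuous_on {a..b} u" "continuous_on {a..b} v"
    and "AE x in lborel. x \<in> {a<..<b} \<longrightarrow> u x = v x" "x \<in> {a..b}"
  shows "u x = v x"
proof -
  have "u x - v x \<le> 0"
    using assms by (intro continuous_le_of_AE[where u = "\<lambda>x. u x - v x" and a = a and b = b] continuous_intros) auto
  moreover have "v x - u x \<le> 0"
    using assms by (intro continuous_le_of_AE[where u = "\<lambda>x. v x - u x" and a = a and b = b] continuous_intros) auto
  ultimately show ?thesis by simp
qed

text \<open>Cauchy-Schwarz, read off from the nonnegative variance of \<open>g\<close> about its
  mean \<open>c\<close> over \<open>(x, y)\<close>.\<close>

lemma CS_interval:
  fixes g :: "real \<Rightarrow> real"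
  assumes "sq_int {0<..<1} g" "0 \<le> x" "x \<le> y" "y \<le> 1"
  shows "(LINT s:{x<..<y}|lborel. g s)\<^sup>2 \<le> (y - x) * (LBINT s. indicator {0<..<1} s * (g s)\<^sup>2)"
proof (cases "x = y")
  case True
  then show ?thesis by (simp add: set_lebesgue_integral_def)
next
  case False
  then have xy: "x < y" using assms by simp
  have sub: "{x<..<y} \<subseteq> {0<..<1}" using assms by auto
  define I where "I = (LBINT s. indicator {x<..<y} s * g s)"
  define c where "c = I / (y - x)"
  have gi: "integrable lborel (\<lambda>s. indicator {x<..<y} s * g s)"
    and g2i: "integrable lborel (\<lambda>s. indicator {x<..<y} s * (g s)\<^sup>2)"
    using sq_intD[OF assms(1)] sub by (auto intro!: integrable_sub_Ioo)
  have "0 \<le> (LBINT s. indicator {x<..<y} s * (g s - c)\<^sup>2)"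
    by (intro Bochner_Integration.integral_nonneg) auto
  also have "\<dots> = (LBINT s. indicator {x<..<y} s * (g s)\<^sup>2 - 2 * c * (indicator {x<..<y} s * g s) + c\<^sup>2 * indicator {x<..<y} s)"
    by (intro Bochner_Integration.integral_cong refl) (auto simp: indicator_def power2_diff)
  also have "\<dots> = (LBINT s. indicator {x<..<y} s * (g s)\<^sup>2) - 2 * c * I + c\<^sup>2 * (y - x)"
    using gi g2i xy by (simp add: I_def)
  also have "\<dots> = (LBINT s. indicator {x<..<y} s * (g s)\<^sup>2) - I\<^sup>2 / (y - x)"
    using xy by (simp add: c_def power2_eq_square)
  finally have "I\<^sup>2 \<le> (y - x) * (LBINT s. indicator {x<..<y} s * (g s)\<^sup>2)"
    using xy by (simp add: pos_divide_le_eq mult.commute)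
  also have "\<dots> \<le> (y - x) * (LBINT s. indicator {0<..<1} s * (g s)\<^sup>2)"
    using xy g2i sq_intD(2)[OF assms(1)] sub by (intro mult_left_mono integral_mono) (auto simp: indicator_def)
  finally show ?thesis by (simp add: I_def set_lebesgue_integral_def)
qed

text \<open>Increments of \<open>F\<close> are integrals of \<open>g\<close>, so Cauchy-Schwarz
  gives the Hoelder exponent 1/2 of one-dimensional \<open>H^1\<close> functions.\<close>

lemma ac_rep_holder:
  assumes "ac_rep f g F" "sq_int {0<..<1} g" "x \<in> {0..1}" "y \<in> {0..1}"
  shows "(F y - F x)\<^sup>2 \<le> \<bar>y - x\<bar> * (LBINT s. indicator {0<..<1} s * (g s)\<^sup>2)"
proof -
  have *: "(F y - F x)\<^sup>2 \<le> (y - x) * (LBINT s. indicator {0<..<1} s * (g s)\<^sup>2)"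
    if "0 \<le> x" "x \<le> y" "y \<le> 1" for x y
    using CS_interval[OF assms(2) that] assms(1) that unfolding ac_rep_def by simp
  show ?thesis
    using *[of x y] *[of y x] assms(3,4) by (cases "x \<le> y") (auto simp: power2_commute)
qed

lemma ac_rep_affine_error:
  assumes "ac_rep f g F" "integrable lborel (\<lambda>x. indicator {0<..<1} x * g x)" "x0 \<in> {0..1}" "y \<in> {0..1}"
    and err: "AE s in lborel. s \<in> {min x0 y<..<max x0 y} \<longrightarrow> \<bar>g s - c\<bar> \<le> K"
  shows "\<bar>F y - F x0 - c * (y - x0)\<bar> \<le> K * \<bar>y - x0\<bar>"
proof -
  have *: "\<bar>F y - F x - c * (y - x)\<bar> \<le> K * (y - x)"
    if xy: "0 \<le> x" "x \<le> y" "y \<le> 1" and e: "AE s in lborel. s \<in> {x<..<y} \<longrightarrow> \<bar>g s - c\<bar> \<le> K" for x y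
  proof -
    have gi: "integrable lborel (\<lambda>s. indicator {x<..<y} s * g s)"
      using xy by (intro integrable_sub_Ioo[OF assms(2)]) auto
    have "F y - F x - c * (y - x) = (LBINT s. indicator {x<..<y} s * g s - c * indicator {x<..<y} s)"
      using assms(1) xy gi unfolding ac_rep_def by (simp add: set_lebesgue_integral_def)
    then have "\<bar>F y - F x - c * (y - x)\<bar> \<le> (LBINT s. \<bar>indicator {x<..<y} s * g s - c * indicator {x<..<y} s\<bar>)"
      using integral_abs_bound by metis
    also have "\<dots> \<le> (LBINT s. K * indicator {x<..<y} s)"
    proof (rule integral_mono_AE)
      show "AE s in lborel. \<bar>indicator {x<..<y} s * g s - c * indicator {x<..<y} s\<bar> \<le> K * indicator {x<..<y} s"
        using e by eventually_elim (auto simp: indicator_def)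
    qed (use gi in auto)
    also have "\<dots> = K * (y - x)" using xy by simp
    finally show ?thesis .
  qed
  show ?thesis
  proof (cases "x0 \<le> y")
    case True
    then show ?thesis using *[of x0 y] err assms(3,4) by (simp add: min_def max_def)
  next
    case False
    then have "\<bar>F x0 - F y - c * (x0 - y)\<bar> \<le> K * (x0 - y)"
      using *[of y x0] err assms(3,4) by (simp add: min_def max_def)
    moreover have "F y - F x0 - c * (y - x0) = - (F x0 - F y - c * (x0 - y))" by (simp add: algebra_simps)
    ultimately show ?thesis using False by simp
  qed
qed

section \<open>Consistency of the scheme on a time slice\<close>

text \<open>The first square is that of the constant in the flux consistency error; the second term
  belongs to the gap between the mean of \<open>h(v)\<close> and \<open>h\<close> of the mean.
  \<open>M\<close> bounds \<open>p\<close>, and \<open>M2\<close> the squared norm of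
  \<open>v_x\<close> uniformly in time.\<close>

definition (in nonlinearities) Acons :: "real \<Rightarrow> real \<Rightarrow> real" where
  "Acons M M2 = (2 + cb + cb * M)\<^sup>2 + c2\<^sup>2 * M2"

text \<open>A fixed time: \<open>f\<close> and \<open>q\<close> are the slices of \<open>v\<close> and \<open>p\<close>, while \<open>V\<close>, \<open>V1\<close>, \<open>P\<close>, \<open>w\<close> are the
  continuous representatives of \<open>v\<close>, \<open>v\<^sub>x\<close>, \<open>p\<close> and of the flux.\<close>

locale slice = nonlinearities +
  fixes f fx fxx q qx V V1 P w :: "real \<Rightarrow> real" and M M2 \<Gamma> :: real
  assumes acV: "ac_rep f fx V" and acV1: "ac_rep fx fxx V1" and acP: "ac_rep q qx P"
    and sq: "sq_int {0<..<1} f" "sq_int {0<..<1} fx" "sq_int {0<..<1} fxx" "sq_int {0<..<1} q" "sq_int {0<..<1} qx"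
    and q_bound: "AE x in lborel. x \<in> {0<..<1} \<longrightarrow> \<bar>q x\<bar> \<le> M"
    and M2: "(LBINT x. indicator {0<..<1} x * (fx x)\<^sup>2) \<le> M2"
    and Gam: "(LBINT x. indicator {0<..<1} x * (fx x)\<^sup>2) + (LBINT x. indicator {0<..<1} x * (fxx x)\<^sup>2)
      + (LBINT x. indicator {0<..<1} x * (qx x)\<^sup>2) = \<Gamma>"
    and w_cont: "continuous_on {0..1} w"
    and w_AE: "AE x in lborel. x \<in> {0<..<1} \<longrightarrow> w x = fx x + b (f x) * q x"
    and w0: "w 0 = 0" and w1: "w 1 = 0"
begin

lemma int_nonneg: "0 \<le> (LBINT x. indicator {0<..<1} x * (g x)\<^sup>2)" for g :: "real \<Rightarrow> real"
  by (intro Bochner_Integration.integral_nonneg) auto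

lemma Gam_parts: "(LBINT x. indicator {0<..<1} x * (fx x)\<^sup>2) \<le> \<Gamma>"
    "(LBINT x. indicator {0<..<1} x * (fxx x)\<^sup>2) \<le> \<Gamma>"
    "(LBINT x. indicator {0<..<1} x * (qx x)\<^sup>2) \<le> \<Gamma>" "0 \<le> \<Gamma>" "0 \<le> M2"
  using Gam M2 int_nonneg[of fx] int_nonneg[of fxx] int_nonneg[of qx] by linarith+

lemma V_AE: "AE x in lborel. x \<in> {0<..<1} \<longrightarrow> f x = V x"
  and V1_AE: "AE x in lborel. x \<in> {0<..<1} \<longrightarrow> fx x = V1 x"
  and P_AE: "AE x in lborel. x \<in> {0<..<1} \<longrightarrow> q x = P x"
  and V_cont: "continuous_on {0..1} V" and V1_cont: "continuous_on {0..1} V1" and P_cont: "continuous_on {0..1} P"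
  using acV acV1 acP by (auto simp: ac_rep_def)

text \<open>Continuous functions agreeing almost everywhere agree everywhere, so point values of the
  flux at the nodes may be expressed by the representatives \<open>V\<close>, \<open>V1\<close>,
  \<open>P\<close>.\<close>

lemma w_eq: "x \<in> {0..1} \<Longrightarrow> w x = V1 x + b (V x) * P x"
proof (rule continuous_eq_of_AE[OF zero_less_one w_cont])
  show "continuous_on {0..1} (\<lambda>x. V1 x + b (V x) * P x)"
    by (intro continuous_intros V_cont V1_cont P_cont)
  show "AE x in lborel. x \<in> {0<..<1} \<longrightarrow> w x = V1 x + b (V x) * P x"
    using w_AE V_AE V1_AE P_AE by eventually_elim auto
qed auto

lemma P_bound: "x \<in> {0..1} \<Longrightarrow> \<bar>P x\<bar> \<le> M"
proof (rule continuous_le_of_AE[OF zero_less_one, where u = "\<lambda>x. \<bar>P x\<bar>"])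
  show "AE x in lborel. x \<in> {0<..<1} \<longrightarrow> \<bar>P x\<bar> \<le> M"
    using q_bound P_AE by eventually_elim auto
qed (auto intro!: continuous_intros P_cont)

lemma M_nonneg: "0 \<le> M" using P_bound[of 0] by simp

text \<open>Compare \<open>V1 x\<close> with \<open>V1 y\<close> and average over \<open>y\<close>:
  the mean of \<open>(V1 y)^2\<close> and the squared oscillation are each at most
  \<open>\<Gamma>\<close>, and squaring a sum of two terms costs a factor 2.\<close>

lemma V1_bound: "x \<in> {0..1} \<Longrightarrow> \<bar>V1 x\<bar> \<le> 2 * sqrt \<Gamma>"
proof -
  assume x: "x \<in> {0..1}"
  have fx2: "integrable lborel (\<lambda>y. indicator {0<..<1} y * (fx y)\<^sup>2)"
    using sq_intD[OF sq(2)] by simp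
  have "(V1 x)\<^sup>2 = (LBINT y. (V1 x)\<^sup>2 * indicator {0<..<1::real} y)"
    by simp
  also have "\<dots> \<le> (LBINT y. 2 * (indicator {0<..<1} y * (fx y)\<^sup>2) + (2 * \<Gamma>) * indicator {0<..<1} y)"
  proof (rule integral_mono_AE)
    show "AE y in lborel. (V1 x)\<^sup>2 * indicator {0<..<1} y \<le> 2 * (indicator {0<..<1} y * (fx y)\<^sup>2) + (2 * \<Gamma>) * indicator {0<..<1} y"
      using V1_AE
    proof eventually_elim
      case (elim y)
      show ?case
      proof (cases "y \<in> {0<..<1}")
        case True
        have "(V1 x - V1 y)\<^sup>2 \<le> \<bar>x - y\<bar> * (LBINT x. indicator {0<..<1} x * (fxx x)\<^sup>2)"
          using ac_rep_holder[OF acV1 sq(3), of y x] x True by auto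
        also have "\<dots> \<le> 1 * \<Gamma>"
          using x True int_nonneg[of fxx] Gam_parts(2) by (intro mult_mono) auto
        finally have "(V1 x - V1 y)\<^sup>2 \<le> \<Gamma>" by simp
        moreover have "(V1 x)\<^sup>2 \<le> 2 * ((V1 y)\<^sup>2 + (V1 x - V1 y)\<^sup>2)"
          using square_add_le[of "V1 y" "V1 x - V1 y"] by simp
        ultimately show ?thesis using True elim by simp
      qed simp
    qed
  qed (use fx2 in auto)
  also have "\<dots> = 2 * (LBINT y. indicator {0<..<1} y * (fx y)\<^sup>2) + 2 * \<Gamma>"
    using fx2 by simp
  also have "\<dots> \<le> 4 * \<Gamma>" using Gam_parts(1) by simp
  finally have "\<bar>V1 x\<bar> \<le> sqrt (4 * \<Gamma>)"
    by (intro real_le_rsqrt) simp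
  then show ?thesis by (simp add: real_sqrt_mult)
qed

text \<open>A bound for the oscillation of \<open>V\<close>, \<open>V1\<close> and \<open>P\<close>
  over one cell width, in terms of the merely integrable \<open>\<Gamma>\<close>. Its companion
  \<open>om2\<close>, for \<open>V\<close> alone, uses the bound \<open>M2\<close> that is uniform
  in time.\<close>

definition om :: "nat \<Rightarrow> real" where "om n = sqrt (dx n * \<Gamma>)"
definition om2 :: "nat \<Rightarrow> real" where "om2 n = sqrt (dx n * M2)"

lemma osc_bound:
  assumes "ac_rep u g F" "sq_int {0<..<1} g" "(LBINT x. indicator {0<..<1} x * (g x)\<^sup>2) \<le> B"
    and "x \<in> {0..1}" "y \<in> {0..1}" "\<bar>y - x\<bar> \<le> d"
  shows "\<bar>F y - F x\<bar> \<le> sqrt (d * B)"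
proof (rule real_le_rsqrt)
  have "(F y - F x)\<^sup>2 \<le> \<bar>y - x\<bar> * (LBINT s. indicator {0<..<1} s * (g s)\<^sup>2)"
    by (rule ac_rep_holder[OF assms(1,2,4,5)])
  also have "\<dots> \<le> d * B"
    using assms int_nonneg[of g] by (intro mult_mono) auto
  finally show "\<bar>F y - F x\<bar>\<^sup>2 \<le> d * B" by simp
qed

context
  fixes n :: nat
  assumes n: "n \<ge> 1"
begin

lemma om_nonneg: "0 \<le> om n" "0 \<le> om2 n"
  using dx_pos[OF n] Gam_parts by (simp_all add: om_def om2_def)

lemma om_le: "om n \<le> sqrt \<Gamma>"
  unfolding om_def using dx_le_1[OF n] Gam_parts dx_pos[OF n] by (simp add: mult_left_le_one_le)

lemma V_near: "x \<in> {0..1} \<Longrightarrow> y \<in> {0..1} \<Longrightarrow> \<bar>y - x\<bar> \<le> dx n \<Longrightarrow> \<bar>V y - V x\<bar> \<le> om n"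
  and V_near2: "x \<in> {0..1} \<Longrightarrow> y \<in> {0..1} \<Longrightarrow> \<bar>y - x\<bar> \<le> dx n \<Longrightarrow> \<bar>V y - V x\<bar> \<le> om2 n"
  and V1_near: "x \<in> {0..1} \<Longrightarrow> y \<in> {0..1} \<Longrightarrow> \<bar>y - x\<bar> \<le> dx n \<Longrightarrow> \<bar>V1 y - V1 x\<bar> \<le> om n"
  and P_near: "x \<in> {0..1} \<Longrightarrow> y \<in> {0..1} \<Longrightarrow> \<bar>y - x\<bar> \<le> dx n \<Longrightarrow> \<bar>P y - P x\<bar> \<le> om n"
  unfolding om_def om2_def
  using osc_bound[OF acV sq(2) Gam_parts(1)] osc_bound[OF acV sq(2) M2]
    osc_bound[OF acV1 sq(3) Gam_parts(2)] osc_bound[OF acP sq(5) Gam_parts(3)] by blast+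

lemma V_lip: "x \<in> {0..1} \<Longrightarrow> y \<in> {0..1} \<Longrightarrow> \<bar>V y - V x\<bar> \<le> 2 * sqrt \<Gamma> * \<bar>y - x\<bar>"
proof -
  assume xy: "x \<in> {0..1}" "y \<in> {0..1}"
  have "\<bar>V y - V x - 0 * (y - x)\<bar> \<le> 2 * sqrt \<Gamma> * \<bar>y - x\<bar>"
  proof (rule ac_rep_affine_error[OF acV _ xy])
    show "AE s in lborel. s \<in> {min x y<..<max x y} \<longrightarrow> \<bar>fx s - 0\<bar> \<le> 2 * sqrt \<Gamma>"
      using V1_AE
    proof eventually_elim
      case (elim s)
      have "s \<in> {0<..<1}" if "s \<in> {min x y<..<max x y}"
        using that xy by (auto simp: min_def max_def split: if_splits)
      then show ?case using elim V1_bound[of s] by auto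
    qed
  qed (use sq_intD[OF sq(2)] in simp)
  then show ?thesis by simp
qed

abbreviation "X i \<equiv> real i * dx n"
abbreviation "Y i \<equiv> cavg n i f"

lemma X01: "i \<le> n \<Longrightarrow> X i \<in> {0..1}"
  using node_nonneg node_le_1[OF n] by simp

lemma in_cell:
  assumes "1 \<le> i" "i \<le> n" "x \<in> cell_Ioo n i"
  shows "x \<in> {0..1}" "x \<in> {0<..<1}" "\<bar>x - X i\<bar> \<le> dx n" "\<bar>x - X (i - 1)\<bar> \<le> dx n" "x' \<in> cell_Ioo n i \<Longrightarrow> \<bar>x' - x\<bar> \<le> dx n"
proof -
  show "x \<in> {0<..<1}" using cell_Ioo_subset[OF n assms(2)] assms(3) by blast
  then show "x \<in> {0..1}" by auto
qed (use assms(3) node_pred[OF assms(1), of n] in auto)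

lemma V_taylor:
  assumes "x0 \<in> {0..1}" "x \<in> {0..1}" "\<bar>x - x0\<bar> \<le> dx n"
  shows "\<bar>V x - (V x0 + V1 x0 * (x - x0))\<bar> \<le> om n * dx n"
proof -
  have "\<bar>V x - V x0 - V1 x0 * (x - x0)\<bar> \<le> om n * \<bar>x - x0\<bar>"
  proof (rule ac_rep_affine_error[OF acV _ assms(1,2)])
    show "AE s in lborel. s \<in> {min x0 x<..<max x0 x} \<longrightarrow> \<bar>fx s - V1 x0\<bar> \<le> om n"
      using V1_AE
    proof eventually_elim
      case (elim s)
      show ?case
      proof
        assume s: "s \<in> {min x0 x<..<max x0 x}"
        then have "s \<in> {0<..<1}" "\<bar>s - x0\<bar> \<le> dx n"
          using assms by (auto simp: min_def max_def split: if_splits)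
        then show "\<bar>fx s - V1 x0\<bar> \<le> om n" using elim V1_near[of x0 s] assms(1) by auto
      qed
    qed
  qed (use sq_intD[OF sq(2)] in simp)
  also have "\<dots> \<le> om n * dx n" using assms(3) om_nonneg by (intro mult_left_mono) auto
  finally show ?thesis by (simp add: diff_diff_eq)
qed

lemma f_int: "integrable lborel (\<lambda>x. indicator {0<..<1} x * f x)"
  and q_int: "integrable lborel (\<lambda>x. indicator {0<..<1} x * q x)"
  using sq_intD(3)[OF sq(1)] sq_intD(3)[OF sq(4)] by simp_all

text \<open>The midpoints of the cells \<open>i\<close> and \<open>i + 1\<close> lie half a cell to
  the left and to the right of the node \<open>X i\<close>. Subtracting the two expansions cancels
  \<open>V (X i)\<close> and leaves a difference quotient close to \<open>V1 (X i)\<close>.\<close>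

lemma Y_left:
  assumes "1 \<le> i" "i < n"
  shows "\<bar>Y i - (V (X i) - V1 (X i) * dx n / 2)\<bar> \<le> om n * dx n"
proof -
  have "\<bar>Y i - (V (X i) + V1 (X i) * (X i - dx n / 2 - X i))\<bar> \<le> om n * dx n"
  proof (rule cavg_affine_error[OF n assms(1) _ f_int])
    show "AE x in lborel. x \<in> cell_Ioo n i \<longrightarrow> \<bar>f x - (V (X i) + V1 (X i) * (x - X i))\<bar> \<le> om n * dx n"
      using V_AE
    proof eventually_elim
      case (elim x)
      then show ?case
        using in_cell[of i x] assms V_taylor[of "X i" x] X01[of i] by auto
    qed
  qed (use assms in simp)
  then show ?thesis by (simp add: algebra_simps)
qed

lemma Y_right:
  assumes "1 \<le> i" "i < n"
  shows "\<bar>Y (i + 1) - (V (X i) + V1 (X i) * dx n / 2)\<bar> \<le> om n * dx n"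
proof -
  have "\<bar>Y (i + 1) - (V (X i) + V1 (X i) * (X (i + 1) - dx n / 2 - X i))\<bar> \<le> om n * dx n"
  proof (rule cavg_affine_error[OF n _ _ f_int])
    show "AE x in lborel. x \<in> cell_Ioo n (i + 1) \<longrightarrow> \<bar>f x - (V (X i) + V1 (X i) * (x - X i))\<bar> \<le> om n * dx n"
      using V_AE
    proof eventually_elim
      case (elim x)
      then show ?case
        using in_cell[of "i + 1" x] assms V_taylor[of "X i" x] X01[of i] by auto
    qed
  qed (use assms in auto)
  then show ?thesis by (simp add: algebra_simps)
qed

lemma dY_near:
  assumes "1 \<le> i" "i < n"
  shows "\<bar>(Y (i + 1) - Y i) / dx n - V1 (X i)\<bar> \<le> 2 * om n"
proof -
  have "\<bar>(Y (i + 1) - Y i) - V1 (X i) * dx n\<bar> \<le> 2 * om n * dx n"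
    using Y_left[OF assms] Y_right[OF assms] by linarith
  moreover have "(Y (i + 1) - Y i) / dx n - V1 (X i) = ((Y (i + 1) - Y i) - V1 (X i) * dx n) / dx n"
    using dx_pos[OF n] by (simp add: diff_divide_distrib)
  ultimately show ?thesis
    using dx_pos[OF n] by (simp add: pos_divide_le_eq)
qed

lemma dY_bound:
  assumes "1 \<le> i" "i < n"
  shows "\<bar>Y (i + 1) - Y i\<bar> \<le> dx n * (4 * sqrt \<Gamma>)"
proof -
  have "\<bar>(Y (i + 1) - Y i) / dx n\<bar> \<le> 4 * sqrt \<Gamma>"
    using dY_near[OF assms] V1_bound[OF X01[of i]] om_le assms by linarith
  then show ?thesis using dx_pos[OF n] by (simp add: pos_divide_le_eq mult.commute)
qed

lemma Y_near:
  assumes "1 \<le> i" "i \<le> n" "AE x in lborel. x \<in> cell_Ioo n i \<longrightarrow> \<bar>V x - c\<bar> \<le> K"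
  shows "\<bar>Y i - c\<bar> \<le> K"
proof (rule cavg_const_error[OF n assms(1,2) f_int])
  show "AE x in lborel. x \<in> cell_Ioo n i \<longrightarrow> \<bar>f x - c\<bar> \<le> K"
    using V_AE assms(3)
  proof eventually_elim
    case (elim x)
    then show ?case using in_cell(2)[OF assms(1,2), of x] by simp
  qed
qed

lemma Y_node:
  assumes "1 \<le> i" "i < n"
  shows "\<bar>Y i - V (X i)\<bar> \<le> om n" "\<bar>Y (i + 1) - V (X i)\<bar> \<le> om n"
proof -
  show "\<bar>Y i - V (X i)\<bar> \<le> om n"
  proof (intro Y_near AE_I2 impI)
    fix x assume x: "x \<in> cell_Ioo n i"
    show "\<bar>V x - V (X i)\<bar> \<le> om n"
      by (rule V_near[OF X01 in_cell(1)[OF _ _ x] in_cell(3)[OF _ _ x]]) (use assms in auto)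
  qed (use assms in auto)
  show "\<bar>Y (i + 1) - V (X i)\<bar> \<le> om n"
  proof (intro Y_near AE_I2 impI)
    fix x assume x: "x \<in> cell_Ioo n (i + 1)"
    have "\<bar>x - X i\<bar> \<le> dx n" using in_cell(4)[OF _ _ x] assms by simp
    then show "\<bar>V x - V (X i)\<bar> \<le> om n"
      by (rule V_near[OF X01 in_cell(1)[OF _ _ x], rotated -1]) (use assms in auto)
  qed (use assms in auto)
qed

lemma Q_near:
  assumes "1 \<le> i" "i < n"
  shows "\<bar>cavg n i q - P (X i)\<bar> \<le> om n"
proof (rule cavg_const_error[OF n assms(1) _ q_int])
  show "AE x in lborel. x \<in> cell_Ioo n i \<longrightarrow> \<bar>q x - P (X i)\<bar> \<le> om n"
    using P_AE
  proof eventually_elim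
    case (elim x)
    show ?case
    proof
      assume x: "x \<in> cell_Ioo n i"
      have "\<bar>P x - P (X i)\<bar> \<le> om n"
        by (rule P_near[OF X01 in_cell(1)[OF _ _ x] in_cell(3)[OF _ _ x]]) (use assms in auto)
      then show "\<bar>q x - P (X i)\<bar> \<le> om n"
        using elim in_cell(2)[OF _ _ x] assms by simp
    qed
  qed
qed (use assms in simp)

lemma Q_bound:
  assumes "1 \<le> i" "i \<le> n"
  shows "\<bar>cavg n i q\<bar> \<le> M"
proof -
  have "\<bar>cavg n i q - 0\<bar> \<le> M"
  proof (rule cavg_const_error[OF n assms q_int])
    show "AE x in lborel. x \<in> cell_Ioo n i \<longrightarrow> \<bar>q x - 0\<bar> \<le> M"
      using q_bound
    proof eventually_elim
      case (elim x)
      then show ?case using in_cell(2)[OF assms, of x] by simp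
    qed
  qed
  then show ?thesis by simp
qed

text \<open>The 2 comes from the difference quotient, \<open>cb\<close> from replacing
  \<open>P\<close> at the node by its average over the left cell, and \<open>cb * M\<close> from the
  argument of \<open>b\<close>. The one-sided average costs no more than the oscillation of
  \<open>P\<close>.\<close>

lemma flux_consistency:
  assumes "1 \<le> i" "i < n"
  shows "\<bar>w (X i) - ((Y (i + 1) - Y i) / dx n + b ((Y i + Y (i + 1)) / 2) * cavg n i q)\<bar> \<le> (2 + cb + cb * M) * om n"
proof -
  define v where "v = (Y i + Y (i + 1)) / 2"
  have "\<bar>v - V (X i)\<bar> \<le> om n"
    using Y_node[OF assms, unfolded abs_le_iff] unfolding v_def abs_le_iff
    by (elim conjE, intro conjI) (simp_all add: field_simps)
  then have bv: "\<bar>b (V (X i)) - b v\<bar> \<le> cb * om n"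
    using cb by (intro order_trans[OF b_lip mult_left_mono]) (auto simp: abs_minus_commute)
  have "w (X i) - ((Y (i + 1) - Y i) / dx n + b v * cavg n i q)
    = - ((Y (i + 1) - Y i) / dx n - V1 (X i)) - b (V (X i)) * (cavg n i q - P (X i)) + (b (V (X i)) - b v) * cavg n i q"
    using w_eq[OF X01[of i]] assms by (simp add: algebra_simps)
  moreover have "\<bar>b (V (X i)) * (cavg n i q - P (X i))\<bar> \<le> cb * om n"
    unfolding abs_mult using b0 Q_near[OF assms] cb by (intro mult_mono) auto
  moreover have "\<bar>(b (V (X i)) - b v) * cavg n i q\<bar> \<le> (cb * om n) * M"
    unfolding abs_mult using bv Q_bound[of i] assms cb om_nonneg by (intro mult_mono) auto
  ultimately have "\<bar>w (X i) - ((Y (i + 1) - Y i) / dx n + b v * cavg n i q)\<bar> \<le> 2 * om n + cb * om n + cb * om n * M"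
    using dY_near[OF assms] by linarith
  then show ?thesis by (simp add: v_def algebra_simps)
qed

abbreviation "HY i \<equiv> cavg n i (\<lambda>x. h (f x))"

lemma V_cell:
  assumes "1 \<le> i" "i \<le> n" "x \<in> cell_Ioo n i"
  shows "\<bar>V x - Y i\<bar> \<le> om2 n" "\<bar>V x - Y i\<bar> \<le> 2 * sqrt \<Gamma> * dx n"
proof -
  have "\<bar>V x' - V x\<bar> \<le> om2 n" if "x' \<in> cell_Ioo n i" for x'
    by (rule V_near2[OF in_cell(1)[OF assms] in_cell(1)[OF assms(1,2) that] in_cell(5)[OF assms that]])
  then have "\<bar>Y i - V x\<bar> \<le> om2 n"
    by (intro Y_near[OF assms(1,2)] AE_I2 impI)
  then show "\<bar>V x - Y i\<bar> \<le> om2 n" by (subst abs_minus_commute)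
  have "\<bar>V x' - V x\<bar> \<le> 2 * sqrt \<Gamma> * dx n" if "x' \<in> cell_Ioo n i" for x'
  proof -
    have "\<bar>V x' - V x\<bar> \<le> 2 * sqrt \<Gamma> * \<bar>x' - x\<bar>"
      by (rule V_lip[OF in_cell(1)[OF assms] in_cell(1)[OF assms(1,2) that]])
    also have "\<dots> \<le> 2 * sqrt \<Gamma> * dx n"
      using in_cell(5)[OF assms that] Gam_parts by (intro mult_left_mono) auto
    finally show ?thesis .
  qed
  then have "\<bar>Y i - V x\<bar> \<le> 2 * sqrt \<Gamma> * dx n"
    by (intro Y_near[OF assms(1,2)] AE_I2 impI)
  then show "\<bar>V x - Y i\<bar> \<le> 2 * sqrt \<Gamma> * dx n" by (subst abs_minus_commute)
qed

lemma hf_int: "integrable lborel (\<lambda>x. indicator {0<..<1} x * h (f x))"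
proof (rule Bochner_Integration.integrable_bound)
  have "(\<lambda>x. indicator {0<..<1} x * h (f x)) = (\<lambda>x. indicator {0<..<1} x * h (indicator {0<..<1} x * f x))"
    by (intro ext) (simp add: indicator_def)
  then show "(\<lambda>x. indicator {0<..<1} x * h (f x)) \<in> borel_measurable lborel"
    using f_int by (auto intro!: borel_measurable_times measurable_compose[OF _ h_measurable])
  show "integrable lborel (\<lambda>x. \<bar>h 0\<bar> * indicator {0<..<1} x + c2 * \<bar>indicator {0<..<1} x * f x\<bar>)"
    using f_int by (intro Bochner_Integration.integrable_add integrable_mult_right integrable_abs) auto
  show "AE x in lborel. norm (indicator {0<..<1} x * h (f x)) \<le> norm (\<bar>h 0\<bar> * indicator {0<..<1} x + c2 * \<bar>indicator {0<..<1} x * f x\<bar>)"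
  proof (intro AE_I2)
    fix x
    have "\<bar>h (f x)\<bar> \<le> \<bar>h 0\<bar> + c2 * \<bar>f x\<bar>" using h_lip[of "f x" 0] abs_triangle_ineq[of "h 0" "h (f x) - h 0"] by simp
    then show "norm (indicator {0<..<1} x * h (f x)) \<le> norm (\<bar>h 0\<bar> * indicator {0<..<1} x + c2 * \<bar>indicator {0<..<1} x * f x\<bar>)"
      by (cases "x \<in> {0<..<1}") auto
  qed
qed

text \<open>The first bound only uses that \<open>h\<close> is Lipschitz. For the second, the linear
  part of \<open>h\<close> at \<open>Y i\<close> averages out and the two factors of the quadratic
  remainder are estimated differently, by \<open>om2 n\<close> and by the sup bound on
  \<open>V1\<close>.\<close>

lemma r_bound:
  assumes "1 \<le> i" "i \<le> n"
  shows "\<bar>HY i - h (Y i)\<bar> \<le> c2 * om2 n" "\<bar>HY i - h (Y i)\<bar> \<le> c2 * (om2 n * (2 * sqrt \<Gamma> * dx n))"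
proof -
  show "\<bar>HY i - h (Y i)\<bar> \<le> c2 * om2 n"
  proof (rule cavg_const_error[OF n assms hf_int])
    show "AE x in lborel. x \<in> cell_Ioo n i \<longrightarrow> \<bar>h (f x) - h (Y i)\<bar> \<le> c2 * om2 n"
      using V_AE
    proof eventually_elim
      case (elim x)
      show ?case
      proof
        assume x: "x \<in> cell_Ioo n i"
        have "\<bar>h (f x) - h (Y i)\<bar> \<le> c2 * \<bar>f x - Y i\<bar>" by (rule h_lip)
        also have "\<dots> \<le> c2 * om2 n"
          using elim V_cell(1)[OF assms x] in_cell(2)[OF assms x] c2 by (intro mult_left_mono) auto
        finally show "\<bar>h (f x) - h (Y i)\<bar> \<le> c2 * om2 n" .
      qed
    qed
  qed
  define m where "m = deriv h (Y i)"
  \<comment> \<open>Removing \<open>m * f\<close> changes the mean by exactly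
    \<open>m * Y i\<close>, so no first-order error remains.\<close>
  define g where "g = (\<lambda>x. h (f x) - m * f x)"
  have gi: "integrable lborel (\<lambda>x. indicator {0<..<1} x * g x)"
  proof -
    have "(\<lambda>x. indicator {0<..<1} x * g x) = (\<lambda>x. indicator {0<..<1} x * h (f x) - m * (indicator {0<..<1} x * f x))"
      by (auto simp: g_def algebra_simps)
    then show ?thesis using hf_int f_int by simp
  qed
  have "\<bar>cavg n i g - (h (Y i) - m * Y i)\<bar> \<le> c2 * (om2 n * (2 * sqrt \<Gamma> * dx n))"
  proof (rule cavg_const_error[OF n assms gi])
    show "AE x in lborel. x \<in> cell_Ioo n i \<longrightarrow> \<bar>g x - (h (Y i) - m * Y i)\<bar> \<le> c2 * (om2 n * (2 * sqrt \<Gamma> * dx n))"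
      using V_AE
    proof eventually_elim
      case (elim x)
      show ?case
      proof
        assume x: "x \<in> cell_Ioo n i"
        have "\<bar>g x - (h (Y i) - m * Y i)\<bar> \<le> c2 * (f x - Y i)\<^sup>2"
          using h_taylor[of "f x" "Y i"] by (simp add: g_def m_def algebra_simps)
        also have "(f x - Y i)\<^sup>2 = \<bar>V x - Y i\<bar> * \<bar>V x - Y i\<bar>"
          using elim in_cell(2)[OF assms x] by (simp add: power2_eq_square)
        also have "c2 * (\<bar>V x - Y i\<bar> * \<bar>V x - Y i\<bar>) \<le> c2 * (om2 n * (2 * sqrt \<Gamma> * dx n))"
          using V_cell[OF assms x] om_nonneg c2 by (intro mult_left_mono mult_mono) auto
        finally show "\<bar>g x - (h (Y i) - m * Y i)\<bar> \<le> c2 * (om2 n * (2 * sqrt \<Gamma> * dx n))" .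
      qed
    qed
  qed
  moreover have "cavg n i g = HY i - m * Y i"
  proof -
    have i1: "integrable lborel (\<lambda>x. indicator (cell_Ioo n i) x * h (f x))" "integrable lborel (\<lambda>x. indicator (cell_Ioo n i) x * f x)"
      using cell_Ioo_subset[OF n assms(2)] by (auto intro!: integrable_sub_Ioo hf_int f_int)
    have "(LBINT x. indicator (cell_Ioo n i) x * g x) =
      (LBINT x. indicator (cell_Ioo n i) x * h (f x) - m * (indicator (cell_Ioo n i) x * f x))"
      by (intro Bochner_Integration.integral_cong refl) (simp add: g_def algebra_simps)
    also have "\<dots> = (LBINT x. indicator (cell_Ioo n i) x * h (f x)) - m * (LBINT x. indicator (cell_Ioo n i) x * f x)"
      by (subst Bochner_Integration.integral_diff) (use i1 in auto)
    finally show ?thesis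
      using cavg_eq[OF n assms, of g] cavg_eq[OF n assms, of f] cavg_eq[OF n assms, of "\<lambda>x. h (f x)"] gi f_int hf_int
      by (simp add: right_diff_distrib)
  qed
  ultimately show "\<bar>HY i - h (Y i)\<bar> \<le> c2 * (om2 n * (2 * sqrt \<Gamma> * dx n))"
    by simp
qed

lemma Acons_nonneg: "0 \<le> Acons M M2"
  unfolding Acons_def using Gam_parts by simp

lemma r_sq: "1 \<le> i \<Longrightarrow> i \<le> n \<Longrightarrow> (HY i - h (Y i))\<^sup>2 \<le> Acons M M2 * dx n"
proof -
  assume i: "1 \<le> i" "i \<le> n"
  have "(HY i - h (Y i))\<^sup>2 \<le> (c2 * om2 n)\<^sup>2" by (rule square_mono_abs[OF r_bound(1)[OF i]])
  also have "\<dots> = c2\<^sup>2 * M2 * dx n"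
    using dx_pos[OF n] Gam_parts by (simp add: om2_def power_mult_distrib)
  also have "\<dots> \<le> Acons M M2 * dx n"
    using dx_pos[OF n] by (intro mult_right_mono) (auto simp: Acons_def)
  finally show ?thesis .
qed

text \<open>The difference quotients of the exact averages are bounded by
  \<open>4 * sqrt \<Gamma>\<close>, whose square is the \<open>16 * \<Gamma>\<close>.\<close>

lemma slice_energy:
  fixes z R e :: "nat \<Rightarrow> real"
  assumes R: "\<And>i. 1 \<le> i \<Longrightarrow> i < n \<Longrightarrow> R i = w (X i) - ((z (i+1) - z i) / dx n + b ((z i + z (i+1)) / 2) * cavg n i q)"
    and R0: "R 0 = 0" "R n = 0"
    and e: "\<And>i. 1 \<le> i \<Longrightarrow> i \<le> n \<Longrightarrow> e i = HY i - h (z i)"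
  shows "(\<Sum>i=1..n. e i * (R i - R (i - 1))) + (c1 / 2) * (\<Sum>i\<in>{1..<n}. dx n * (((Y (i+1) - Y i) - (z (i+1) - z i)) / dx n)\<^sup>2)
    \<le> Ken M * (1 + 16 * \<Gamma>) * (Acons M M2 * dx n + (\<Sum>i=1..n. dx n * (e i)\<^sup>2))"
proof -
  have S2: "(4 * sqrt \<Gamma>)\<^sup>2 = 16 * \<Gamma>" using Gam_parts by (simp add: power_mult_distrib)
  have d: "0 < dx n" by (rule dx_pos[OF n])
  have om2: "(om2 n)\<^sup>2 = dx n * M2" and om: "(om n)\<^sup>2 = dx n * \<Gamma>"
    using d Gam_parts by (simp_all add: om_def om2_def)
  have "(\<Sum>i=1..n. e i * (R i - R (i - 1))) + (c1 / 2) * (\<Sum>i\<in>{1..<n}. dx n * (((Y (i+1) - Y i) - (z (i+1) - z i)) / dx n)\<^sup>2)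
    \<le> Ken M * (1 + (4 * sqrt \<Gamma>)\<^sup>2) * (Acons M M2 * dx n + (\<Sum>i=1..n. dx n * (e i)\<^sup>2))"
  proof (rule discrete_energy[OF n, where W = "\<lambda>i. w (X i)" and P = "\<lambda>i. cavg n i q" and r = "\<lambda>i. HY i - h (Y i)"])
    fix i assume i: "1 \<le> i" "i < n"
    have "(w (X i) - ((Y (i+1) - Y i) / dx n + b ((Y i + Y (i+1)) / 2) * cavg n i q))\<^sup>2 \<le> ((2 + cb + cb * M) * om n)\<^sup>2"
      by (rule square_mono_abs[OF flux_consistency[OF i]])
    also have "\<dots> = (2 + cb + cb * M)\<^sup>2 * dx n * \<Gamma>" by (simp add: power_mult_distrib om)
    also have "\<dots> \<le> Acons M M2 * dx n * (1 + 16 * \<Gamma>)"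
      using d Gam_parts by (intro mult_mono mult_right_mono) (auto simp: Acons_def)
    finally show "(w (X i) - ((Y (i+1) - Y i) / dx n + b ((Y i + Y (i+1)) / 2) * cavg n i q))\<^sup>2
      \<le> Acons M M2 * dx n * (1 + (4 * sqrt \<Gamma>)\<^sup>2)" by (simp only: S2)
    have "\<bar>(HY (i+1) - h (Y (i+1)) - (HY i - h (Y i))) / dx n\<bar> \<le> c2 * (om2 n * (4 * sqrt \<Gamma>))"
    proof -
      have "\<bar>HY (i+1) - h (Y (i+1)) - (HY i - h (Y i))\<bar> \<le> 2 * (c2 * (om2 n * (2 * sqrt \<Gamma> * dx n)))"
        using r_bound(2)[of i] r_bound(2)[of "i+1"] i by auto
      then show ?thesis using d by (simp add: pos_divide_le_eq algebra_simps)
    qed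
    then have "((HY (i+1) - h (Y (i+1)) - (HY i - h (Y i))) / dx n)\<^sup>2 \<le> (c2 * (om2 n * (4 * sqrt \<Gamma>)))\<^sup>2"
      by (rule square_mono_abs)
    also have "\<dots> = c2\<^sup>2 * M2 * dx n * (16 * \<Gamma>)"
      using Gam_parts by (simp add: power_mult_distrib om2)
    also have "\<dots> \<le> Acons M M2 * dx n * (1 + 16 * \<Gamma>)"
      using d Gam_parts by (intro mult_mono mult_right_mono) (auto simp: Acons_def)
    finally show "((HY (i+1) - h (Y (i+1)) - (HY i - h (Y i))) / dx n)\<^sup>2 \<le> Acons M M2 * dx n * (1 + (4 * sqrt \<Gamma>)\<^sup>2)"
      by (simp only: S2)
  qed (use R R0 e Q_bound dY_bound r_sq M_nonneg Gam_parts d Acons_nonneg in \<open>auto simp: dx_def\<close>)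
  then show ?thesis by (simp only: S2)
qed

end

end

section \<open>From cell errors to the norms in the statement\<close>

lemma cell_iff:
  assumes "n \<ge> 1" "0 \<le> x" "x < 1" "1 \<le> i" "i \<le> n"
  shows "x \<in> cell n i \<longleftrightarrow> i = nat \<lfloor>x * real n\<rfloor> + 1"
proof -
  have n0: "0 < real n" using assms by simp
  have "x \<in> cell n i \<longleftrightarrow> real (i - 1) \<le> x * real n \<and> x * real n < real i"
    using assms n0 by (auto simp: cell_def dx_def pos_divide_le_eq pos_less_divide_eq)
  also have "\<dots> \<longleftrightarrow> \<lfloor>x * real n\<rfloor> = int i - 1"
    using assms(4) by (simp add: floor_eq_iff of_nat_diff)
  also have "\<dots> \<longleftrightarrow> i = nat \<lfloor>x * real n\<rfloor> + 1"
  proof -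
    have "0 \<le> \<lfloor>x * real n\<rfloor>" using assms n0 by simp
    then show ?thesis using assms(4) by auto
  qed
  finally show ?thesis .
qed

lemma cell_exists:
  assumes "n \<ge> 1" "0 \<le> x" "x < 1"
  obtains i where "1 \<le> i" "i \<le> n" "x \<in> cell n i"
proof -
  define i where "i = nat \<lfloor>x * real n\<rfloor> + 1"
  have "x * real n < real n" using assms by simp
  then have "\<lfloor>x * real n\<rfloor> < int n" by (simp add: floor_less_iff)
  moreover have "0 \<le> \<lfloor>x * real n\<rfloor>" using assms by simp
  ultimately have "1 \<le> i" "i \<le> n" unfolding i_def by linarith+
  then show ?thesis using that[of i] cell_iff[OF assms] by (simp add: i_def)
qed

lemma vapprox_cell:
  assumes "n \<ge> 1" "0 \<le> x" "x < 1" "1 \<le> i" "i \<le> n" "x \<in> cell n i"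
  shows "vapprox n vs t x = vs i t"
proof -
  have "vapprox n vs t x = (\<Sum>j=1..n. if j = i then vs i t else 0)"
    unfolding vapprox_def
  proof (rule sum.cong[OF refl])
    fix j assume "j \<in> {1..n}"
    then show "indicator (cell n j) x * vs j t = (if j = i then vs i t else 0)"
      using cell_iff[OF assms(1-3)] assms(4-6) by (auto simp: indicator_def)
  qed
  also have "\<dots> = vs i t" using assms(4,5) by simp
  finally show ?thesis .
qed

text \<open>Shifting by \<open>dx n\<close> lowers the cell index by exactly one, so the backward
  difference at a point of cell \<open>i + 1\<close> is the difference quotient across the node
  \<open>i\<close>.\<close>

lemma vtilde_cell:
  assumes n: "n \<ge> 1" and x: "dx n \<le> x" "x < 1"
  obtains i where "1 \<le> i" "i < n" "x \<in> cell n (i + 1)" "vtilde n vs t x = (vs (i + 1) t - vs i t) / dx n"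
proof -
  have d: "0 < dx n" by (rule dx_pos[OF n])
  obtain j where j: "1 \<le> j" "j \<le> n" "x \<in> cell n j" using cell_exists[OF n] x d by (metis less_le_trans less_imp_le)
  have jf: "j = nat \<lfloor>x * real n\<rfloor> + 1" using cell_iff[OF n, of x j] x d j by simp
  have "1 \<le> x * real n" using x n by (simp add: dx_def pos_divide_le_eq)
  then have fl: "1 \<le> \<lfloor>x * real n\<rfloor>" by (simp add: le_floor_iff)
  then have fl': "1 \<le> nat \<lfloor>x * real n\<rfloor>" by linarith
  define i where "i = j - 1"
  have i: "1 \<le> i" "i < n" "j = i + 1" unfolding i_def using jf fl' j by linarith+
  have "(x - dx n) * real n = x * real n - 1" using n by (simp add: dx_def left_diff_distrib)
  then have "\<lfloor>(x - dx n) * real n\<rfloor> = \<lfloor>x * real n\<rfloor> - 1" by simp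
  then have "i = nat \<lfloor>(x - dx n) * real n\<rfloor> + 1"
    using jf fl i(3) by linarith
  then have "x - dx n \<in> cell n i"
    using cell_iff[OF n, of "x - dx n" i] x d i by simp
  then have "vapprox n vs t (x - dx n) = vs i t"
    using vapprox_cell[OF n, of "x - dx n" i] x d i by simp
  moreover have "vapprox n vs t x = vs (i + 1) t"
    using vapprox_cell[OF n, of x j] x d i j by simp
  ultimately have "vtilde n vs t x = (vs (i + 1) t - vs i t) / dx n"
    using x by (simp add: vtilde_def)
  then show ?thesis using that[of i] i j by simp
qed

lemma AE_cells:
  assumes "n \<ge> 1"
  shows "AE x in lborel. \<forall>i\<in>{1..n}. x \<in> cell n i \<longleftrightarrow> x \<in> cell_Ioo n i"
  using AE_cell[OF assms] by (intro eventually_ball_finite) auto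

text \<open>If \<open>g\<close> fails to be integrable, its integral has the default value 0, which
  the nonnegative step function bounds as well; hence a pointwise bound suffices.\<close>

lemma cell_sum_bound:
  fixes u c :: "nat \<Rightarrow> real"
  assumes n: "n \<ge> 1" and I: "I \<subseteq> {1..n}" and c: "\<And>i. i \<in> I \<Longrightarrow> 0 \<le> c i"
    and le: "AE x in lborel. g x \<le> (\<Sum>i\<in>I. indicator (cell_Ioo n i) x * c i)"
  shows "(LBINT x. g x) \<le> (\<Sum>i\<in>I. dx n * c i)"
proof -
  have "(LBINT x. g x) \<le> (LBINT x. (\<Sum>i\<in>I. c i * indicator (cell_Ioo n i) x))"
  proof (rule integral_mono_AE')
    show "AE x in lborel. g x \<le> (\<Sum>i\<in>I. c i * indicator (cell_Ioo n i) x)"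
      using le by (simp add: mult.commute)
    show "AE x in lborel. 0 \<le> (\<Sum>i\<in>I. c i * indicator (cell_Ioo n i) x)"
      using c by (intro AE_I2 sum_nonneg) auto
  qed auto
  also have "\<dots> = (\<Sum>i\<in>I. c i * (LBINT x. indicator (cell_Ioo n i) x))"
    by (subst Bochner_Integration.integral_sum) auto
  also have "\<dots> = (\<Sum>i\<in>I. dx n * c i)"
  proof (rule sum.cong[OF refl])
    fix i assume "i \<in> I"
    then have "real i * dx n - real (i - 1) * dx n = dx n" using I node_pred[of i n] by auto
    then show "c i * (LBINT x. indicator (cell_Ioo n i) x) = dx n * c i"
      using dx_pos[OF n] by simp
  qed
  finally show ?thesis .
qed

lemma sum_term_ge:
  fixes c :: "'i \<Rightarrow> real"
  assumes "finite I" "i \<in> I" "x \<in> S i" "\<And>j. j \<in> I \<Longrightarrow> 0 \<le> c j" "y \<le> c i"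
  shows "y \<le> (\<Sum>j\<in>I. indicator (S j) x * c j)"
proof -
  have "indicator (S i) x * c i \<le> (\<Sum>j\<in>I. indicator (S j) x * c j)"
    using assms by (intro member_le_sum) auto
  then show ?thesis using assms(3,5) by simp
qed

text \<open>Split the error into \<open>V - Y\<close>, at most \<open>om2 n\<close> on a cell, and
  \<open>Y - z\<close>, which coercivity of \<open>h\<close> bounds by \<open>|e - r| / c1\<close>.
  Two squares of sums account for the 4.\<close>

lemma (in slice) slice_L2:
  assumes n: "n \<ge> 1" and e: "\<And>i. 1 \<le> i \<Longrightarrow> i \<le> n \<Longrightarrow> e i = cavg n i (\<lambda>x. h (f x)) - h (vs i t)"
  shows "(LBINT x. indicator {0<..<1} x * (f x - vapprox n vs t x)\<^sup>2)
    \<le> 2 * M2 * dx n + (4 / c1\<^sup>2) * (Acons M M2 * dx n + (\<Sum>i=1..n. dx n * (e i)\<^sup>2))"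
proof -
  define Y where "Y = (\<lambda>i. cavg n i f)"
  define C where "C = (\<lambda>i. 2 * (om2 n)\<^sup>2 + 2 * (Y i - vs i t)\<^sup>2)"
  have d: "0 < dx n" by (rule dx_pos[OF n])
  have "(LBINT x. indicator {0<..<1} x * (f x - vapprox n vs t x)\<^sup>2) \<le> (\<Sum>i\<in>{1..n}. dx n * C i)"
  proof (rule cell_sum_bound[OF n order_refl])
    show "AE x in lborel. indicator {0<..<1} x * (f x - vapprox n vs t x)\<^sup>2 \<le> (\<Sum>i\<in>{1..n}. indicator (cell_Ioo n i) x * C i)"
      using AE_cells[OF n] V_AE
    proof eventually_elim
      case (elim x)
      show ?case
      proof (cases "x \<in> {0<..<1}")
        case True
        obtain i where i: "1 \<le> i" "i \<le> n" "x \<in> cell n i" using cell_exists[OF n, of x] True by auto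
        have xi: "x \<in> cell_Ioo n i" using elim i by auto
        have "(f x - vs i t)\<^sup>2 \<le> 2 * ((V x - Y i)\<^sup>2 + (Y i - vs i t)\<^sup>2)"
          using square_add_le[of "V x - Y i" "Y i - vs i t"] elim True by simp
        also have "(V x - Y i)\<^sup>2 \<le> (om2 n)\<^sup>2"
          unfolding Y_def by (rule square_mono_abs[OF V_cell(1)[OF n i(1,2) xi]])
        finally have "(f x - vs i t)\<^sup>2 \<le> C i" by (simp add: C_def)
        then show ?thesis
          using vapprox_cell[OF n _ _ i] True xi i by (intro sum_term_ge[where i = i]) (auto simp: C_def)
      next
        case False
        then show ?thesis by (auto intro!: sum_nonneg simp: C_def)
      qed
    qed
  qed (simp add: C_def)
  also have "\<dots> \<le> (\<Sum>i\<in>{1..n}. dx n * (2 * (om2 n)\<^sup>2 + (4 / c1\<^sup>2) * ((e i)\<^sup>2 + Acons M M2 * dx n)))"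
  proof (intro sum_mono mult_left_mono)
    fix i assume "i \<in> {1..n}"
    then have i: "1 \<le> i" "i \<le> n" by auto
    define r where "r = cavg n i (\<lambda>x. h (f x)) - h (Y i)"
    have "c1 * \<bar>Y i - vs i t\<bar> \<le> \<bar>h (Y i) - h (vs i t)\<bar>" by (rule h_coercive)
    also have "\<dots> = \<bar>e i - r\<bar>" using e[OF i] by (simp add: r_def)
    finally have "(c1 * \<bar>Y i - vs i t\<bar>)\<^sup>2 \<le> (e i - r)\<^sup>2"
      using c1 by (simp add: abs_le_square_iff[symmetric] abs_mult)
    also have "\<dots> \<le> 2 * ((e i)\<^sup>2 + r\<^sup>2)"
      using square_add_le[of "e i" "- r"] by simp
    also have "r\<^sup>2 \<le> Acons M M2 * dx n"
      unfolding r_def Y_def by (rule r_sq[OF n i])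
    finally have "c1\<^sup>2 * (Y i - vs i t)\<^sup>2 \<le> 2 * ((e i)\<^sup>2 + Acons M M2 * dx n)"
      by (simp add: power_mult_distrib)
    then have "(Y i - vs i t)\<^sup>2 \<le> 2 * ((e i)\<^sup>2 + Acons M M2 * dx n) / c1\<^sup>2"
      using c1 by (simp add: pos_le_divide_eq mult.commute)
    moreover have "(4 / c1\<^sup>2) * ((e i)\<^sup>2 + Acons M M2 * dx n) = 2 * (2 * ((e i)\<^sup>2 + Acons M M2 * dx n) / c1\<^sup>2)"
      by simp
    ultimately show "C i \<le> 2 * (om2 n)\<^sup>2 + (4 / c1\<^sup>2) * ((e i)\<^sup>2 + Acons M M2 * dx n)"
      unfolding C_def by linarith
  qed (use d in auto)
  also have "\<dots> = real n * dx n * (2 * (om2 n)\<^sup>2 + (4 / c1\<^sup>2) * (Acons M M2 * dx n)) + (4 / c1\<^sup>2) * (\<Sum>i=1..n. dx n * (e i)\<^sup>2)"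
    by (simp add: sum.distrib sum_distrib_left distrib_left mult.left_commute)
  also have "real n * dx n = 1" by (rule n_dx[OF n])
  also have "(om2 n)\<^sup>2 = M2 * dx n" using d Gam_parts by (simp add: om2_def mult.commute)
  finally show ?thesis by (simp add: algebra_simps)
qed

text \<open>Moving from \<open>x\<close> to the node costs one \<open>om n\<close>, the difference
  quotient there two more; the rest is the discrete gradient of the error. Squaring turns
  \<open>3 * om n\<close> into the factor \<open>2 * 9 = 18\<close>.\<close>

lemma (in slice) slice_H1:
  assumes n: "n \<ge> 1"
  shows "(LBINT x. indicator {dx n..1} x * (fx x - vtilde n vs t x)\<^sup>2)
    \<le> 18 * \<Gamma> * dx n + 2 * (\<Sum>i\<in>{1..<n}. dx n * (((cavg n (i+1) f - cavg n i f) - (vs (i+1) t - vs i t)) / dx n)\<^sup>2)"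
proof -
  define Dd where "Dd = (\<lambda>i. ((cavg n (i+1) f - cavg n i f) - (vs (i+1) t - vs i t)) / dx n)"
  \<comment> \<open>On cell \<open>i\<close> the backward difference belongs to the node
    \<open>i - 1\<close>, and the sum starts with the second cell.\<close>
  define C where "C = (\<lambda>i. 18 * (om n)\<^sup>2 + 2 * (Dd (i - 1))\<^sup>2)"
  have d: "0 < dx n" by (rule dx_pos[OF n])
  have "(LBINT x. indicator {dx n..1} x * (fx x - vtilde n vs t x)\<^sup>2) \<le> (\<Sum>i\<in>{2..n}. dx n * C i)"
  proof (rule cell_sum_bound[OF n])
    show "AE x in lborel. indicator {dx n..1} x * (fx x - vtilde n vs t x)\<^sup>2 \<le> (\<Sum>i\<in>{2..n}. indicator (cell_Ioo n i) x * C i)"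
      using AE_cells[OF n] V1_AE AE_lborel_singleton[of 1]
    proof eventually_elim
      case (elim x)
      show ?case
      proof (cases "x \<in> {dx n..1}")
        case True
        then have x: "dx n \<le> x" "x < 1" using elim by auto
        then have x1: "fx x = V1 x" using elim d by auto
        obtain i where i: "1 \<le> i" "i < n" "x \<in> cell n (i + 1)" and vt: "vtilde n vs t x = (vs (i + 1) t - vs i t) / dx n"
          using vtilde_cell[OF n x] by blast
        have xi: "x \<in> cell_Ioo n (i + 1)" using elim(1) i by auto
        have x01: "x \<in> {0..1}" using x d by auto
        have "\<bar>x - real i * dx n\<bar> \<le> dx n"
          using in_cell(4)[OF n _ _ xi] i by simp
        then have "\<bar>V1 x - V1 (real i * dx n)\<bar> \<le> om n"
          using V1_near[OF n X01[OF n, of i] x01] i by simp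
        moreover have "\<bar>(cavg n (i + 1) f - cavg n i f) / dx n - V1 (real i * dx n)\<bar> \<le> 2 * om n"
          by (rule dY_near[OF n i(1,2)])
        moreover have "fx x - vtilde n vs t x = (V1 x - V1 (real i * dx n))
            - ((cavg n (i + 1) f - cavg n i f) / dx n - V1 (real i * dx n)) + Dd i"
          unfolding vt x1 Dd_def by (simp add: diff_divide_distrib)
        ultimately have "\<bar>fx x - vtilde n vs t x\<bar> \<le> 3 * om n + \<bar>Dd i\<bar>" by linarith
        then have "(fx x - vtilde n vs t x)\<^sup>2 \<le> (3 * om n + \<bar>Dd i\<bar>)\<^sup>2" by (rule square_mono_abs)
        also have "\<dots> \<le> 2 * ((3 * om n)\<^sup>2 + \<bar>Dd i\<bar>\<^sup>2)" by (rule square_add_le)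
        also have "\<dots> = C (i + 1)" by (simp add: C_def power_mult_distrib)
        finally show ?thesis
          using True xi i by (intro sum_term_ge[where i = "i + 1"]) (auto simp: C_def)
      next
        case False
        then show ?thesis by (auto intro!: sum_nonneg simp: C_def)
      qed
    qed
  qed (auto simp: C_def)
  also have "(\<Sum>i\<in>{2..n}. dx n * C i) = (\<Sum>i\<in>{1..<n}. dx n * C (Suc i))"
  proof -
    have "{2..n} = {Suc 1..<Suc n}" by auto
    then show ?thesis using sum.shift_bounds_Suc_ivl[of "\<lambda>i. dx n * C i" 1 n] by simp
  qed
  also have "\<dots> = (real (n - 1) * dx n) * (18 * (om n)\<^sup>2) + 2 * (\<Sum>i\<in>{1..<n}. dx n * (Dd i)\<^sup>2)"
    by (simp add: C_def sum.distrib sum_distrib_left distrib_left mult.left_commute)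
  also have "\<dots> \<le> 1 * (18 * (om n)\<^sup>2) + 2 * (\<Sum>i\<in>{1..<n}. dx n * (Dd i)\<^sup>2)"
  proof -
    have "real (n - 1) * dx n \<le> 1" using n by (simp add: dx_def)
    then have "(real (n - 1) * dx n) * (18 * (om n)\<^sup>2) \<le> 1 * (18 * (om n)\<^sup>2)"
      by (rule mult_right_mono) simp
    then show ?thesis by simp
  qed
  also have "(om n)\<^sup>2 = \<Gamma> * dx n" using d Gam_parts by (simp add: om_def mult.commute)
  finally show ?thesis by (simp add: Dd_def)
qed

section \<open>The evolution of averages\<close>

lemma deriv_plat_outside: "x \<notin> {a<..<b} \<Longrightarrow> deriv (plat a b k) x = 0"
proof (rule deriv_zero_outside[OF plat_outside])
  assume "x \<notin> {a<..<b}"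
  moreover have "0 < 1 / real (Suc k)" by simp
  ultimately show "x \<notin> {a + 1 / real (Suc k)..b - 1 / real (Suc k)}"
    unfolding atLeastAtMost_iff greaterThanLessThan_iff by linarith
qed

lemma deriv_plat_measurable [measurable]: "deriv (plat a b k) \<in> borel_measurable borel"
  by (intro borel_measurable_continuous_onI smooth_continuous smooth_deriv smooth_plat)

text \<open>The test in time is a plateau on \<open>(0, t)\<close>. Its derivative concentrates at 0
  and \<open>t\<close>, where continuity in time of the tested quantity yields point values, while
  on the flux side the plateau itself tends to an indicator.\<close>

lemma weak_evolution_smooth:
  fixes u W :: "real \<Rightarrow> real \<Rightarrow> real"
  assumes weak: "\<And>\<alpha> \<beta>. bump {0<..<T} \<alpha> \<Longrightarrow> bump {0<..<1} \<beta> \<Longrightarrow>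
      (LBINT z. indicator (QT T) z * u (fst z) (snd z) * (deriv \<alpha> (fst z) * \<beta> (snd z)))
      = (LBINT z. indicator (QT T) z * W (fst z) (snd z) * (\<alpha> (fst z) * deriv \<beta> (snd z)))"
    and ui: "integrable lborel (\<lambda>z. indicator (QT T) z * u (fst z) (snd z))"
    and Wi: "integrable lborel (\<lambda>z. indicator (QT T) z * W (fst z) (snd z))"
    and \<beta>: "bump {0<..<1} \<beta>" and t: "0 < t" "t \<le> T"
    and cont: "continuous_on {0..T} (\<lambda>s. LBINT x. indicator {0<..<1} x * u s x * \<beta> x)"
  shows "(LBINT x. indicator {0<..<1} x * u 0 x * \<beta> x) - (LBINT x. indicator {0<..<1} x * u t x * \<beta> x)
    = (LBINT s. indicator {0<..<t} s * (LBINT x. indicator (QT T) (s, x) * W s x * deriv \<beta> x))"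
proof -
  define u0 where "u0 = (\<lambda>z. indicator (QT T) z * u (fst z) (snd z))"
  define W0 where "W0 = (\<lambda>z. indicator (QT T) z * W (fst z) (snd z))"
  define \<eta> where "\<eta> = (\<lambda>s. LBINT x. indicator {0<..<1} x * u s x * \<beta> x)"
  obtain B where B: "0 < B" "\<And>x. \<bar>\<beta> x\<bar> \<le> B" using bump_bounded[OF \<beta>] by blast
  obtain B' where B': "0 < B'" "\<And>x. \<bar>deriv \<beta> x\<bar> \<le> B'" using bump_bounded[OF bump_deriv[OF \<beta>]] by blast
  note [measurable] = bump_measurable[OF \<beta>] bump_measurable[OF bump_deriv[OF \<beta>]]
  have lhs: "(LBINT z. u0 z * (deriv (plat 0 t k) (fst z) * \<beta> (snd z)))
    = (LBINT s. indicator {0<..<t} s * (\<eta> s * deriv (plat 0 t k) s))" for k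
  proof -
    have bp: "bump {0<..<T} (deriv (plat 0 t k))" using t by (intro bump_deriv bump_plat) auto
    obtain A where A: "0 < A" "\<And>x. \<bar>deriv (plat 0 t k) x\<bar> \<le> A" using bump_bounded[OF bp] by blast
    have "integrable lborel (\<lambda>z. u0 z * (deriv (plat 0 t k) (fst z) * \<beta> (snd z)))"
      using A B by (intro integrable_mult_bounded[OF ui[folded u0_def], where C = "A * B"])
        (auto simp: abs_mult borel_prod[symmetric] intro!: mult_mono)
    from plane_fst(3)[OF this]
    have "(LBINT z. u0 z * (deriv (plat 0 t k) (fst z) * \<beta> (snd z)))
      = (LBINT s. (LBINT x. u0 (s, x) * (deriv (plat 0 t k) s * \<beta> x)))" by simp
    also have "\<dots> = (LBINT s. indicator {0<..<t} s * (\<eta> s * deriv (plat 0 t k) s))"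
    proof (intro Bochner_Integration.integral_cong refl)
      fix s
      have "(LBINT x. u0 (s, x) * (deriv (plat 0 t k) s * \<beta> x))
        = (LBINT x. (indicator {0<..<t} s * deriv (plat 0 t k) s) * (indicator {0<..<1} x * u s x * \<beta> x))"
        using t deriv_plat_outside[of s 0 t k]
        by (intro Bochner_Integration.integral_cong refl) (cases "s \<in> {0<..<t}"; auto simp: u0_def indicator_QT)
      also have "\<dots> = (indicator {0<..<t} s * deriv (plat 0 t k) s) * \<eta> s"
        unfolding \<eta>_def by (rule integral_mult_right_zero)
      finally show "(LBINT x. u0 (s, x) * (deriv (plat 0 t k) s * \<beta> x)) = indicator {0<..<t} s * (\<eta> s * deriv (plat 0 t k) s)"
        by (simp only: ac_simps)
    qed
    finally show ?thesis .
  qed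
  have "(\<lambda>k. LBINT z. u0 z * (deriv (plat 0 t k) (fst z) * \<beta> (snd z))) \<longlonglongrightarrow> \<eta> 0 - \<eta> t"
    unfolding lhs using t by (intro plat_deriv_limit continuous_on_subset[OF cont[folded \<eta>_def]]) auto
  moreover have "(\<lambda>k. LBINT z. (W0 z * deriv \<beta> (snd z)) * plat 0 t k (fst z))
    \<longlonglongrightarrow> (LBINT z. (W0 z * deriv \<beta> (snd z)) * indicator {0<..<t} (fst z))"
  proof (rule tendsto_integral_mult_bounded[where C = 1])
    show "integrable lborel (\<lambda>z. W0 z * deriv \<beta> (snd z))"
      using B' by (intro integrable_mult_bounded[OF Wi[folded W0_def], where C = B']) (auto simp: borel_prod[symmetric])
    show "\<bar>plat 0 t k (fst z)\<bar> \<le> 1" for k and z :: "real \<times> real"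
      using plat_bounds by simp
    show "(\<lambda>k. plat 0 t k (fst z)) \<longlonglongrightarrow> indicator {0<..<t} (fst z)" for z :: "real \<times> real"
      by (rule plat_tendsto)
  qed (simp_all add: borel_prod[symmetric])
  moreover have "(LBINT z. u0 z * (deriv (plat 0 t k) (fst z) * \<beta> (snd z)))
    = (LBINT z. (W0 z * deriv \<beta> (snd z)) * plat 0 t k (fst z))" for k
    using weak[OF bump_plat \<beta>, of 0 t k] t by (simp add: u0_def W0_def mult.commute mult.left_commute)
  ultimately have "\<eta> 0 - \<eta> t = (LBINT z. (W0 z * deriv \<beta> (snd z)) * indicator {0<..<t} (fst z))"
    using LIMSEQ_unique by force
  also have "\<dots> = (LBINT s. (LBINT x. (W0 (s, x) * deriv \<beta> x) * indicator {0<..<t} s))"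
  proof -
    have "integrable lborel (\<lambda>z. W0 z * (deriv \<beta> (snd z) * indicator {0<..<t} (fst z)))"
      using B' by (intro integrable_mult_bounded[OF Wi[folded W0_def], where C = B'])
        (auto simp: borel_prod[symmetric] indicator_def less_imp_le)
    then show ?thesis using plane_fst(3)[of "\<lambda>z. W0 z * (deriv \<beta> (snd z) * indicator {0<..<t} (fst z))"] by (simp add: mult.assoc)
  qed
  also have "\<dots> = (LBINT s. indicator {0<..<t} s * (LBINT x. indicator (QT T) (s, x) * W s x * deriv \<beta> x))"
    by (intro Bochner_Integration.integral_cong refl) (simp add: W0_def mult.commute)
  finally show ?thesis by (simp add: \<eta>_def)
qed

text \<open>The representative \<open>w\<close> of the flux is only chosen slice by slice, so the difference of its end
  point values is recovered as a limit \<open>d\<close> that is measurable in time.\<close>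

lemma weak_evolution:
  fixes u W :: "real \<Rightarrow> real \<Rightarrow> real" and B :: "real \<Rightarrow> real"
  assumes weak: "\<And>\<alpha> \<beta>. bump {0<..<T} \<alpha> \<Longrightarrow> bump {0<..<1} \<beta> \<Longrightarrow>
      (LBINT z. indicator (QT T) z * u (fst z) (snd z) * (deriv \<alpha> (fst z) * \<beta> (snd z)))
      = (LBINT z. indicator (QT T) z * W (fst z) (snd z) * (\<alpha> (fst z) * deriv \<beta> (snd z)))"
    and ui: "integrable lborel (\<lambda>z. indicator (QT T) z * u (fst z) (snd z))"
    and Wi: "integrable lborel (\<lambda>z. indicator (QT T) z * W (fst z) (snd z))"
    and us: "\<And>t. t \<in> {0..T} \<Longrightarrow> integrable lborel (\<lambda>x. indicator {0<..<1} x * u t x)"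
    and cont: "\<And>\<beta>. bump {0<..<1} \<beta> \<Longrightarrow> continuous_on {0..T} (\<lambda>s. LBINT x. indicator {0<..<1} x * u s x * \<beta> x)"
    and slices: "AE s in lborel. s \<in> {0<..<T} \<longrightarrow> (\<exists>w. continuous_on {0..1} w \<and>
       (AE x in lborel. x \<in> {0<..<1} \<longrightarrow> w x = W s x) \<and> (\<forall>x\<in>{0..1}. \<bar>w x\<bar> \<le> B s))"
    and B: "integrable lborel B" and ac: "0 \<le> a" "a < c" "c \<le> 1"
  obtains d where "integrable lborel d"
    "AE s in lborel. s \<in> {0<..<T} \<longrightarrow> (\<forall>w. continuous_on {0..1} w \<and>
       (AE x in lborel. x \<in> {0<..<1} \<longrightarrow> w x = W s x) \<longrightarrow> d s = w c - w a)"
    "\<And>t. t \<in> {0..T} \<Longrightarrow> (LBINT x. indicator {a<..<c} x * u t x)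
       = (LBINT x. indicator {a<..<c} x * u 0 x) + (LBINT s. indicator {0<..<t} s * d s)"
proof -
  define D where "D = (\<lambda>k s. LBINT x. indicator (QT T) (s, x) * W s x * deriv (plat a c k) x)"
  \<comment> \<open>The derivative of the spatial plateau produces \<open>w a - w c\<close> in the
    limit, hence the minus sign.\<close>
  define d where "d = (\<lambda>s. - indicator {0<..<T} s * lim (\<lambda>k. D k s))"
  have bp: "bump {0<..<1} (plat a c k)" for k using ac by (intro bump_plat) auto
  have Dm[measurable]: "D k \<in> borel_measurable borel" for k
  proof -
    obtain C where C: "0 < C" "\<And>x. \<bar>deriv (plat a c k) x\<bar> \<le> C" using bump_bounded[OF bump_deriv[OF bp]] by blast
    have "integrable lborel (\<lambda>z. (indicator (QT T) z * W (fst z) (snd z)) * deriv (plat a c k) (snd z))"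
      using C by (intro integrable_mult_bounded[OF Wi, where C = C]) (auto simp: borel_prod[symmetric])
    from plane_fst(2)[OF this] show ?thesis unfolding D_def by auto
  qed
  have dm[measurable]: "d \<in> borel_measurable borel"
  proof -
    have "(\<lambda>s. lim (\<lambda>k. D k s)) \<in> borel_measurable borel"
      by (rule borel_measurable_lim_metric) (rule Dm)
    then show ?thesis unfolding d_def by simp
  qed
  have slice_D: "D k s = (LBINT x. indicator {a<..<c} x * (w x * deriv (plat a c k) x))"
    if s: "s \<in> {0<..<T}" and w: "continuous_on {0..1} w" "AE x in lborel. x \<in> {0<..<1} \<longrightarrow> w x = W s x"
      and Ws: "integrable lborel (\<lambda>x. indicator (QT T) (s, x) * W s x)" for k s w
    unfolding D_def
  proof (rule integral_cong_AE)
    show "(\<lambda>x. indicator (QT T) (s, x) * W s x * deriv (plat a c k) x) \<in> borel_measurable lborel"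
      by (rule borel_measurable_times[OF borel_measurable_integrable[OF Ws]]) simp
    show "(\<lambda>x. indicator {a<..<c} x * (w x * deriv (plat a c k) x)) \<in> borel_measurable lborel"
      using integrable_Ioo_continuous[of a c "\<lambda>x. w x * deriv (plat a c k) x"] ac
      by (intro borel_measurable_integrable integrable_Ioo_continuous continuous_intros continuous_on_subset[OF w(1)]
          smooth_continuous smooth_deriv smooth_plat) auto
    show "AE x in lborel. indicator (QT T) (s, x) * W s x * deriv (plat a c k) x = indicator {a<..<c} x * (w x * deriv (plat a c k) x)"
      using w(2)
    proof eventually_elim
      case (elim x)
      then show ?case
        using s ac deriv_plat_outside[of x a c k] by (cases "x \<in> {a<..<c}") (auto simp: indicator_QT)
    qed
  qed
  have AE_W: "AE s in lborel. integrable lborel (\<lambda>x. indicator (QT T) (s, x) * W s x)"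
    using plane_fst(1)[OF Wi] by simp
  have conv: "AE s in lborel. s \<in> {0<..<T} \<longrightarrow> (\<forall>w. continuous_on {0..1} w \<and>
       (AE x in lborel. x \<in> {0<..<1} \<longrightarrow> w x = W s x) \<longrightarrow> (\<lambda>k. D k s) \<longlonglongrightarrow> w a - w c)"
    using AE_W
  proof eventually_elim
    case (elim s)
    show ?case
    proof (intro impI allI, elim conjE)
      fix w assume s: "s \<in> {0<..<T}" and w: "continuous_on {0..1} w" "AE x in lborel. x \<in> {0<..<1} \<longrightarrow> w x = W s x"
      have "continuous_on {a..c} w" using ac by (intro continuous_on_subset[OF w(1)]) auto
      from plat_deriv_limit[OF ac(2) this] show "(\<lambda>k. D k s) \<longlonglongrightarrow> w a - w c"
        by (simp only: slice_D[OF s w elim])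
    qed
  qed
  have d_eq: "AE s in lborel. s \<in> {0<..<T} \<longrightarrow> (\<forall>w. continuous_on {0..1} w \<and>
       (AE x in lborel. x \<in> {0<..<1} \<longrightarrow> w x = W s x) \<longrightarrow> d s = w c - w a)"
    using conv
  proof eventually_elim
    case (elim s)
    show ?case
    proof (intro impI allI)
      fix w assume s: "s \<in> {0<..<T}" and w: "continuous_on {0..1} w \<and> (AE x in lborel. x \<in> {0<..<1} \<longrightarrow> w x = W s x)"
      have "(\<lambda>k. D k s) \<longlonglongrightarrow> w a - w c" using elim s w by blast
      then show "d s = w c - w a" using s by (simp add: d_def limI)
    qed
  qed
  \<comment> \<open>The majorant is independent of \<open>k\<close>; it makes \<open>d\<close>
    integrable and justifies the limit under the time integral.\<close>
  have bound: "AE s in lborel. s \<in> {0<..<T} \<longrightarrow> (\<forall>k. \<bar>D k s\<bar> \<le> 2 * B s)"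
    using slices AE_W
  proof eventually_elim
    case (elim s)
    show ?case
    proof (intro impI allI)
      fix k assume s: "s \<in> {0<..<T}"
      then obtain w where w: "continuous_on {0..1} w" "AE x in lborel. x \<in> {0<..<1} \<longrightarrow> w x = W s x" "\<forall>x\<in>{0..1}. \<bar>w x\<bar> \<le> B s"
        using elim by blast
      have "continuous_on {a..c} w" using ac by (intro continuous_on_subset[OF w(1)]) auto
      then show "\<bar>D k s\<bar> \<le> 2 * B s"
        unfolding slice_D[OF s w(1,2) elim(2)] using w(3) ac by (intro plat_deriv_bound) auto
    qed
  qed
  have limD: "AE s in lborel. s \<in> {0<..<T} \<longrightarrow> (\<lambda>k. D k s) \<longlonglongrightarrow> - d s"
    using slices conv d_eq
  proof eventually_elim
    case (elim s)
    show ?case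
    proof
      assume s: "s \<in> {0<..<T}"
      then obtain w where w: "continuous_on {0..1} w \<and> (AE x in lborel. x \<in> {0<..<1} \<longrightarrow> w x = W s x)"
        using elim(1) by blast
      then have "(\<lambda>k. D k s) \<longlonglongrightarrow> w a - w c" "d s = w c - w a" using elim(2,3) s by blast+
      then show "(\<lambda>k. D k s) \<longlonglongrightarrow> - d s" by simp
    qed
  qed
  have di: "integrable lborel d"
  proof (rule Bochner_Integration.integrable_bound[where f = "\<lambda>s. 2 * B s"])
    show "AE s in lborel. norm (d s) \<le> norm (2 * B s)"
      using limD bound
    proof eventually_elim
      case (elim s)
      show ?case
      proof (cases "s \<in> {0<..<T}")
        case True
        then have "(\<lambda>k. \<bar>D k s\<bar>) \<longlonglongrightarrow> \<bar>- d s\<bar>" using elim(1) by (intro tendsto_rabs) auto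
        then have "\<bar>- d s\<bar> \<le> 2 * B s" using elim(2) True by (intro LIMSEQ_le_const2) auto
        then show ?thesis by simp
      qed (simp add: d_def)
    qed
  qed (use B in auto)
  have main: "(LBINT x. indicator {a<..<c} x * u t x)
       = (LBINT x. indicator {a<..<c} x * u 0 x) + (LBINT s. indicator {0<..<t} s * d s)"
    if t: "t \<in> {0..T}" for t
  proof (cases "t = 0")
    case False
    then have t': "0 < t" "t \<le> T" using t by auto
    have lim_u: "(\<lambda>k. LBINT x. indicator {0<..<1} x * u r x * plat a c k x) \<longlonglongrightarrow> (LBINT x. indicator {a<..<c} x * u r x)"
      if "r \<in> {0..T}" for r
    proof -
      have "(\<lambda>k. LBINT x. indicator {0<..<1} x * u r x * plat a c k x)
        \<longlonglongrightarrow> (LBINT x. indicator {0<..<1} x * u r x * indicator {a<..<c} x)"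
        using plat_bounds by (intro tendsto_integral_mult_bounded[where C = 1] us that plat_tendsto) auto
      also have "(LBINT x. indicator {0<..<1} x * u r x * indicator {a<..<c} x) = (LBINT x. indicator {a<..<c} x * u r x)"
        using ac by (intro Bochner_Integration.integral_cong refl) (auto simp: indicator_def)
      finally show ?thesis .
    qed
    have "(\<lambda>k. (LBINT x. indicator {0<..<1} x * u 0 x * plat a c k x) - (LBINT x. indicator {0<..<1} x * u t x * plat a c k x))
      \<longlonglongrightarrow> (LBINT x. indicator {a<..<c} x * u 0 x) - (LBINT x. indicator {a<..<c} x * u t x)"
      using t by (intro tendsto_diff lim_u) auto
    moreover have "(LBINT x. indicator {0<..<1} x * u 0 x * plat a c k x) - (LBINT x. indicator {0<..<1} x * u t x * plat a c k x)
      = (LBINT s. indicator {0<..<t} s * D k s)" for k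
      unfolding D_def by (rule weak_evolution_smooth[OF weak ui Wi bp t' cont[OF bp]])
    moreover have "(\<lambda>k. LBINT s. indicator {0<..<t} s * D k s) \<longlonglongrightarrow> (LBINT s. indicator {0<..<t} s * (- d s))"
    proof (rule integral_dominated_convergence[where w = "\<lambda>s. 2 * \<bar>B s\<bar>"])
      show "AE s in lborel. (\<lambda>k. indicator {0<..<t} s * D k s) \<longlonglongrightarrow> indicator {0<..<t} s * (- d s)"
        using limD
      proof eventually_elim
        case (elim s)
        then show ?case using t' by (cases "s \<in> {0<..<t}") auto
      qed
      show "AE s in lborel. norm (indicator {0<..<t} s * D k s) \<le> 2 * \<bar>B s\<bar>" for k
        using bound
      proof eventually_elim
        case (elim s)
        show ?case
        proof (cases "s \<in> {0<..<t}")
          case True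
          then have "\<bar>D k s\<bar> \<le> 2 * B s" using elim t' by auto
          then show ?thesis using True by simp
        qed simp
      qed
    qed (use B in auto)
    ultimately have "(LBINT x. indicator {a<..<c} x * u 0 x) - (LBINT x. indicator {a<..<c} x * u t x)
      = (LBINT s. indicator {0<..<t} s * (- d s))"
      using LIMSEQ_unique by force
    then show ?thesis by simp
  qed simp
  show ?thesis using that[OF di d_eq main] .
qed

section \<open>Continuity in time of integrals of a function continuous into L2\<close>

lemma sq_int_bound:
  fixes f g :: "real \<Rightarrow> real"
  assumes "sq_int {0<..<1} f" and m: "(\<lambda>x. indicator {0<..<1} x * g x) \<in> borel_measurable borel"
    and le: "AE x in lborel. x \<in> {0<..<1} \<longrightarrow> \<bar>g x\<bar> \<le> A + B * \<bar>f x\<bar>"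
  shows "sq_int {0<..<1} g"
proof -
  have "integrable lborel (\<lambda>x. indicator {0<..<1} x * (g x)\<^sup>2)"
  proof (rule Bochner_Integration.integrable_bound)
    show "integrable lborel (\<lambda>x. 2 * A\<^sup>2 * indicator {0<..<1} x + 2 * B\<^sup>2 * (indicator {0<..<1} x * (f x)\<^sup>2))"
      using sq_intD(2)[OF assms(1)] by simp
    have "(\<lambda>x. indicator {0<..<1} x * (g x)\<^sup>2) = (\<lambda>x. (indicator {0<..<1} x * g x)\<^sup>2)"
      by (auto simp: indicator_def)
    then show "(\<lambda>x. indicator {0<..<1} x * (g x)\<^sup>2) \<in> borel_measurable lborel" using m by simp
    show "AE x in lborel. norm (indicator {0<..<1} x * (g x)\<^sup>2) \<le> norm (2 * A\<^sup>2 * indicator {0<..<1} x + 2 * B\<^sup>2 * (indicator {0<..<1} x * (f x)\<^sup>2))"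
      using le
    proof eventually_elim
      case (elim x)
      show ?case
      proof (cases "x \<in> {0<..<1}")
        case True
        then have "(g x)\<^sup>2 \<le> (A + B * \<bar>f x\<bar>)\<^sup>2" using elim by (intro square_mono_abs) auto
        also have "\<dots> \<le> 2 * (A\<^sup>2 + (B * \<bar>f x\<bar>)\<^sup>2)" by (rule square_add_le)
        finally show ?thesis using True by (simp add: power_mult_distrib)
      qed simp
    qed
  qed
  then show ?thesis
    using m by (simp add: sq_int_def set_borel_measurable_def set_integrable_def)
qed

lemma sq_int_diff:
  fixes f g :: "real \<Rightarrow> real"
  assumes "sq_int {0<..<1} f" "sq_int {0<..<1} g"
  shows "sq_int {0<..<1} (\<lambda>x. f x - g x)"
proof -
  have m: "(\<lambda>x. indicator {0<..<1} x * (f x - g x)) \<in> borel_measurable borel"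
    using sq_intD(1)[OF assms(1)] sq_intD(1)[OF assms(2)] by (simp add: right_diff_distrib)
  have "integrable lborel (\<lambda>x. indicator {0<..<1} x * (f x - g x)\<^sup>2)"
  proof (rule Bochner_Integration.integrable_bound)
    show "integrable lborel (\<lambda>x. 2 * (indicator {0<..<1} x * (f x)\<^sup>2) + 2 * (indicator {0<..<1} x * (g x)\<^sup>2))"
      using sq_intD(2)[OF assms(1)] sq_intD(2)[OF assms(2)] by simp
    have "(\<lambda>x. indicator {0<..<1} x * (f x - g x)\<^sup>2) = (\<lambda>x. (indicator {0<..<1} x * (f x - g x))\<^sup>2)"
      by (auto simp: indicator_def)
    then show "(\<lambda>x. indicator {0<..<1} x * (f x - g x)\<^sup>2) \<in> borel_measurable lborel" using m by simp
    show "AE x in lborel. norm (indicator {0<..<1} x * (f x - g x)\<^sup>2) \<le> norm (2 * (indicator {0<..<1} x * (f x)\<^sup>2) + 2 * (indicator {0<..<1} x * (g x)\<^sup>2))"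
    proof (intro AE_I2)
      fix x
      show "norm (indicator {0<..<1} x * (f x - g x)\<^sup>2) \<le> norm (2 * (indicator {0<..<1} x * (f x)\<^sup>2) + 2 * (indicator {0<..<1} x * (g x)\<^sup>2))"
        using square_add_le[of "f x" "- g x"] by (cases "x \<in> {0<..<1}") auto
    qed
  qed
  then show ?thesis
    using m by (simp add: sq_int_def set_borel_measurable_def set_integrable_def)
qed

text \<open>Under the outer indicator the argument of \<open>\<phi>\<close> may be replaced by the
  measurable product; off \<open>S\<close> the outer factor is 0, whatever \<open>\<phi> 0\<close>
  is.\<close>

lemma measurable_compose_on_Ioo:
  fixes f \<phi> :: "real \<Rightarrow> real"
  assumes "(\<lambda>x. indicator S x * f x) \<in> borel_measurable borel" "\<phi> \<in> borel_measurable borel" "S \<in> sets borel"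
  shows "(\<lambda>x. indicator S x * \<phi> (f x)) \<in> borel_measurable borel"
proof -
  have "(\<lambda>x. indicator S x * \<phi> (f x)) = (\<lambda>x. indicator S x * \<phi> (indicator S x * f x))"
    by (intro ext) (simp add: indicator_def)
  then show ?thesis
    using assms by (auto intro!: borel_measurable_times measurable_compose[OF _ assms(2)])
qed

text \<open>The Lipschitz bound reduces the increment in time to the L1 distance of two slices, and
  Cauchy-Schwarz to their L2 distance, which tends to 0 by \<open>cont_L2\<close>.\<close>

lemma cont_L2_integral:
  fixes \<phi> \<beta> :: "real \<Rightarrow> real"
  assumes f: "cont_L2 T f" and lip: "\<And>x y. \<bar>\<phi> x - \<phi> y\<bar> \<le> L * \<bar>x - y\<bar>" and L: "0 \<le> L"
    and [measurable]: "\<phi> \<in> borel_measurable borel" "\<beta> \<in> borel_measurable borel" and \<beta>: "\<And>x. \<bar>\<beta> x\<bar> \<le> C"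
  shows "continuous_on {0..T} (\<lambda>t. LBINT x. indicator {0<..<1} x * \<phi> (f t x) * \<beta> x)"
  unfolding continuous_on_def
proof
  fix s assume s: "s \<in> {0..T}"
  have C: "0 \<le> C" using \<beta>[of 0] by linarith
  define F where "F = (\<lambda>t. LBINT x. indicator {0<..<1} x * \<phi> (f t x) * \<beta> x)"
  define D where "D = (\<lambda>t. LBINT x. indicator {0<..<1} x * (f t x - f s x)\<^sup>2)"
  have sq: "sq_int {0<..<1} (f t)" if "t \<in> {0..T}" for t
    using f that by (simp add: cont_L2_def)
  have \<phi>sq: "sq_int {0<..<1} (\<lambda>x. \<phi> (f t x))" if "t \<in> {0..T}" for t
  proof (rule sq_int_bound[OF sq[OF that]])
    show "(\<lambda>x. indicator {0<..<1} x * \<phi> (f t x)) \<in> borel_measurable borel"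
      by (rule measurable_compose_on_Ioo[OF sq_intD(1)[OF sq[OF that]]]) simp_all
    show "AE x in lborel. x \<in> {0<..<1} \<longrightarrow> \<bar>\<phi> (f t x)\<bar> \<le> \<bar>\<phi> 0\<bar> + L * \<bar>f t x\<bar>"
    proof (intro AE_I2 impI)
      fix x
      show "\<bar>\<phi> (f t x)\<bar> \<le> \<bar>\<phi> 0\<bar> + L * \<bar>f t x\<bar>"
        using lip[of "f t x" 0] abs_triangle_ineq[of "\<phi> 0" "\<phi> (f t x) - \<phi> 0"] by simp
    qed
  qed
  have int: "integrable lborel (\<lambda>x. indicator {0<..<1} x * \<phi> (f t x) * \<beta> x)" if "t \<in> {0..T}" for t
    using \<beta> by (intro integrable_mult_bounded[where C = C] sq_intD(3)[OF \<phi>sq[OF that]]) auto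
  have bound: "\<bar>F t - F s\<bar> \<le> L * C * sqrt (D t)" if t: "t \<in> {0..T}" for t
  proof -
    have d: "sq_int {0<..<1} (\<lambda>x. f t x - f s x)" by (intro sq_int_diff sq t s)
    have da: "sq_int {0<..<1} (\<lambda>x. \<bar>f t x - f s x\<bar>)"
    proof (rule sq_int_bound[OF d])
      show "(\<lambda>x. indicator {0<..<1} x * \<bar>f t x - f s x\<bar>) \<in> borel_measurable borel"
        by (rule measurable_compose_on_Ioo[OF sq_intD(1)[OF d], of abs]) simp_all
      show "AE x in lborel. x \<in> {0<..<1} \<longrightarrow> \<bar>\<bar>f t x - f s x\<bar>\<bar> \<le> 0 + 1 * \<bar>f t x - f s x\<bar>" by simp
    qed
    have "\<bar>F t - F s\<bar> = \<bar>LBINT x. indicator {0<..<1} x * \<phi> (f t x) * \<beta> x - indicator {0<..<1} x * \<phi> (f s x) * \<beta> x\<bar>"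
      unfolding F_def using int t s by simp
    also have "\<dots> \<le> (LBINT x. \<bar>indicator {0<..<1} x * \<phi> (f t x) * \<beta> x - indicator {0<..<1} x * \<phi> (f s x) * \<beta> x\<bar>)"
      by (rule integral_abs_bound)
    also have "\<dots> \<le> (LBINT x. L * C * (indicator {0<..<1} x * \<bar>f t x - f s x\<bar>))"
    proof (rule integral_mono)
      show "integrable lborel (\<lambda>x. \<bar>indicator {0<..<1} x * \<phi> (f t x) * \<beta> x - indicator {0<..<1} x * \<phi> (f s x) * \<beta> x\<bar>)"
        using int t s by auto
      show "integrable lborel (\<lambda>x. L * C * (indicator {0<..<1} x * \<bar>f t x - f s x\<bar>))"
        using sq_intD(3)[OF da] by simp
      fix x
      have "\<bar>\<phi> (f t x) - \<phi> (f s x)\<bar> * \<bar>\<beta> x\<bar> \<le> (L * \<bar>f t x - f s x\<bar>) * C"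
        using lip \<beta> L C by (intro mult_mono) auto
      then show "\<bar>indicator {0<..<1} x * \<phi> (f t x) * \<beta> x - indicator {0<..<1} x * \<phi> (f s x) * \<beta> x\<bar>
        \<le> L * C * (indicator {0<..<1} x * \<bar>f t x - f s x\<bar>)"
      proof (cases "x \<in> {0<..<1}")
        case True
        have "\<bar>\<phi> (f t x) * \<beta> x - \<phi> (f s x) * \<beta> x\<bar> = \<bar>\<phi> (f t x) - \<phi> (f s x)\<bar> * \<bar>\<beta> x\<bar>"
          by (simp only: left_diff_distrib[symmetric] abs_mult)
        then show ?thesis
          using True \<open>\<bar>\<phi> (f t x) - \<phi> (f s x)\<bar> * \<bar>\<beta> x\<bar> \<le> (L * \<bar>f t x - f s x\<bar>) * C\<close> by (simp add: ac_simps)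
      qed simp
    qed
    also have "\<dots> = L * C * (LBINT x. indicator {0<..<1} x * \<bar>f t x - f s x\<bar>)" by simp
    also have "\<dots> \<le> L * C * sqrt (D t)"
    proof (intro mult_left_mono real_le_rsqrt)
      show "(LBINT x. indicator {0<..<1} x * \<bar>f t x - f s x\<bar>)\<^sup>2 \<le> D t"
        using CS_interval[OF da, of 0 1] by (simp add: D_def set_lebesgue_integral_def)
    qed (use L C in auto)
    finally show ?thesis .
  qed
  have "(D \<longlongrightarrow> 0) (at s within {0..T})"
    using f s by (simp add: cont_L2_def D_def set_lebesgue_integral_def)
  then have "((\<lambda>t. L * C * sqrt (D t)) \<longlongrightarrow> L * C * sqrt 0) (at s within {0..T})"
    by (intro tendsto_intros)
  then have "((\<lambda>t. F t - F s) \<longlongrightarrow> 0) (at s within {0..T})"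
    by (intro Lim_null_comparison[of "\<lambda>t. F t - F s" "\<lambda>t. L * C * sqrt (D t)"])
       (auto simp: eventually_at_filter bound intro!: eventuallyI)
  then show "(F \<longlongrightarrow> F s) (at s within {0..T})"
    by (rule LIM_zero_cancel)
qed

text \<open>The weight is the indicator of a cell, admissible above because only boundedness and
  measurability of \<open>\<beta>\<close> enter.\<close>

lemma cont_L2_cavg:
  fixes \<phi> :: "real \<Rightarrow> real"
  assumes f: "cont_L2 T f" and lip: "\<And>x y. \<bar>\<phi> x - \<phi> y\<bar> \<le> L * \<bar>x - y\<bar>" and L: "0 \<le> L"
    and m: "\<phi> \<in> borel_measurable borel" and i: "n \<ge> 1" "1 \<le> i" "i \<le> n"
  shows "continuous_on {0..T} (\<lambda>t. cavg n i (\<lambda>x. \<phi> (f t x)))"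
proof -
  have c: "continuous_on {0..T} (\<lambda>t. (1 / dx n) * (LBINT x. indicator {0<..<1} x * \<phi> (f t x) * indicator (cell_Ioo n i) x))"
    by (intro continuous_intros cont_L2_integral[OF f lip L m, where C = 1]) (auto simp: indicator_def)
  have e: "cavg n i (\<lambda>x. \<phi> (f t x)) = (1 / dx n) * (LBINT x. indicator {0<..<1} x * \<phi> (f t x) * indicator (cell_Ioo n i) x)"
    if "t \<in> {0..T}" for t
  proof -
    have "sq_int {0<..<1} (f t)" using f that by (simp add: cont_L2_def)
    then have "(\<lambda>x. indicator {0<..<1} x * \<phi> (f t x)) \<in> borel_measurable borel"
      by (intro measurable_compose_on_Ioo[OF sq_intD(1)] m) simp_all
    from cavg_eq[OF i this] show ?thesis
      using cell_Ioo_subset[OF i(1,3)]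
      by (auto intro!: arg_cong[where f = "\<lambda>x. x / dx n"] Bochner_Integration.integral_cong simp: indicator_def)
  qed
  show ?thesis by (rule continuous_on_eq[OF c e[symmetric]])
qed

section \<open>The strong solution\<close>

locale strong_solution = nonlinearities +
  fixes T M M2 :: real and p px v vx vxx :: "real \<Rightarrow> real \<Rightarrow> real"
  assumes T: "0 < T" and M2_nonneg: "0 \<le> M2"
    and p_L2: "L2Q T p" and p_x: "weak_dx (QT T) p px" "L2Q T px"
    and p_bound: "AE z in lborel. z \<in> QT T \<longrightarrow> \<bar>p (fst z) (snd z)\<bar> \<le> M"
    and p_cont: "cont_L2 T p"
    and v_L2: "L2Q T v" and v_x: "weak_dx (QT T) v vx" "L2Q T vx"
    and v_xx: "weak_dx (QT T) vx vxx" "L2Q T vxx"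
    and v_bound: "AE t in lborel. t \<in> {0<..<T} \<longrightarrow> (LINT x:{0<..<1}|lborel. (v t x)\<^sup>2 + (vx t x)\<^sup>2) \<le> M2"
    and v_cont: "cont_L2 T v"
    and v_eq: "\<exists>g. weak_dt (QT T) (\<lambda>t x. h (v t x)) g \<and> weak_dx (QT T) (\<lambda>t x. vx t x + b (v t x) * p t x) g"
    and v_bc: "AE t in lborel. t \<in> {0<..<T} \<longrightarrow> (\<exists>w. continuous_on {0..1} w \<and>
       (AE x in lborel. x \<in> {0<..<1} \<longrightarrow> w x = vx t x + b (v t x) * p t x) \<and> w 0 = 0 \<and> w 1 = 0)"
begin

text \<open>The indicator of \<open>QT T\<close> also cuts off in time, so that Fubini gives
  integrability on the whole line.\<close>

definition Gm :: "real \<Rightarrow> real" where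
  "Gm t = (LBINT x. indicator (QT T) (t, x) * (vx t x)\<^sup>2) + (LBINT x. indicator (QT T) (t, x) * (vxx t x)\<^sup>2)
     + (LBINT x. indicator (QT T) (t, x) * (px t x)\<^sup>2)"

lemma Gm_integrable: "integrable lborel Gm"
  unfolding Gm_def[abs_def]
  using plane_fst(2)[OF L2Q_D(2)[OF v_x(2)]] plane_fst(2)[OF L2Q_D(2)[OF v_xx(2)]] plane_fst(2)[OF L2Q_D(2)[OF p_x(2)]]
  by (intro Bochner_Integration.integrable_add) simp_all

lemma Gm_nonneg: "0 \<le> Gm t"
  unfolding Gm_def by (intro add_nonneg_nonneg Bochner_Integration.integral_nonneg) auto

abbreviation is_slice where
  "is_slice t V V1 P w \<equiv> slice h b c1 c2 cb (v t) (vx t) (vxx t) (p t) (px t) V V1 P w M M2 (Gm t)"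

text \<open>Eleven almost-everywhere facts are intersected. The representatives are chosen
  separately for each \<open>t\<close>, and nothing is claimed about their measurability in
  \<open>t\<close>.\<close>

lemma slices: "AE t in lborel. t \<in> {0<..<T} \<longrightarrow> (\<exists>V V1 P w. is_slice t V V1 P w)"
  using weak_dx_slice[OF v_x(1) v_L2 v_x(2)] weak_dx_slice[OF v_xx(1) v_x(2) v_xx(2)] weak_dx_slice[OF p_x(1) p_L2 p_x(2)]
    sq_int_slice[OF v_L2] sq_int_slice[OF v_x(2)] sq_int_slice[OF v_xx(2)] sq_int_slice[OF p_L2] sq_int_slice[OF p_x(2)]
    plane_AE[OF p_bound] v_bound v_bc
proof eventually_elim
  case (elim t)
  show ?case
  proof
    assume t: "t \<in> {0<..<T}"
    obtain V where V: "ac_rep (v t) (vx t) V" using elim(1) t by blast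
    obtain V1 where V1: "ac_rep (vx t) (vxx t) V1" using elim(2) t by blast
    obtain P where P: "ac_rep (p t) (px t) P" using elim(3) t by blast
    obtain w where w: "continuous_on {0..1} w" "AE x in lborel. x \<in> {0<..<1} \<longrightarrow> w x = vx t x + b (v t x) * p t x" "w 0 = 0" "w 1 = 0"
      using elim(11) t by blast
    have sq: "sq_int {0<..<1} (v t)" "sq_int {0<..<1} (vx t)" "sq_int {0<..<1} (vxx t)" "sq_int {0<..<1} (p t)" "sq_int {0<..<1} (px t)"
      using elim(4-8) t by blast+
    have pb: "AE x in lborel. x \<in> {0<..<1} \<longrightarrow> \<bar>p t x\<bar> \<le> M"
      using elim(9) by eventually_elim (use t in \<open>auto simp: QT_def\<close>)
    have "(LBINT x. indicator {0<..<1} x * (vx t x)\<^sup>2)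
      \<le> (LBINT x. indicator {0<..<1} x * (v t x)\<^sup>2 + indicator {0<..<1} x * (vx t x)\<^sup>2)"
      using sq_intD(2)[OF sq(1)] sq_intD(2)[OF sq(2)] by (intro integral_mono) auto
    also have "\<dots> \<le> M2"
      using elim(10) t by (simp add: set_lebesgue_integral_def distrib_left)
    finally have m2: "(LBINT x. indicator {0<..<1} x * (vx t x)\<^sup>2) \<le> M2" .
    have gm: "(LBINT x. indicator {0<..<1} x * (vx t x)\<^sup>2) + (LBINT x. indicator {0<..<1} x * (vxx t x)\<^sup>2)
      + (LBINT x. indicator {0<..<1} x * (px t x)\<^sup>2) = Gm t"
      using t by (simp add: Gm_def indicator_QT)
    have "is_slice t V V1 P w"
      by (intro slice.intro nonlinearities_axioms slice_axioms.intro V V1 P sq pb m2 gm w)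
    then show "\<exists>V V1 P w. is_slice t V V1 P w" by blast
  qed
qed

abbreviation "W t x \<equiv> vx t x + b (v t x) * p t x"

lemma weak_form:
  assumes "bump {0<..<T} \<alpha>" "bump {0<..<1} \<beta>"
  shows "(LBINT z. indicator (QT T) z * h (v (fst z) (snd z)) * (deriv \<alpha> (fst z) * \<beta> (snd z)))
      = (LBINT z. indicator (QT T) z * W (fst z) (snd z) * (\<alpha> (fst z) * deriv \<beta> (snd z)))"
proof -
  obtain g where g: "weak_dt (QT T) (\<lambda>t x. h (v t x)) g" "weak_dx (QT T) W g" using v_eq by blast
  show ?thesis using weak_dt_tensor[OF g(1) assms] weak_dx_tensor[OF g(2) assms] by simp
qed

lemma QT_integrable: "integrable lborel (indicator (QT T) :: real \<times> real \<Rightarrow> real)"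
  using QT_sets QT_finite by (intro integrable_real_indicator) auto

lemma v_QT_measurable: "(\<lambda>z. indicator (QT T) z * v (fst z) (snd z)) \<in> borel_measurable borel"
  by (rule L2Q_D(1)[OF v_L2])

lemma comp_v_measurable:
  fixes \<phi> :: "real \<Rightarrow> real"
  assumes "\<phi> \<in> borel_measurable borel"
  shows "(\<lambda>z. indicator (QT T) z * \<phi> (v (fst z) (snd z))) \<in> borel_measurable borel"
proof -
  have "(\<lambda>z. indicator (QT T) z * \<phi> (v (fst z) (snd z))) = (\<lambda>z. indicator (QT T) z * \<phi> (indicator (QT T) z * v (fst z) (snd z)))"
    by (intro ext) (simp add: indicator_def)
  then show ?thesis
    using v_QT_measurable QT_sets
    by (auto intro!: borel_measurable_times measurable_compose[OF _ assms])
qed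

lemma hv_integrable: "integrable lborel (\<lambda>z. indicator (QT T) z * h (v (fst z) (snd z)))"
proof (rule Bochner_Integration.integrable_bound)
  show "integrable lborel (\<lambda>z. \<bar>h 0\<bar> * indicator (QT T) z + c2 * \<bar>indicator (QT T) z * v (fst z) (snd z)\<bar>)"
    using QT_integrable L2Q_D(3)[OF v_L2] by (intro Bochner_Integration.integrable_add integrable_mult_right integrable_abs) auto
  show "(\<lambda>z. indicator (QT T) z * h (v (fst z) (snd z))) \<in> borel_measurable lborel"
    using comp_v_measurable[OF h_measurable] by simp
  show "AE z in lborel. norm (indicator (QT T) z * h (v (fst z) (snd z))) \<le> norm (\<bar>h 0\<bar> * indicator (QT T) z + c2 * \<bar>indicator (QT T) z * v (fst z) (snd z)\<bar>)"
  proof (intro AE_I2)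
    fix z
    have "\<bar>h (v (fst z) (snd z))\<bar> \<le> \<bar>h 0\<bar> + c2 * \<bar>v (fst z) (snd z)\<bar>"
      using h_lip[of "v (fst z) (snd z)" 0] abs_triangle_ineq[of "h 0" "h (v (fst z) (snd z)) - h 0"] by simp
    then show "norm (indicator (QT T) z * h (v (fst z) (snd z))) \<le> norm (\<bar>h 0\<bar> * indicator (QT T) z + c2 * \<bar>indicator (QT T) z * v (fst z) (snd z)\<bar>)"
      by (cases "z \<in> QT T") auto
  qed
qed

lemma W_integrable: "integrable lborel (\<lambda>z. indicator (QT T) z * W (fst z) (snd z))"
proof -
  have "integrable lborel (\<lambda>z. (indicator (QT T) z * p (fst z) (snd z)) * (indicator (QT T) z * b (v (fst z) (snd z))))"
  proof (rule integrable_mult_bounded[OF L2Q_D(3)[OF p_L2], where C = cb])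
    show "(\<lambda>z. indicator (QT T) z * b (v (fst z) (snd z))) \<in> borel_measurable lborel"
      using comp_v_measurable[OF b_measurable] by simp
    show "\<bar>indicator (QT T) z * b (v (fst z) (snd z))\<bar> \<le> cb" for z
      using b0 cb by (cases "z \<in> QT T") auto
  qed
  then have "integrable lborel (\<lambda>z. indicator (QT T) z * vx (fst z) (snd z)
      + (indicator (QT T) z * p (fst z) (snd z)) * (indicator (QT T) z * b (v (fst z) (snd z))))"
    using L2Q_D(3)[OF v_x(2)] by (rule Bochner_Integration.integrable_add[rotated])
  moreover have "(\<lambda>z. indicator (QT T) z * vx (fst z) (snd z)
      + (indicator (QT T) z * p (fst z) (snd z)) * (indicator (QT T) z * b (v (fst z) (snd z))))
      = (\<lambda>z. indicator (QT T) z * W (fst z) (snd z))"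
    by (intro ext) (simp add: indicator_def mult.commute)
  ultimately show ?thesis by simp
qed

lemma v_sq: "t \<in> {0..T} \<Longrightarrow> sq_int {0<..<1} (v t)"
  using v_cont by (simp add: cont_L2_def)

lemma hv_sq: "t \<in> {0..T} \<Longrightarrow> sq_int {0<..<1} (\<lambda>x. h (v t x))"
proof (rule sq_int_bound[OF v_sq, where A = "\<bar>h 0\<bar>" and B = c2])
  assume t: "t \<in> {0..T}"
  show "(\<lambda>x. indicator {0<..<1} x * h (v t x)) \<in> borel_measurable borel"
    by (rule measurable_compose_on_Ioo[OF sq_intD(1)[OF v_sq[OF t]]]) simp_all
  show "AE x in lborel. x \<in> {0<..<1} \<longrightarrow> \<bar>h (v t x)\<bar> \<le> \<bar>h 0\<bar> + c2 * \<bar>v t x\<bar>"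
  proof (intro AE_I2 impI)
    fix x
    show "\<bar>h (v t x)\<bar> \<le> \<bar>h 0\<bar> + c2 * \<bar>v t x\<bar>"
      using h_lip[of "v t x" 0] abs_triangle_ineq[of "h 0" "h (v t x) - h 0"] by simp
  qed
qed auto

text \<open>\<open>2 * sqrt x <= 1 + x\<close> makes the sup bound on \<open>V1\<close> linear in
  \<open>Gm\<close> and thus integrable in time, as the majorant \<open>B\<close> of
  \<open>weak_evolution\<close> has to be.\<close>

lemma node_flux_bound:
  assumes "is_slice t V V1 P w" "x \<in> {0..1}"
  shows "\<bar>w x\<bar> \<le> 1 + Gm t + cb * M"
proof -
  interpret s: slice h b c1 c2 cb "v t" "vx t" "vxx t" "p t" "px t" V V1 P w M M2 "Gm t" by (rule assms(1))
  have "\<bar>b (V x) * P x\<bar> \<le> cb * M"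
    unfolding abs_mult using b0 s.P_bound[OF assms(2)] cb by (intro mult_mono) auto
  moreover have "2 * sqrt (Gm t) \<le> 1 + Gm t"
    using sum_squares_bound[of 1 "sqrt (Gm t)"] Gm_nonneg[of t] by simp
  ultimately show ?thesis
    using s.w_eq[OF assms(2)] s.V1_bound[OF assms(2)] by linarith
qed

text \<open>The balance law on one cell, in integrated form: the change of the mean of
  \<open>h(v)\<close> is driven by the difference of the exact flux between the two end
  nodes.\<close>

lemma cell_evolution:
  assumes i: "n \<ge> 1" "1 \<le> i" "i \<le> n"
  obtains d where "integrable lborel d"
    "AE s in lborel. s \<in> {0<..<T} \<longrightarrow> (\<forall>V V1 P w. is_slice s V V1 P w \<longrightarrow> d s = w (real i * dx n) - w (real (i - 1) * dx n))"
    "\<And>t. t \<in> {0..T} \<Longrightarrow> cavg n i (\<lambda>x. h (v t x)) = cavg n i (\<lambda>x. h (v 0 x)) + (LBINT s. indicator {0<..<t} s * (d s / dx n))"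
proof -
  have d0: "0 < dx n" by (rule dx_pos[OF i(1)])
  have ac: "0 \<le> real (i - 1) * dx n" "real (i - 1) * dx n < real i * dx n" "real i * dx n \<le> 1"
    using node_nonneg[of "i - 1" n] node_pred[OF i(2), of n] node_le_1[OF i(1,3)] d0 by linarith+
  have B: "integrable lborel (\<lambda>s. indicator {0<..<T} s * (1 + Gm s + cb * M))"
  proof -
    have "integrable lborel (\<lambda>s. (1 + cb * M) * indicator {0<..<T} s + indicator {0<..<T} s * Gm s)"
      using Gm_integrable by (intro Bochner_Integration.integrable_add integrable_mult_right integrable_indicator_mult) auto
    then show ?thesis by (simp add: algebra_simps)
  qed
  have sl: "AE s in lborel. s \<in> {0<..<T} \<longrightarrow> (\<exists>w. continuous_on {0..1} w \<and>
       (AE x in lborel. x \<in> {0<..<1} \<longrightarrow> w x = W s x) \<and> (\<forall>x\<in>{0..1}. \<bar>w x\<bar> \<le> indicator {0<..<T} s * (1 + Gm s + cb * M)))"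
    using slices
  proof eventually_elim
    case (elim s)
    show ?case
    proof
      assume s: "s \<in> {0<..<T}"
      then obtain V V1 P w where sl: "is_slice s V V1 P w" using elim by blast
      show "\<exists>w. continuous_on {0..1} w \<and> (AE x in lborel. x \<in> {0<..<1} \<longrightarrow> w x = W s x)
        \<and> (\<forall>x\<in>{0..1}. \<bar>w x\<bar> \<le> indicator {0<..<T} s * (1 + Gm s + cb * M))"
        using slice.w_cont[OF sl] slice.w_AE[OF sl] node_flux_bound[OF sl] s by (intro exI[of _ w]) auto
    qed
  qed
  have us: "integrable lborel (\<lambda>x. indicator {0<..<1} x * h (v t x))" if "t \<in> {0..T}" for t
    using sq_intD(3)[OF hv_sq[OF that]] by simp
  have cont: "continuous_on {0..T} (\<lambda>s. LBINT x. indicator {0<..<1} x * h (v s x) * \<beta> x)" if \<beta>: "bump {0<..<1} \<beta>" for \<beta>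
  proof -
    obtain C where C: "\<And>x. \<bar>\<beta> x\<bar> \<le> C" using bump_bounded[OF \<beta>] by blast
    show ?thesis
      by (rule cont_L2_integral[OF v_cont h_lip _ h_measurable bump_measurable[OF \<beta>] C]) (use c2 in simp)
  qed
  obtain d where d: "integrable lborel d"
    "AE s in lborel. s \<in> {0<..<T} \<longrightarrow> (\<forall>w. continuous_on {0..1} w \<and>
       (AE x in lborel. x \<in> {0<..<1} \<longrightarrow> w x = W s x) \<longrightarrow> d s = w (real i * dx n) - w (real (i - 1) * dx n))"
    "\<And>t. t \<in> {0..T} \<Longrightarrow> (LBINT x. indicator (cell_Ioo n i) x * h (v t x))
       = (LBINT x. indicator (cell_Ioo n i) x * h (v 0 x)) + (LBINT s. indicator {0<..<t} s * d s)"
    using weak_evolution[where u = "\<lambda>t x. h (v t x)" and W = W, OF weak_form hv_integrable W_integrable us cont sl B ac] by blast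
  show ?thesis
  proof (rule that[OF d(1)])
    show "AE s in lborel. s \<in> {0<..<T} \<longrightarrow> (\<forall>V V1 P w. is_slice s V V1 P w \<longrightarrow> d s = w (real i * dx n) - w (real (i - 1) * dx n))"
      using d(2)
    proof eventually_elim
      case (elim s)
      show ?case
      proof (intro impI allI)
        fix V V1 P w assume s: "s \<in> {0<..<T}" and sl: "is_slice s V V1 P w"
        show "d s = w (real i * dx n) - w (real (i - 1) * dx n)"
          using elim s slice.w_cont[OF sl] slice.w_AE[OF sl] by blast
      qed
    qed
    fix t assume t: "t \<in> {0..T}"
    have c: "cavg n i (\<lambda>x. h (v r x)) = (1 / dx n) * (LBINT x. indicator (cell_Ioo n i) x * h (v r x))" if "r \<in> {0..T}" for r
      using sq_intD(1)[OF hv_sq[OF that]] by (intro cavg_eq[OF i]) simp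
    have "(LBINT s. indicator {0<..<t} s * (d s / dx n)) = (1 / dx n) * (LBINT s. indicator {0<..<t} s * d s)"
      by simp
    then show "cavg n i (\<lambda>x. h (v t x)) = cavg n i (\<lambda>x. h (v 0 x)) + (LBINT s. indicator {0<..<t} s * (d s / dx n))"
      using c[OF t] c[of 0] d(3)[OF t] T by (simp add: add_divide_distrib)
  qed
qed

text \<open>The bound is known for almost every \<open>t > 0\<close>. Both averages are continuous
  in time because \<open>v\<close> is continuous into L2, so it extends to
  \<open>t = 0\<close>.\<close>

lemma initial_consistency:
  assumes i: "n \<ge> 1" "1 \<le> i" "i \<le> n"
  shows "(cavg n i (\<lambda>x. h (v 0 x)) - h (cavg n i (v 0)))\<^sup>2 \<le> Acons M M2 * dx n"
proof (rule continuous_le_of_AE[OF T, where u = "\<lambda>t. (cavg n i (\<lambda>x. h (v t x)) - h (cavg n i (v t)))\<^sup>2"])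
  show "continuous_on {0..T} (\<lambda>t. (cavg n i (\<lambda>x. h (v t x)) - h (cavg n i (v t)))\<^sup>2)"
    using cont_L2_cavg[OF v_cont h_lip _ h_measurable i] cont_L2_cavg[OF v_cont, of "\<lambda>x. x" 1, OF _ _ _ i] c2
    by (intro continuous_intros) auto
  show "AE t in lborel. t \<in> {0<..<T} \<longrightarrow> (cavg n i (\<lambda>x. h (v t x)) - h (cavg n i (v t)))\<^sup>2 \<le> Acons M M2 * dx n"
    using slices
  proof eventually_elim
    case (elim t)
    then show ?case using slice.r_sq[OF _ i] by blast
  qed
qed (use T in simp)

end

lemma integrable_continuous_mult:
  fixes g r :: "real \<Rightarrow> real"
  assumes "continuous_on {0..T} g" "integrable lborel r" "t \<le> T"
  shows "integrable lborel (\<lambda>s. indicator {0<..<t} s * (g s * r s))"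
proof (cases "0 \<le> T")
  case True
  have "compact (g ` {0..T})" by (intro compact_continuous_image assms(1)) simp
  then obtain C where C: "\<And>s. s \<in> {0..T} \<Longrightarrow> \<bar>g s\<bar> \<le> C"
    using compact_imp_bounded bounded_iff by (metis imageI real_norm_def)
  then have C0: "0 \<le> C" using True by (meson abs_ge_zero atLeastAtMost_iff order_refl order_trans)
  have "continuous_on {0..t} g" using assms(3) by (intro continuous_on_subset[OF assms(1)]) auto
  then have "integrable lborel (\<lambda>s. r s * (indicator {0<..<t} s * g s))"
    using C C0 assms(3) borel_measurable_integrable[OF integrable_Ioo_continuous]
    by (intro integrable_mult_bounded[OF assms(2), where C = C]) (auto simp: indicator_def)
  then show ?thesis by (simp add: ac_simps)
next
  case False
  then have "{0<..<t} = {}" using assms(3) by auto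
  then show ?thesis by simp
qed

section \<open>Energy estimate and convergence\<close>

context strong_solution
begin

definition err :: "nat \<Rightarrow> (nat \<Rightarrow> real \<Rightarrow> real) \<Rightarrow> nat \<Rightarrow> real \<Rightarrow> real" where
  "err n vs i t = cavg n i (\<lambda>x. h (v t x)) - h (vs i t)"

definition energy :: "nat \<Rightarrow> (nat \<Rightarrow> real \<Rightarrow> real) \<Rightarrow> real \<Rightarrow> real" where
  "energy n vs t = (\<Sum>i=1..n. dx n * (err n vs i t)\<^sup>2)"

definition dissipation :: "nat \<Rightarrow> (nat \<Rightarrow> real \<Rightarrow> real) \<Rightarrow> real \<Rightarrow> real" where
  "dissipation n vs t = (\<Sum>i\<in>{1..<n}. dx n * (((cavg n (i+1) (v t) - cavg n i (v t)) - (vs (i+1) t - vs i t)) / dx n)\<^sup>2)"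

text \<open>Twice the coefficient in \<open>slice_energy\<close>, the factor 2 coming from the chain
  rule for squares.\<close>

definition growth :: "real \<Rightarrow> real" where
  "growth s = indicator {0<..<T} s * (2 * Ken M * (1 + 16 * Gm s))"

lemma growth_nonneg: "0 \<le> growth s"
  unfolding growth_def using Ken_pos[of M] Gm_nonneg[of s] by (intro mult_nonneg_nonneg) auto

lemma growth_integrable: "integrable lborel growth"
proof -
  have "integrable lborel (\<lambda>s. 2 * Ken M * indicator {0<..<T} s + 32 * Ken M * (indicator {0<..<T} s * Gm s))"
    using Gm_integrable by (intro Bochner_Integration.integrable_add integrable_mult_right integrable_indicator_mult) auto
  moreover have "growth = (\<lambda>s. 2 * Ken M * indicator {0<..<T} s + 32 * Ken M * (indicator {0<..<T} s * Gm s))"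
    by (intro ext) (simp add: growth_def algebra_simps)
  ultimately show ?thesis by simp
qed

lemma cavg_continuous:
  assumes "n \<ge> 1" "1 \<le> i" "i \<le> n"
  shows "continuous_on {0..T} (\<lambda>t. cavg n i (v t))" "continuous_on {0..T} (\<lambda>t. cavg n i (p t))"
    "continuous_on {0..T} (\<lambda>t. cavg n i (\<lambda>x. h (v t x)))"
  using cont_L2_cavg[OF v_cont, of "\<lambda>x. x" 1, OF _ _ _ assms] cont_L2_cavg[OF p_cont, of "\<lambda>x. x" 1, OF _ _ _ assms]
    cont_L2_cavg[OF v_cont h_lip _ h_measurable assms] c2 by auto

context
  fixes n :: nat and vs :: "nat \<Rightarrow> real \<Rightarrow> real" and v0 :: "real \<Rightarrow> real"
  assumes n: "n \<ge> 1" and fv: "fv_solution h b p v0 T n vs"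
    and v0: "sq_int {0<..<1} v0" "AE x in lborel. x \<in> {0<..<1} \<longrightarrow> v 0 x = v0 x"
begin

lemma vs_continuous: "1 \<le> i \<Longrightarrow> i \<le> n \<Longrightarrow> continuous_on {0..T} (vs i)"
  using fv by (simp add: fv_solution_def)

lemma flux_continuous: "continuous_on {0..T} (flux b p n vs i)"
proof (cases "1 \<le> i \<and> i \<le> n - 1")
  case True
  then have "flux b p n vs i = (\<lambda>t. (vs (i+1) t - vs i t) / dx n + b ((vs i t + vs (i+1) t) / 2) * cavg n i (p t))"
    by (intro ext) (simp add: flux_def)
  moreover have "continuous_on {0..T} (\<lambda>t. (vs (i+1) t - vs i t) / dx n + b ((vs i t + vs (i+1) t) / 2) * cavg n i (p t))"
    using True n dx_pos[OF n] by (intro continuous_intros vs_continuous cavg_continuous) auto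
  ultimately show ?thesis by simp
next
  case False
  then have "flux b p n vs i = (\<lambda>t. 0)" by (auto simp: flux_def fun_eq_iff)
  then show ?thesis by simp
qed

text \<open>By the chain rule the left side of the scheme is the time derivative of
  \<open>h(vs i t)\<close>; the derivative within \<open>[0, T]\<close> covers the end
  times.\<close>

lemma scheme_integral:
  assumes i: "1 \<le> i" "i \<le> n" and t: "t \<in> {0..T}"
  shows "h (vs i t) = h (vs i 0) + (LBINT s. indicator {0<..<t} s * ((flux b p n vs i s - flux b p n vs (i - 1) s) / dx n))"
proof -
  have "(LBINT s. indicator {0<..<t} s * ((flux b p n vs i s - flux b p n vs (i - 1) s) / dx n)) = h (vs i t) - h (vs i 0)"
  proof (rule LBINT_FTC_within)
    show "continuous_on {0..t} (\<lambda>s. (flux b p n vs i s - flux b p n vs (i - 1) s) / dx n)"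
      using t dx_pos[OF n] by (intro continuous_intros continuous_on_subset[OF flux_continuous]) auto
    fix s assume s: "s \<in> {0..t}"
    then have sT: "s \<in> {0..T}" using t by auto
    have "i \<in> {1..n}" using i by simp
    then have "\<exists>d. (vs i has_real_derivative d) (at s within {0..T}) \<and>
      deriv h (vs i s) * d = (flux b p n vs i s - flux b p n vs (i - 1) s) / dx n"
      using fv sT unfolding fv_solution_def by blast
    then obtain d where d: "(vs i has_real_derivative d) (at s within {0..T})"
      "deriv h (vs i s) * d = (flux b p n vs i s - flux b p n vs (i - 1) s) / dx n"
      by blast
    have "((\<lambda>s. h (vs i s)) has_real_derivative deriv h (vs i s) * d) (at s within {0..T})"
      by (rule DERIV_chain2[OF DERIV_h d(1)])
    then show "((\<lambda>s. h (vs i s)) has_real_derivative (flux b p n vs i s - flux b p n vs (i - 1) s) / dx n) (at s within {0..t})"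
      unfolding d(2) by (rule has_field_derivative_subset) (use t in auto)
  qed (use t in auto)
  then show ?thesis by simp
qed

lemma err_continuous: "1 \<le> i \<Longrightarrow> i \<le> n \<Longrightarrow> continuous_on {0..T} (err n vs i)"
  unfolding err_def[abs_def] by (intro continuous_intros cavg_continuous vs_continuous n)

lemma energy_continuous: "continuous_on {0..T} (energy n vs)"
  unfolding energy_def[abs_def] by (intro continuous_intros err_continuous) auto

lemma dissipation_continuous: "continuous_on {0..T} (dissipation n vs)"
  unfolding dissipation_def[abs_def] using dx_pos[OF n]
  by (intro continuous_intros cavg_continuous vs_continuous n) auto

lemma energy_nonneg: "0 \<le> energy n vs t" and dissipation_nonneg: "0 \<le> dissipation n vs t"
  unfolding energy_def dissipation_def using dx_pos[OF n] by (auto intro!: sum_nonneg)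

text \<open>Exact balance and scheme are both differences of fluxes across the same two nodes, so
  subtracting them leaves the difference of the residual fluxes.\<close>

lemma err_evolution:
  assumes i: "1 \<le> i" "i \<le> n"
  obtains r where "integrable lborel r"
    "AE s in lborel. s \<in> {0<..<T} \<longrightarrow> (\<forall>V V1 P w. is_slice s V V1 P w \<longrightarrow>
       r s = ((w (real i * dx n) - flux b p n vs i s) - (w (real (i - 1) * dx n) - flux b p n vs (i - 1) s)) / dx n)"
    "\<And>t. t \<in> {0..T} \<Longrightarrow> err n vs i t = err n vs i 0 + (LBINT s. indicator {0<..<t} s * r s)"
proof -
  obtain d where d: "integrable lborel d"
    "AE s in lborel. s \<in> {0<..<T} \<longrightarrow> (\<forall>V V1 P w. is_slice s V V1 P w \<longrightarrow> d s = w (real i * dx n) - w (real (i - 1) * dx n))"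
    "\<And>t. t \<in> {0..T} \<Longrightarrow> cavg n i (\<lambda>x. h (v t x)) = cavg n i (\<lambda>x. h (v 0 x)) + (LBINT s. indicator {0<..<t} s * (d s / dx n))"
    using cell_evolution[OF n i] by blast
  define F where "F = (\<lambda>s. (flux b p n vs i s - flux b p n vs (i - 1) s) / dx n)"
  define r where "r = (\<lambda>s. d s / dx n - indicator {0<..<T} s * F s)"
  have Fc: "continuous_on {0..T} F"
    unfolding F_def using dx_pos[OF n] by (intro continuous_intros flux_continuous) auto
  have Fi: "integrable lborel (\<lambda>s. indicator {0<..<T} s * F s)" by (rule integrable_Ioo_continuous[OF Fc])
  have r: "integrable lborel r" unfolding r_def using d(1) Fi by simp
  show ?thesis
  proof (rule that[OF r])
    show "AE s in lborel. s \<in> {0<..<T} \<longrightarrow> (\<forall>V V1 P w. is_slice s V V1 P w \<longrightarrow>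
       r s = ((w (real i * dx n) - flux b p n vs i s) - (w (real (i - 1) * dx n) - flux b p n vs (i - 1) s)) / dx n)"
      using d(2)
    proof eventually_elim
      case (elim s)
      show ?case
      proof (intro impI allI)
        fix V V1 P w assume s: "s \<in> {0<..<T}" and sl: "is_slice s V V1 P w"
        then have "d s = w (real i * dx n) - w (real (i - 1) * dx n)" using elim by blast
        then show "r s = ((w (real i * dx n) - flux b p n vs i s) - (w (real (i - 1) * dx n) - flux b p n vs (i - 1) s)) / dx n"
          using s by (simp add: r_def F_def diff_divide_distrib)
      qed
    qed
    fix t assume t: "t \<in> {0..T}"
    have i1: "integrable lborel (\<lambda>s. indicator {0<..<t} s * (d s / dx n))"
      using d(1) by (intro integrable_indicator_mult) auto
    have i2: "integrable lborel (\<lambda>s. indicator {0<..<t} s * F s)"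
      using t by (intro integrable_Ioo_continuous continuous_on_subset[OF Fc]) auto
    have "(LBINT s. indicator {0<..<t} s * r s) = (LBINT s. indicator {0<..<t} s * (d s / dx n) - indicator {0<..<t} s * F s)"
      using t by (intro Bochner_Integration.integral_cong refl) (auto simp: r_def indicator_def)
    also have "\<dots> = (LBINT s. indicator {0<..<t} s * (d s / dx n)) - (LBINT s. indicator {0<..<t} s * F s)"
      by (rule Bochner_Integration.integral_diff[OF i1 i2])
    finally show "err n vs i t = err n vs i 0 + (LBINT s. indicator {0<..<t} s * r s)"
      using d(3)[OF t] scheme_integral[OF i t] by (simp add: err_def F_def)
  qed
qed

text \<open>\<open>ac_square\<close> expresses each squared error through the integral of
  \<open>e * r\<close>. In the sum the weight \<open>dx n\<close> cancels the division by
  \<open>dx n\<close> in the rate \<open>r\<close>, and what remains is estimated at almost every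
  time by \<open>slice_energy\<close>.\<close>

lemma energy_inequality:
  assumes t: "t \<in> {0..T}"
  shows "energy n vs t + c1 * (LBINT s. indicator {0<..<t} s * dissipation n vs s)
    \<le> energy n vs 0 + (LBINT s. indicator {0<..<t} s * ((Acons M M2 * dx n + energy n vs s) * growth s))"
proof -
  \<comment> \<open>The three properties are packed into one predicate so that a single choice
    provides the rates \<open>r i\<close> of all cells.\<close>
  define Q where "Q = (\<lambda>i r. integrable lborel r \<and>
    (AE s in lborel. s \<in> {0<..<T} \<longrightarrow> (\<forall>V V1 P w. is_slice s V V1 P w \<longrightarrow>
       r s = ((w (real i * dx n) - flux b p n vs i s) - (w (real (i - 1) * dx n) - flux b p n vs (i - 1) s)) / dx n)) \<and>
    (\<forall>t\<in>{0..T}. err n vs i t = err n vs i 0 + (LBINT s. indicator {0<..<t} s * r s)))"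
  have "\<exists>r. Q i r" if "i \<in> {1..n}" for i
  proof -
    have i: "1 \<le> i" "i \<le> n" using that by auto
    show ?thesis unfolding Q_def by (rule err_evolution[OF i]) blast
  qed
  then obtain r where "\<And>i. i \<in> {1..n} \<Longrightarrow> Q i (r i)" by metis
  then have r: "\<And>i. i \<in> {1..n} \<Longrightarrow> integrable lborel (r i)"
    "\<And>i. i \<in> {1..n} \<Longrightarrow> AE s in lborel. s \<in> {0<..<T} \<longrightarrow> (\<forall>V V1 P w. is_slice s V V1 P w \<longrightarrow>
       r i s = ((w (real i * dx n) - flux b p n vs i s) - (w (real (i - 1) * dx n) - flux b p n vs (i - 1) s)) / dx n)"
    "\<And>i t. i \<in> {1..n} \<Longrightarrow> t \<in> {0..T} \<Longrightarrow> err n vs i t = err n vs i 0 + (LBINT s. indicator {0<..<t} s * r i s)"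
    unfolding Q_def by blast+
  have d: "0 < dx n" by (rule dx_pos[OF n])
  define Z where "Z = (\<lambda>s. \<Sum>i=1..n. dx n * (err n vs i s * r i s))"
  have eri: "integrable lborel (\<lambda>s. indicator {0<..<t} s * (err n vs i s * r i s))" if "i \<in> {1..n}" for i
    using that t by (intro integrable_continuous_mult[OF err_continuous r(1)]) auto
  have Zi: "integrable lborel (\<lambda>s. indicator {0<..<t} s * Z s)"
  proof -
    have "integrable lborel (\<lambda>s. \<Sum>i=1..n. dx n * (indicator {0<..<t} s * (err n vs i s * r i s)))"
      using eri by (intro Bochner_Integration.integrable_sum integrable_mult_right) auto
    then show ?thesis by (simp add: Z_def sum_distrib_left mult.left_commute)
  qed
  have energy_eq: "energy n vs t = energy n vs 0 + 2 * (LBINT s. indicator {0<..<t} s * Z s)"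
  proof -
    have sq: "(err n vs i t)\<^sup>2 = (err n vs i 0)\<^sup>2 + 2 * (LBINT s. indicator {0<..<t} s * (err n vs i s * r i s))"
      if i: "i \<in> {1..n}" for i
    proof (rule ac_square[OF r(1)[OF i]])
      fix u assume "u \<in> {0..t}"
      then have "u \<in> {0..T}" using t by simp
      then show "err n vs i u = err n vs i 0 + (LBINT s. indicator {0<..<u} s * r i s)"
        by (rule r(3)[OF i])
    qed (use t in simp)
    have "(LBINT s. indicator {0<..<t} s * Z s) = (LBINT s. (\<Sum>i=1..n. dx n * (indicator {0<..<t} s * (err n vs i s * r i s))))"
      by (simp add: Z_def sum_distrib_left mult.left_commute)
    also have "\<dots> = (\<Sum>i=1..n. dx n * (LBINT s. indicator {0<..<t} s * (err n vs i s * r i s)))"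
      using eri by (subst Bochner_Integration.integral_sum) auto
    finally have Z: "(LBINT s. indicator {0<..<t} s * Z s) = (\<Sum>i=1..n. dx n * (LBINT s. indicator {0<..<t} s * (err n vs i s * r i s)))" .
    have "energy n vs t = (\<Sum>i=1..n. dx n * (err n vs i 0)\<^sup>2 + 2 * (dx n * (LBINT s. indicator {0<..<t} s * (err n vs i s * r i s))))"
      unfolding energy_def
    proof (rule sum.cong[OF refl])
      fix i assume i: "i \<in> {1..n}"
      show "dx n * (err n vs i t)\<^sup>2 = dx n * (err n vs i 0)\<^sup>2 + 2 * (dx n * (LBINT s. indicator {0<..<t} s * (err n vs i s * r i s)))"
        unfolding sq[OF i] by (simp only: distrib_left mult.left_commute)
    qed
    then show ?thesis unfolding Z energy_def by (simp only: sum.distrib sum_distrib_left)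
  qed
  have disi: "integrable lborel (\<lambda>s. indicator {0<..<t} s * dissipation n vs s)"
    using t by (intro integrable_Ioo_continuous continuous_on_subset[OF dissipation_continuous]) auto
  have gri: "integrable lborel (\<lambda>s. indicator {0<..<t} s * ((Acons M M2 * dx n + energy n vs s) * growth s))"
  proof (rule integrable_continuous_mult[OF _ growth_integrable])
    show "continuous_on {0..T} (\<lambda>s. Acons M M2 * dx n + energy n vs s)"
      by (rule continuous_on_add[OF continuous_on_const energy_continuous])
  qed (use t in simp)
  have all: "AE s in lborel. \<forall>i\<in>{1..n}. s \<in> {0<..<T} \<longrightarrow> (\<forall>V V1 P w. is_slice s V V1 P w \<longrightarrow>
       r i s = ((w (real i * dx n) - flux b p n vs i s) - (w (real (i - 1) * dx n) - flux b p n vs (i - 1) s)) / dx n)"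
    using r(2) by (intro eventually_ball_finite) auto
  have "2 * (LBINT s. indicator {0<..<t} s * Z s) + c1 * (LBINT s. indicator {0<..<t} s * dissipation n vs s)
    = (LBINT s. 2 * (indicator {0<..<t} s * Z s) + c1 * (indicator {0<..<t} s * dissipation n vs s))"
    using Zi disi by simp
  also have "\<dots> \<le> (LBINT s. indicator {0<..<t} s * ((Acons M M2 * dx n + energy n vs s) * growth s))"
  proof (rule integral_mono_AE)
    show "AE s in lborel. 2 * (indicator {0<..<t} s * Z s) + c1 * (indicator {0<..<t} s * dissipation n vs s)
      \<le> indicator {0<..<t} s * ((Acons M M2 * dx n + energy n vs s) * growth s)"
      using all slices
    proof eventually_elim
      case (elim s)
      show ?case
      proof (cases "s \<in> {0<..<t}")
        case True
        then have s: "s \<in> {0<..<T}" using t by auto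
        obtain V V1 P w where sl: "is_slice s V V1 P w" using elim(2) s by blast
        define R where "R = (\<lambda>i. w (real i * dx n) - flux b p n vs i s)"
        have "Z s = (\<Sum>i=1..n. err n vs i s * (R i - R (i - 1)))"
          unfolding Z_def
        proof (rule sum.cong[OF refl])
          fix i assume "i \<in> {1..n}"
          then have "r i s = (R i - R (i - 1)) / dx n" unfolding R_def using elim(1) s sl by blast
          then show "dx n * (err n vs i s * r i s) = err n vs i s * (R i - R (i - 1))" using d by simp
        qed
        moreover have "(\<Sum>i=1..n. err n vs i s * (R i - R (i - 1))) + (c1 / 2) * dissipation n vs s
          \<le> Ken M * (1 + 16 * Gm s) * (Acons M M2 * dx n + energy n vs s)"
          unfolding dissipation_def energy_def
        proof (rule slice.slice_energy[OF sl n])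
          show "R i = w (real i * dx n) - ((vs (i + 1) s - vs i s) / dx n + b ((vs i s + vs (i + 1) s) / 2) * cavg n i (p s))"
            if "1 \<le> i" "i < n" for i
          proof -
            have "1 \<le> i \<and> i \<le> n - 1" using that by linarith
            then show ?thesis by (simp add: R_def flux_def)
          qed
          \<comment> \<open>At both ends the exact flux vanishes by the boundary condition and the
            numerical flux by its default value 0.\<close>
          show "R 0 = 0" using slice.w0[OF sl] by (simp add: R_def flux_def)
          show "R n = 0" using slice.w1[OF sl] n by (simp add: R_def flux_def n_dx[OF n])
        qed (simp add: err_def)
        ultimately have "2 * Z s + c1 * dissipation n vs s \<le> 2 * (Ken M * (1 + 16 * Gm s) * (Acons M M2 * dx n + energy n vs s))"
          by linarith
        then show ?thesis using True s by (simp add: growth_def ac_simps)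
      qed simp
    qed
  qed (use Zi disi gri in auto)
  finally show ?thesis using energy_eq by linarith
qed

text \<open>The scheme starts from the averages of \<open>v0\<close>, which are those of
  \<open>v 0\<close>; the initial error is thus the gap between the mean of \<open>h(v 0)\<close>
  and \<open>h\<close> of the mean.\<close>

lemma initial_energy: "energy n vs 0 \<le> Acons M M2 * dx n"
proof -
  have d: "0 < dx n" by (rule dx_pos[OF n])
  have "energy n vs 0 \<le> (\<Sum>i=1..n. dx n * (Acons M M2 * dx n))"
    unfolding energy_def
  proof (intro sum_mono mult_left_mono)
    fix i assume "i \<in> {1..n}"
    then have i: "1 \<le> i" "i \<le> n" by auto
    have "vs i 0 = cavg n i v0" using fv i by (simp add: fv_solution_def)
    also have "cavg n i v0 = cavg n i (v 0)"
    proof -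
      have m: "(\<lambda>x. indicator {0<..<1} x * v0 x) \<in> borel_measurable borel"
        "(\<lambda>x. indicator {0<..<1} x * v 0 x) \<in> borel_measurable borel"
        using sq_intD(1)[OF v0(1)] sq_intD(1)[OF v_sq[of 0]] T by auto
      have sub: "cell_Ioo n i \<subseteq> {0..1}" using cell_Ioo_subset[OF n i(2)] by fastforce
      have "(LBINT x. indicator (cell_Ioo n i) x * v0 x) = (LBINT x. indicator (cell_Ioo n i) x * v 0 x)"
      proof (rule integral_cong_AE)
        show "AE x in lborel. indicator (cell_Ioo n i) x * v0 x = indicator (cell_Ioo n i) x * v 0 x"
          using v0(2)
        proof eventually_elim
          case (elim x)
          then show ?case
            using subsetD[OF cell_Ioo_subset[OF n i(2)], of x] by (cases "x \<in> cell_Ioo n i") simp_all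
        qed
      qed (use cell_borel_measurable[OF m(1) sub] cell_borel_measurable[OF m(2) sub] in auto)
      then show ?thesis using cavg_eq[OF n i m(1)] cavg_eq[OF n i m(2)] by simp
    qed
    finally show "(err n vs i 0)\<^sup>2 \<le> Acons M M2 * dx n"
      unfolding err_def using initial_consistency[OF n i] by simp
  qed (use d in simp)
  also have "\<dots> = Acons M M2 * dx n" using n_dx[OF n] by (simp add: mult.assoc[symmetric])
  finally show ?thesis .
qed

end

lemma Acons_nonneg: "0 \<le> Acons M M2"
  unfolding Acons_def using M2_nonneg by simp

text \<open>Measurability in time is a premise of \<open>esssup_I\<close>. On \<open>QT T\<close>
  the error equals a jointly measurable \<open>g\<close>, and integrating \<open>g^2\<close> in
  \<open>x\<close> keeps measurability.\<close>

lemma L2_error_measurable: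
  assumes "fv_solution h b p v0 T n vs"
  shows "(\<lambda>s. LINT x:{0<..<1}|lborel. (v s x - vapprox n vs s x)\<^sup>2) \<in> borel_measurable (restrict_space lborel {0<..<T})"
proof -
  define g where "g = (\<lambda>z. indicator (QT T) z * v (fst z) (snd z)
    - (\<Sum>i=1..n. (indicator {0<..<1} (snd z) * indicator (cell n i) (snd z)) * (indicator {0<..<T} (fst z) * vs i (fst z))))"
  have vs: "(\<lambda>s. indicator {0<..<T} s * vs i s) \<in> borel_measurable borel" if "i \<in> {1..n}" for i
  proof -
    have "continuous_on {0..T} (vs i)" using assms that by (simp add: fv_solution_def)
    from borel_measurable_integrable[OF integrable_Ioo_continuous[OF this]] show ?thesis by simp
  qed
  have f: "(fst :: real \<times> real \<Rightarrow> real) \<in> borel_measurable borel" and s: "(snd :: real \<times> real \<Rightarrow> real) \<in> borel_measurable borel"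
    by (auto intro!: borel_measurable_continuous_onI continuous_on_fst continuous_on_snd continuous_on_id)
  have "(\<lambda>z. \<Sum>i=1..n. (indicator {0<..<1} (snd z) * indicator (cell n i) (snd z)) * (indicator {0<..<T} (fst z) * vs i (fst z)))
    \<in> borel_measurable (borel :: (real \<times> real) measure)"
  proof (rule borel_measurable_sum)
    fix i assume i: "i \<in> {1..n}"
    have "(\<lambda>z. indicator {0<..<1} (snd z) * indicator (cell n i) (snd z) :: real) \<in> borel_measurable (borel :: (real \<times> real) measure)"
      by (rule measurable_compose[OF s, of "\<lambda>x. indicator {0<..<1} x * indicator (cell n i) x"]) simp
    moreover have "(\<lambda>z. indicator {0<..<T} (fst z) * vs i (fst z)) \<in> borel_measurable (borel :: (real \<times> real) measure)"
      by (rule measurable_compose[OF f vs[OF i]])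
    ultimately show "(\<lambda>z. (indicator {0<..<1} (snd z) * indicator (cell n i) (snd z)) * (indicator {0<..<T} (fst z) * vs i (fst z)))
      \<in> borel_measurable (borel :: (real \<times> real) measure)"
      by (rule borel_measurable_times)
  qed
  then have "g \<in> borel_measurable (borel \<Otimes>\<^sub>M borel)"
    unfolding g_def borel_prod by (rule borel_measurable_diff[OF v_QT_measurable])
  then have "(\<lambda>s. LBINT x. (g (s, x))\<^sup>2) \<in> borel_measurable borel"
    by measurable
  then have m: "(\<lambda>s. LBINT x. (g (s, x))\<^sup>2) \<in> borel_measurable (restrict_space lborel {0<..<T})"
    by (intro measurable_restrict_space1) simp
  have e: "(LBINT x. (g (s, x))\<^sup>2) = (LINT x:{0<..<1}|lborel. (v s x - vapprox n vs s x)\<^sup>2)"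
    if "s \<in> space (restrict_space lborel {0<..<T})" for s
    unfolding set_lebesgue_integral_def
  proof (intro Bochner_Integration.integral_cong refl)
    fix x
    show "(g (s, x))\<^sup>2 = indicator {0<..<1} x *\<^sub>R (v s x - vapprox n vs s x)\<^sup>2"
      using that by (cases "x \<in> {0<..<1}") (auto simp: g_def indicator_QT vapprox_def space_restrict_space)
  qed
  show ?thesis by (rule measurable_cong[THEN iffD1, OF e m])
qed

lemma convergence:
  assumes v0: "sq_int {0<..<1} v0" "AE x in lborel. x \<in> {0<..<1} \<longrightarrow> v 0 x = v0 x"
  obtains C where "0 < C"
    "\<And>n vs t. n \<ge> 1 \<Longrightarrow> fv_solution h b p v0 T n vs \<Longrightarrow> t \<in> {0..T} \<Longrightarrow>
       esssup (restrict_space lborel {0<..<T}) (\<lambda>s. ereal (LINT x:{0<..<1}|lborel. (v s x - vapprox n vs s x)\<^sup>2))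
       + ereal (LINT \<tau>:{0..t}|lborel. (LINT x:{dx n..1}|lborel. (vx \<tau> x - vtilde n vs \<tau> x)\<^sup>2))
       \<le> ereal (C * dx n powr (1/2))"
proof -
  obtain CG where CG: "0 < CG"
    "\<And>f A t. continuous_on {0..T} f \<Longrightarrow> (\<And>t. t \<in> {0..T} \<Longrightarrow> 0 \<le> f t) \<Longrightarrow> 0 \<le> A \<Longrightarrow>
       (\<And>t. t \<in> {0..T} \<Longrightarrow> f t \<le> A + (LBINT s. indicator {0<..<t} s * (growth s * f s))) \<Longrightarrow>
       t \<in> {0..T} \<Longrightarrow> f t \<le> CG * A"
    using gronwall_integrable[OF growth_integrable growth_nonneg less_imp_le[OF T]] by blast
  define K1 where "K1 = (LBINT s. growth s)"
  define G1 where "G1 = (LBINT s. Gm s)"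
  define A where "A = Acons M M2"
  \<comment> \<open>\<open>A * dx n\<close> bounds the initial energy, and
    \<open>A * K1 * dx n\<close> the time integral of the consistency errors.\<close>
  define A1 where "A1 = A * (1 + K1)"
  have K1: "0 \<le> K1" unfolding K1_def by (intro Bochner_Integration.integral_nonneg growth_nonneg)
  have G1: "0 \<le> G1" unfolding G1_def by (intro Bochner_Integration.integral_nonneg Gm_nonneg)
  have A: "0 \<le> A" "0 \<le> A1" using Acons_nonneg K1 by (auto simp: A_def A1_def)
  \<comment> \<open>\<open>B1\<close> and \<open>B2\<close> arise by inserting the Gronwall bound
    and the resulting dissipation bound into \<open>slice_L2\<close> and
    \<open>slice_H1\<close>.\<close>
  define B1 where "B1 = 2 * M2 + (4 / c1\<^sup>2) * (A + CG * A1)"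
  define B2 where "B2 = 18 * G1 + (2 / c1) * (A1 + CG * A1 * K1)"
  have B: "0 \<le> B1" "0 \<le> B2"
    unfolding B1_def B2_def using A K1 G1 CG(1) c1 M2_nonneg by (auto intro!: add_nonneg_nonneg mult_nonneg_nonneg)
  show ?thesis
  proof (rule that[of "B1 + B2 + 1"])
    show "0 < B1 + B2 + 1" using B by simp
    fix n vs t assume n: "(n::nat) \<ge> 1" and fv: "fv_solution h b p v0 T n vs" and t: "t \<in> {0..T}"
    define d where "d = dx n"
    have d: "0 < d" "d \<le> 1" using dx_pos[OF n] dx_le_1[OF n] by (auto simp: d_def)
    note Ec = energy_continuous[OF n fv v0]
    note E0 = energy_nonneg[OF n fv v0, of]
    have split: "(LBINT s. indicator {0<..<r} s * ((A * d + energy n vs s) * growth s))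
      \<le> A * d * K1 + (LBINT s. indicator {0<..<r} s * (growth s * energy n vs s))" if r: "r \<in> {0..T}" for r
    proof -
      have i1: "integrable lborel (\<lambda>s. indicator {0<..<r} s * (growth s * energy n vs s))"
        using integrable_continuous_mult[OF Ec growth_integrable, of r] r by (simp add: mult.commute)
      have i2: "integrable lborel (\<lambda>s. indicator {0<..<r} s * growth s)"
        by (intro integrable_indicator_mult growth_integrable) simp
      have "(LBINT s. indicator {0<..<r} s * growth s) \<le> K1"
        unfolding K1_def using growth_nonneg
        by (intro integral_mono i2 growth_integrable) (auto simp: indicator_def)
      then have "A * d * (LBINT s. indicator {0<..<r} s * growth s) \<le> A * d * K1"
        using A d by (intro mult_left_mono) auto
      moreover have "(LBINT s. indicator {0<..<r} s * ((A * d + energy n vs s) * growth s))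
        = (LBINT s. A * d * (indicator {0<..<r} s * growth s) + indicator {0<..<r} s * (growth s * energy n vs s))"
        by (intro Bochner_Integration.integral_cong refl) (simp add: algebra_simps)
      ultimately show ?thesis using i1 i2 by simp
    qed
    have main: "energy n vs r + c1 * (LBINT s. indicator {0<..<r} s * dissipation n vs s)
      \<le> A1 * d + (LBINT s. indicator {0<..<r} s * (growth s * energy n vs s))" if r: "r \<in> {0..T}" for r
      using energy_inequality[OF n fv v0 r] initial_energy[OF n fv v0] split[OF r]
      by (simp add: A1_def A_def d_def algebra_simps)
    have dis0: "0 \<le> (LBINT s. indicator {0<..<r} s * dissipation n vs s)" for r
      using dissipation_nonneg[OF n fv v0] by (intro Bochner_Integration.integral_nonneg) auto
    \<comment> \<open>The nonnegative dissipation is dropped for Gronwall; the same inequality then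
      bounds it once the energy is known to be small.\<close>
    have E: "energy n vs r \<le> CG * (A1 * d)" if r: "r \<in> {0..T}" for r
    proof (rule CG(2)[OF Ec _ _ _ r])
      fix u assume u: "u \<in> {0..T}"
      show "energy n vs u \<le> A1 * d + (LBINT s. indicator {0<..<u} s * (growth s * energy n vs s))"
        using main[OF u] dis0[of u] c1 by (smt (verit) mult_nonneg_nonneg)
    qed (use energy_nonneg[OF n fv v0] A d in auto)
    have dis: "(LBINT s. indicator {0<..<t} s * dissipation n vs s) \<le> (A1 + CG * A1 * K1) / c1 * d"
    proof -
      have "(LBINT s. indicator {0<..<t} s * (growth s * energy n vs s)) \<le> (LBINT s. CG * (A1 * d) * growth s)"
      proof (rule integral_mono')
        fix s
        show "indicator {0<..<t} s * (growth s * energy n vs s) \<le> CG * (A1 * d) * growth s"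
          using E[of s] t growth_nonneg[of s] CG(1) A d
          by (cases "s \<in> {0<..<t}") (auto simp: mult.commute[of "growth s"] intro!: mult_right_mono)
        show "0 \<le> CG * (A1 * d) * growth s" using growth_nonneg[of s] CG(1) A d by simp
      qed (use growth_integrable in simp)
      also have "\<dots> = CG * A1 * K1 * d" by (simp add: K1_def)
      finally have "c1 * (LBINT s. indicator {0<..<t} s * dissipation n vs s) \<le> A1 * d + CG * A1 * K1 * d"
        using main[OF t] energy_nonneg[OF n fv v0, of t] by linarith
      then show ?thesis using c1 by (simp add: pos_le_divide_eq field_simps)
    qed
    have part1: "esssup (restrict_space lborel {0<..<T}) (\<lambda>s. ereal (LINT x:{0<..<1}|lborel. (v s x - vapprox n vs s x)\<^sup>2)) \<le> ereal (B1 * d)"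
    proof (rule esssup_I)
      show "(\<lambda>s. ereal (LINT x:{0<..<1}|lborel. (v s x - vapprox n vs s x)\<^sup>2)) \<in> borel_measurable (restrict_space lborel {0<..<T})"
        using L2_error_measurable[OF fv] by simp
      have "AE s in lborel. s \<in> {0<..<T} \<longrightarrow> ereal (LINT x:{0<..<1}|lborel. (v s x - vapprox n vs s x)\<^sup>2) \<le> ereal (B1 * d)"
        using slices
      proof eventually_elim
        case (elim s)
        show ?case
        proof
          assume s: "s \<in> {0<..<T}"
          then obtain V V1 P w where sl: "is_slice s V V1 P w" using elim by blast
          have "(LINT x:{0<..<1}|lborel. (v s x - vapprox n vs s x)\<^sup>2) \<le> 2 * M2 * d + (4 / c1\<^sup>2) * (A * d + energy n vs s)"
            using slice.slice_L2[OF sl n, of "\<lambda>i. err n vs i s" vs s]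
            by (simp add: err_def energy_def set_lebesgue_integral_def A_def d_def)
          also have "\<dots> \<le> 2 * M2 * d + (4 / c1\<^sup>2) * (A * d + CG * (A1 * d))"
            using E[of s] s by (intro add_left_mono mult_left_mono) auto
          also have "\<dots> = B1 * d" by (simp add: B1_def algebra_simps)
          finally show "ereal (LINT x:{0<..<1}|lborel. (v s x - vapprox n vs s x)\<^sup>2) \<le> ereal (B1 * d)" by simp
        qed
      qed
      then show "AE s in restrict_space lborel {0<..<T}. ereal (LINT x:{0<..<1}|lborel. (v s x - vapprox n vs s x)\<^sup>2) \<le> ereal (B1 * d)"
        by (subst AE_restrict_space_iff) auto
    qed
    have part2: "(LINT \<tau>:{0..t}|lborel. (LINT x:{dx n..1}|lborel. (vx \<tau> x - vtilde n vs \<tau> x)\<^sup>2)) \<le> B2 * d"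
    proof -
      have di: "integrable lborel (\<lambda>s. indicator {0<..<t} s * dissipation n vs s)"
        using t by (intro integrable_Ioo_continuous continuous_on_subset[OF dissipation_continuous[OF n fv v0]]) auto
      have "(LINT \<tau>:{0..t}|lborel. (LINT x:{dx n..1}|lborel. (vx \<tau> x - vtilde n vs \<tau> x)\<^sup>2))
        \<le> (LBINT s. 18 * d * Gm s + 2 * (indicator {0<..<t} s * dissipation n vs s))"
        unfolding set_lebesgue_integral_def
      proof (rule integral_mono_AE')
        show "AE s in lborel. indicator {0..t} s *\<^sub>R (LBINT x. indicator {dx n..1} x *\<^sub>R (vx s x - vtilde n vs s x)\<^sup>2)
          \<le> 18 * d * Gm s + 2 * (indicator {0<..<t} s * dissipation n vs s)"
          using slices AE_lborel_singleton[of 0] AE_lborel_singleton[of t]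
        proof eventually_elim
          case (elim s)
          show ?case
          proof (cases "s \<in> {0<..<t}")
            case True
            then obtain V V1 P w where sl: "is_slice s V V1 P w" using elim(1) t by auto
            show ?thesis
              using slice.slice_H1[OF sl n, of vs s] True by (simp add: dissipation_def d_def ac_simps)
          next
            case False
            then have "s \<notin> {0..t}" using elim(2,3) by auto
            then show ?thesis using False Gm_nonneg[of s] d by simp
          qed
        qed
        show "AE s in lborel. 0 \<le> 18 * d * Gm s + 2 * (indicator {0<..<t} s * dissipation n vs s)"
          using Gm_nonneg d dissipation_nonneg[OF n fv v0] by (intro AE_I2 add_nonneg_nonneg mult_nonneg_nonneg) auto
      qed (use di Gm_integrable in simp)
      also have "\<dots> = 18 * d * G1 + 2 * (LBINT s. indicator {0<..<t} s * dissipation n vs s)"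
        using di Gm_integrable by (simp add: G1_def)
      also have "\<dots> \<le> 18 * d * G1 + 2 * ((A1 + CG * A1 * K1) / c1 * d)"
        using dis by simp
      also have "\<dots> = B2 * d" by (simp add: B2_def algebra_simps add_divide_distrib)
      finally show ?thesis .
    qed
    \<comment> \<open>The estimates so far are of first order in \<open>d\<close>; as
      \<open>d <= 1\<close>, they imply the order 1/2 of the statement.\<close>
    have "d \<le> d powr (1/2)"
      using powr_mono'[of "1/2" 1 d] d by simp
    then have "(B1 + B2) * d \<le> (B1 + B2 + 1) * d powr (1/2)"
      using B d by (intro mult_mono) auto
    then have "ereal (B1 * d) + ereal (B2 * d) \<le> ereal ((B1 + B2 + 1) * dx n powr (1/2))"
      by (simp add: d_def algebra_simps)
    moreover have "esssup (restrict_space lborel {0<..<T}) (\<lambda>s. ereal (LINT x:{0<..<1}|lborel. (v s x - vapprox n vs s x)\<^sup>2))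
       + ereal (LINT \<tau>:{0..t}|lborel. (LINT x:{dx n..1}|lborel. (vx \<tau> x - vtilde n vs \<tau> x)\<^sup>2)) \<le> ereal (B1 * d) + ereal (B2 * d)"
      using part1 part2 by (intro add_mono) auto
    ultimately show "esssup (restrict_space lborel {0<..<T}) (\<lambda>s. ereal (LINT x:{0<..<1}|lborel. (v s x - vapprox n vs s x)\<^sup>2))
       + ereal (LINT \<tau>:{0..t}|lborel. (LINT x:{dx n..1}|lborel. (vx \<tau> x - vtilde n vs \<tau> x)\<^sup>2))
       \<le> ereal ((B1 + B2 + 1) * dx n powr (1/2))"
      by (rule order_trans[rotated])
  qed
qed

end



theorem theorem2p2:
  fixes T Ch1 Ch2 Cb1 Cb2 :: real
    and h b v0 v0x :: "real \<Rightarrow> real"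
    and p pt px v vt vx vxx :: "real \<Rightarrow> real \<Rightarrow> real"
  assumes T_pos: "T > 0"
    (* (A1) *)
    and A1_C2: "C2 h" and A1_pos: "Ch1 > 0" "Ch2 > 0"
    and A1_h': "\<And>r. Ch1 \<le> deriv h r \<and> deriv h r \<le> Ch2"
    and A1_h'': "\<And>r. \<bar>deriv (deriv h) r\<bar> \<le> Ch2"
    (* (A2) *)
    and A2_C2: "C2 b" and A2_pos: "Cb1 > 0" "Cb2 > 0"
    and A2_b: "\<And>r. Cb1 \<le> b r \<and> b r \<le> Cb2"
    and A2_b': "\<And>r. \<bar>deriv b r\<bar> \<le> Cb2"
    and A2_b'': "\<And>r. \<bar>deriv (deriv b) r\<bar> \<le> Cb2"
    (* p in W^{1,2}(0,T;H) \<inter> L^\<infinity>(0,T;L^\<infinity>(0,1)) \<inter> L^2(0,T;X);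
       p is taken as its representative in C([0,T];H) *)
    and p_L2: "L2Q T p"
    and p_t: "weak_dt (QT T) p pt" "L2Q T pt"
    and p_x: "weak_dx (QT T) p px" "L2Q T px"
    and p_Linf: "\<exists>M. AE z in lborel. z \<in> QT T \<longrightarrow> \<bar>p (fst z) (snd z)\<bar> \<le> M"
    and p_cont: "cont_L2 T p"
    (* v0 in X = H^1(0,1) *)
    and v0_L2: "sq_int {0<..<1} v0"
    and v0_x: "weak_deriv1 {0<..<1} v0 v0x" "sq_int {0<..<1} v0x"
    (* v in W^{1,2}(0,T;H) \<inter> L^\<infinity>(0,T;X) \<inter> L^2(0,T;H^2(0,1)),
       taken as its representative in C([0,T];H) *)
    and v_L2: "L2Q T v"
    and v_t: "weak_dt (QT T) v vt" "L2Q T vt"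
    and v_x: "weak_dx (QT T) v vx" "L2Q T vx"
    and v_xx: "weak_dx (QT T) vx vxx" "L2Q T vxx"
    and v_LinfX: "\<exists>M. AE t in lborel. t \<in> {0<..<T} \<longrightarrow>
                    (LINT x:{0<..<1}|lborel. (v t x)\<^sup>2 + (vx t x)\<^sup>2) \<le> M"
    and v_cont: "cont_L2 T v"
    (* strong solution *)
    and v_eq: "\<exists>g. weak_dt (QT T) (\<lambda>t x. h (v t x)) g \<and>
                   weak_dx (QT T) (\<lambda>t x. vx t x + b (v t x) * p t x) g"
    and v_bc: "AE t in lborel. t \<in> {0<..<T} \<longrightarrow>
                 (\<exists>w. continuous_on {0..1} w \<and>
                      (AE x in lborel. x \<in> {0<..<1} \<longrightarrow> w x = vx t x + b (v t x) * p t x) \<and>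
                      w 0 = 0 \<and> w 1 = 0)"
    and v_init: "AE x in lborel. x \<in> {0<..<1} \<longrightarrow> v 0 x = v0 x"
  shows "\<exists>C>0. \<forall>n\<ge>3. \<forall>vs. fv_solution h b p v0 T n vs \<longrightarrow>
           (\<forall>t\<in>{0..T}.
              esssup (restrict_space lborel {0<..<T})
                  (\<lambda>s. ereal (LINT x:{0<..<1}|lborel. (v s x - vapprox n vs s x)\<^sup>2))
              + ereal (LINT \<tau>:{0..t}|lborel.
                          (LINT x:{dx n..1}|lborel. (vx \<tau> x - vtilde n vs \<tau> x)\<^sup>2))
              \<le> ereal (C * dx n powr (1/2)))"
proof -
  obtain M where M: "AE z in lborel. z \<in> QT T \<longrightarrow> \<bar>p (fst z) (snd z)\<bar> \<le> M" using p_Linf by blast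
  obtain M2 where M2: "AE t in lborel. t \<in> {0<..<T} \<longrightarrow> (LINT x:{0<..<1}|lborel. (v t x)\<^sup>2 + (vx t x)\<^sup>2) \<le> M2"
    using v_LinfX by blast
  have nl: "nonlinearities h b Ch1 Ch2 Cb2"
  proof
    show "\<bar>b r\<bar> \<le> Cb2" for r using A2_b[of r] A2_pos by linarith
  qed (use A1_C2 A2_C2 A1_pos A2_pos A1_h' A1_h'' A2_b' in auto)
  \<comment> \<open>The bound is raised to at least 0 because it appears under a square root in
    \<open>om2\<close>.\<close>
  have "AE t in lborel. t \<in> {0<..<T} \<longrightarrow> (LINT x:{0<..<1}|lborel. (v t x)\<^sup>2 + (vx t x)\<^sup>2) \<le> max M2 0"
    using M2 by eventually_elim auto
  with nl M interpret strong_solution h b Ch1 Ch2 Cb2 T M "max M2 0" p px v vx vxx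
    by (intro strong_solution.intro strong_solution_axioms.intro)
       (use T_pos p_L2 p_x p_cont v_L2 v_x v_xx v_cont v_eq v_bc in auto)
  show ?thesis
  proof (rule convergence[OF v0_L2 v_init])
    fix C assume C: "0 < C"
      "\<And>n vs t. n \<ge> 1 \<Longrightarrow> fv_solution h b p v0 T n vs \<Longrightarrow> t \<in> {0..T} \<Longrightarrow>
       esssup (restrict_space lborel {0<..<T}) (\<lambda>s. ereal (LINT x:{0<..<1}|lborel. (v s x - vapprox n vs s x)\<^sup>2))
       + ereal (LINT \<tau>:{0..t}|lborel. (LINT x:{dx n..1}|lborel. (vx \<tau> x - vtilde n vs \<tau> x)\<^sup>2))
       \<le> ereal (C * dx n powr (1/2))"
    show ?thesis
    proof (intro exI[of _ C] conjI allI impI ballI C)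
      fix n :: nat assume "3 \<le> n"
      then show "1 \<le> n" by simp
    qed
  qed
qed

end
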